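(* Let $E\subset\mathbb{C}$ be a compact set containing more than one point, with $0\in E$ and $\overline{\mathbb{C}}\setminus E$ simply connected. Let $\mathbf{F}=(F_1,\ldots,F_d)\in\mathcal{H}(E)^d$ and let $\mathbf{m}=(m_1,\ldots,m_d)\in\mathbb{N}^d$ be a fixed multi-index. Suppose that $\mathbf{F}$ has exactly $|\mathbf{m}|$ system poles with respect to $\mathbf{m}$ counting multiplicities. Then, for all sufficiently large $n$, the (monic) polynomials $Q_{n,\mathbf{m}}$ and the approximants $R_{n,\mathbf{m},\alpha}$, $\alpha=1,\ldots,d$, are uniquely determined, and $$\limsup_{n\to\infty}\|Q_{n,\mathbf{m}}-Q_{\mathbf{m}}^{\mathbf{F}}\|^{1/n}=\max\left\{\frac{|\Phi(\xi)|}{\boldsymbol\rho_{\xi}(\mathbf{F},\mathbf{m})}:\xi\in\mathcal{P}(\mathbf{F},\mathbf{m})\right\},$$ where $\|\cdot\|$ denotes the coefficient norm in the space of polynomials. Moreover, for any $\alpha=1,\ldots,d$, any $k=0,1,\ldots,m_\alpha-1$, and any compact subset $K$ of $D_\alpha^{*}(\mathbf{F},\mathbf{m})\setminus\mathcal{P}(\mathbf{F},\mathbf{m})$, $$\limsup_{n\to\infty}\left\|\frac{P_{n,\mathbf{m},k,\alpha}}{Q_{n,\mathbf{m}}}-z^kF_\alpha\right\|_K^{1/n}\le\frac{\|\Phi\|_K}{\boldsymbol\rho_\alpha^{*}(\mathbf{F},\mathbf{m})},$$ where $\|\cdot\|_K$ denotes the sup-norm on $K$ and, if $K\subset E$, $\|\Phi\|_K$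 is replaced by $1$.
   Context: Conventions: $\mathbb{N}=\{1,2,\ldots\}$; $|\mathbf{m}|=m_1+\cdots+m_d$; $1/\infty=0$. The index $\rho=\infty$ is allowed, with $D_\infty=\mathbb{C}$. $\Phi$ is the unique conformal map of $\overline{\mathbb{C}}\setminus E$ onto $\overline{\mathbb{C}}\setminus\{|w|\le1\}$ with $\Phi(\infty)=\infty$ and $\Phi'(\infty)=\lim_{z\to\infty}\Phi(z)/z>0$. For $\rho>1$, $\Gamma_\rho=\{z\in\mathbb{C}:|\Phi(z)|=\rho\}$ and the canonical domain of index $\rho$ is $D_\rho=E\cup\{z\in\mathbb{C}\setminus E:|\Phi(z)|<\rho\}$. If $K\not\subset E$, $\|\Phi\|_K$ is the supremum of $|\Phi|$ over $K\setminus E$. $\mathcal{H}(E)$ is the space of functions holomorphic in some neighborhood of $E$, and $\mathcal{H}(E)^d$ is the set of $d$-tuples of such functions. For $G\in\mathcal{H}(E)$ and an integer $t\ge0$, $\rho_t(G)$ is the index of the largest canonical domain to which $G$ extends as a meromorphic function with at most $t$ poles counting multiplicities (so $\rho_0(G)$ refers to holomorphic extension). The $n$-th Faber coefficient of $G$ is $$[G]_n=\frac{1}{2\pi i}\int_{\Gamma_\rho}\frac{G(t)\Phi'(t)}{\Phi^{n+1}(t)}\,dt,\qquad 1<\rho<\rho_0(G).$$ Simultaneous Padé–Faber approximants: for $n\in\mathbb{N}$ there exist polynomials $Q_{n,\mathbf{m}}\not\equiv0$ and $P_{n,\mathbf{m},k,\alpha}$ with $\deg Q_{n,\mathbf{m}}\le|\mathbf{m}|$,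 $\deg P_{n,\mathbf{m},k,\alpha}\le n-1$, and $$[Q_{n,\mathbf{m}}z^kF_\alpha-P_{n,\mathbf{m},k,\alpha}]_j=0,\qquad j=0,1,\ldots,n,$$ for all $k=0,\ldots,m_\alpha-1$ and $\alpha=1,\ldots,d$. $Q_{n,\mathbf{m}}$ is normalized to be monic; for each $n$ one solution is chosen. Set $R_{n,\mathbf{m},\alpha}=P_{n,\mathbf{m},0,\alpha}/Q_{n,\mathbf{m}}$. System poles: $\xi\in\mathbb{C}$ (necessarily $\xi\notin E$) is a system pole of order $\tau$ of $\mathbf{F}$ with respect to $\mathbf{m}$ if $\tau$ is the largest positive integer such that for each $t=1,\ldots,\tau$ there is at least one polynomial combination $$G=\sum_{\alpha=1}^d v_\alpha F_\alpha,\qquad \deg v_\alpha<m_\alpha,\ \alpha=1,\ldots,d,\qquad( * )$$ which is holomorphic on a neighborhood of $\overline{D}_{|\Phi(\xi)|}$ except for a pole at $z=\xi$ of exact order $t$. System poles are counted with their order. $Q^{\mathbf{F}}_{\mathbf{m}}$ is the monic polynomial whose zeros are the system poles of $\mathbf{F}$ with respect to $\mathbf{m}$, with multiplicity equal to their order; $\mathcal{P}(\mathbf{F},\mathbf{m})$ is the set of its distinct zeros. For a system pole $\xi$ of order $\tau$ and $t=1,\ldots,\tau$, $\rho_{\xi,t}(\mathbf{F},\mathbf{m})$ is the largest (it is attained) of the numbers $\rho_t(G)$ over all $G$ of the form $( * )$ that are holomorphic on a neighborhood of $\overline{D}_{|\Phi(\xi)|}$ except for a pole at $\xi$ of order $t$.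 Then $\boldsymbol\rho_{\xi,t}(\mathbf{F},\mathbf{m})=\min_{k=1,\ldots,t}\rho_{\xi,k}(\mathbf{F},\mathbf{m})$ and $\boldsymbol\rho_\xi(\mathbf{F},\mathbf{m})=\boldsymbol\rho_{\xi,\tau}(\mathbf{F},\mathbf{m})$. For $\alpha\in\{1,\ldots,d\}$, $D_\alpha(\mathbf{F},\mathbf{m})$ is the largest canonical domain in which all the poles of $F_\alpha$ are system poles of $\mathbf{F}$ with respect to $\mathbf{m}$, their order as poles of $F_\alpha$ does not exceed their order as system poles, and $F_\alpha$ has no other singularity; $\boldsymbol\rho_\alpha(\mathbf{F},\mathbf{m})$ is its index. If $\xi_1,\ldots,\xi_N$ are the poles of $F_\alpha$ in $D_\alpha(\mathbf{F},\mathbf{m})$ and $\hat\tau_j$ is the order of $\xi_j$ as a pole of $F_\alpha$, then $$\boldsymbol\rho_\alpha^{*}(\mathbf{F},\mathbf{m})=\min\Big\{\boldsymbol\rho_\alpha(\mathbf{F},\mathbf{m}),\min_{j=1,\ldots,N}\boldsymbol\rho_{\xi_j,\hat\tau_j}(\mathbf{F},\mathbf{m})\Big\},$$ and $D_\alpha^{*}(\mathbf{F},\mathbf{m})$ is the canonical domain with this index. *)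

theory Defs
  imports "HOL-Complex_Analysis.Complex_Analysis"
    "HOL-Computational_Algebra.Computational_Algebra"
begin

section \<open>The set \<open>E\<close>, its exterior map and the canonical domains\<close>

text \<open>The library defines \<^const>\<open>simply_connected\<close> only for subsets of a type; the following is the
  same definition (any two loops are homotopic through loops) for an abstract topology, so that
  it can be used on the Riemann sphere, the Alexandroff compactification of the plane.\<close>

definition simply_connected_space :: "'a topology \<Rightarrow> bool" where
  "simply_connected_space X \<longleftrightarrow>
     (\<forall>p q. pathin X p \<and> p 1 = p 0 \<and> pathin X q \<and> q 1 = q 0 \<longrightarrow>
        homotopic_with (\<lambda>r. r 1 = r 0) (top_of_set {0..1::real}) X p q)"

lemma simply_connected_space_top_of_set:
  "simply_connected_space (top_of_set S) \<longleftrightarrow> simply_connected S"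
  unfolding simply_connected_space_def simply_connected_def homotopic_loops_def
    pathin_def path_def path_image_def pathstart_def pathfinish_def
  by (simp add: image_subset_iff_funcset conj_ac)

definition sphere_complement :: "complex set \<Rightarrow> complex option topology" where
  "sphere_complement E =
     subtopology (Alexandroff_compactification euclidean) (- (Some ` E))"

text \<open>The map of the sphere fixes infinity, so it is given by its restriction to the finite part
  of the complement of \<open>E\<close>. Values of \<open>\<Phi>\<close> on \<open>E\<close> are irrelevant and are never used.\<close>

definition exterior_map :: "complex set \<Rightarrow> (complex \<Rightarrow> complex) \<Rightarrow> bool" where
  "exterior_map E \<Phi> \<longleftrightarrow>
     \<Phi> holomorphic_on (- E) \<and> bij_betw \<Phi> (- E) {w. 1 < norm w} \<and>
     (\<exists>c::real. 0 < c \<and> ((\<lambda>z. \<Phi> z / z) \<longlongrightarrow> of_real c) at_infinity)"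

definition canonical_domain :: "complex set \<Rightarrow> (complex \<Rightarrow> complex) \<Rightarrow> ereal \<Rightarrow> complex set" where
  "canonical_domain E \<Phi> \<rho> = E \<union> {z. z \<notin> E \<and> ereal (norm (\<Phi> z)) < \<rho>}"

text \<open>The level curve \<open>|\<Phi>| = \<rho>\<close>, traversed once counterclockwise.\<close>

definition level_path :: "complex set \<Rightarrow> (complex \<Rightarrow> complex) \<Rightarrow> real \<Rightarrow> real \<Rightarrow> complex" where
  "level_path E \<Phi> \<rho> = inv_into (- E) \<Phi> \<circ> circlepath 0 \<rho>"


section \<open>Meromorphic extension\<close>

text \<open>An element of \<open>\<H>(E)\<close> is represented by a function that is \<^const>\<open>analytic_on\<close> \<open>E\<close>. Only its
  germ along \<open>E\<close> matters: beyond a neighbourhood of \<open>E\<close>, the paper's function is its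
  meromorphic extension, not the given HOL function.\<close>

definition is_mero_ext ::
    "complex set \<Rightarrow> complex set \<Rightarrow> (complex \<Rightarrow> complex) \<Rightarrow> (complex \<Rightarrow> complex) \<Rightarrow> bool" where
  "is_mero_ext E D G g \<longleftrightarrow>
     g nicely_meromorphic_on D \<and> (\<exists>U. open U \<and> E \<subseteq> U \<and> (\<forall>z\<in>U. g z = G z))"

definition mero_ext ::
    "complex set \<Rightarrow> complex set \<Rightarrow> (complex \<Rightarrow> complex) \<Rightarrow> complex \<Rightarrow> complex" where
  "mero_ext E D G = (SOME g. is_mero_ext E D G g)"

definition pole_order :: "(complex \<Rightarrow> complex) \<Rightarrow> complex \<Rightarrow> nat" where
  "pole_order g z = nat (- zorder g z)"

definition poles_in :: "(complex \<Rightarrow> complex) \<Rightarrow> complex set \<Rightarrow> complex set" where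
  "poles_in g D = {z \<in> D. is_pole g z}"

text \<open>\<open>\<rho>\<^sub>t(G)\<close>. Extensions to increasing canonical domains are compatible, so the supremum is
  attained and is the index of the largest domain.\<close>

definition rho_mero ::
    "complex set \<Rightarrow> (complex \<Rightarrow> complex) \<Rightarrow> nat \<Rightarrow> (complex \<Rightarrow> complex) \<Rightarrow> ereal" where
  "rho_mero E \<Phi> t G = Sup {\<rho>. 1 < \<rho> \<and>
     (\<exists>g. is_mero_ext E (canonical_domain E \<Phi> \<rho>) G g \<and>
          finite (poles_in g (canonical_domain E \<Phi> \<rho>)) \<and>
          (\<Sum>z\<in>poles_in g (canonical_domain E \<Phi> \<rho>). pole_order g z) \<le> t)}"

definition faber_coeff ::
    "complex set \<Rightarrow> (complex \<Rightarrow> complex) \<Rightarrow> (complex \<Rightarrow> complex) \<Rightarrow> nat \<Rightarrow> complex" where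
  "faber_coeff E \<Phi> G n =
     (THE c. \<forall>\<rho>. 1 < \<rho> \<and> ereal \<rho> < rho_mero E \<Phi> 0 G \<longrightarrow>
        c = 1 / (2 * of_real pi * \<i>) *
          contour_integral (level_path E \<Phi> \<rho>)
            (\<lambda>t. mero_ext E (canonical_domain E \<Phi> (rho_mero E \<Phi> 0 G)) G t * deriv \<Phi> t
                   / \<Phi> t ^ (n + 1)))"


section \<open>Simultaneous Pade-Faber approximants\<close>

text \<open>Systems are indexed by \<open>\<alpha> \<in> {1..d}\<close>; the numerator \<open>P\<^sub>n\<^sub>,\<^sub>m\<^sub>,\<^sub>k\<^sub>,\<^sub>\<alpha>\<close> is \<open>P k \<alpha>\<close>.\<close>

definition msize :: "nat \<Rightarrow> (nat \<Rightarrow> nat) \<Rightarrow> nat" where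
  "msize d m = (\<Sum>\<alpha>=1..d. m \<alpha>)"

definition pade_faber ::
    "complex set \<Rightarrow> (complex \<Rightarrow> complex) \<Rightarrow> nat \<Rightarrow> (nat \<Rightarrow> nat) \<Rightarrow> (nat \<Rightarrow> complex \<Rightarrow> complex) \<Rightarrow>
     nat \<Rightarrow> complex poly \<Rightarrow> (nat \<Rightarrow> nat \<Rightarrow> complex poly) \<Rightarrow> bool" where
  "pade_faber E \<Phi> d m F n Q P \<longleftrightarrow>
     lead_coeff Q = 1 \<and> degree Q \<le> msize d m \<and>
     (\<forall>\<alpha>\<in>{1..d}. \<forall>k<m \<alpha>. degree (P k \<alpha>) \<le> n - 1 \<and>
        (\<forall>j\<le>n. faber_coeff E \<Phi> (\<lambda>z. poly Q z * z ^ k * F \<alpha> z - poly (P k \<alpha>) z) j = 0))"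


section \<open>System poles\<close>

definition poly_comb ::
    "nat \<Rightarrow> (nat \<Rightarrow> complex \<Rightarrow> complex) \<Rightarrow> (nat \<Rightarrow> complex poly) \<Rightarrow> complex \<Rightarrow> complex" where
  "poly_comb d F v = (\<lambda>z. \<Sum>\<alpha>=1..d. poly (v \<alpha>) z * F \<alpha> z)"

text \<open>The polynomial combinations that are holomorphic on a neighbourhood of the closure of
  \<open>D\<^sub>|\<^sub>\<Phi>\<^sub>(\<^sub>\<xi>\<^sub>)\<^sub>|\<close> except for a pole at \<open>\<xi>\<close> of exact order \<open>t\<close>. Since \<open>m \<alpha> \<ge> 1\<close>, the condition
  \<open>degree (v \<alpha>) < m \<alpha>\<close> allows \<open>v \<alpha> = 0\<close>.\<close>

definition pole_combs ::
    "complex set \<Rightarrow> (complex \<Rightarrow> complex) \<Rightarrow> nat \<Rightarrow> (nat \<Rightarrow> nat) \<Rightarrow> (nat \<Rightarrow> complex \<Rightarrow> complex) \<Rightarrow>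
     complex \<Rightarrow> nat \<Rightarrow> (complex \<Rightarrow> complex) set" where
  "pole_combs E \<Phi> d m F \<xi> t =
     {G. (\<exists>v. (\<forall>\<alpha>\<in>{1..d}. degree (v \<alpha>) < m \<alpha>) \<and> G = poly_comb d F v) \<and>
         (\<exists>V g. open V \<and> closure (canonical_domain E \<Phi> (ereal (norm (\<Phi> \<xi>)))) \<subseteq> V \<and>
            is_mero_ext E V G g \<and> poles_in g V = {\<xi>} \<and> pole_order g \<xi> = t)}"

definition system_pole_of_order ::
    "complex set \<Rightarrow> (complex \<Rightarrow> complex) \<Rightarrow> nat \<Rightarrow> (nat \<Rightarrow> nat) \<Rightarrow> (nat \<Rightarrow> complex \<Rightarrow> complex) \<Rightarrow>
     complex \<Rightarrow> nat \<Rightarrow> bool" where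
  "system_pole_of_order E \<Phi> d m F \<xi> \<tau> \<longleftrightarrow>
     \<xi> \<notin> E \<and> 1 \<le> \<tau> \<and> (\<forall>t\<in>{1..\<tau>}. pole_combs E \<Phi> d m F \<xi> t \<noteq> {}) \<and>
     (\<forall>\<tau>'. (\<forall>t\<in>{1..\<tau>'}. pole_combs E \<Phi> d m F \<xi> t \<noteq> {}) \<longrightarrow> \<tau>' \<le> \<tau>)"

definition system_poles ::
    "complex set \<Rightarrow> (complex \<Rightarrow> complex) \<Rightarrow> nat \<Rightarrow> (nat \<Rightarrow> nat) \<Rightarrow> (nat \<Rightarrow> complex \<Rightarrow> complex) \<Rightarrow>
     complex set" where
  "system_poles E \<Phi> d m F = {\<xi>. \<exists>\<tau>. system_pole_of_order E \<Phi> d m F \<xi> \<tau>}"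

definition system_order ::
    "complex set \<Rightarrow> (complex \<Rightarrow> complex) \<Rightarrow> nat \<Rightarrow> (nat \<Rightarrow> nat) \<Rightarrow> (nat \<Rightarrow> complex \<Rightarrow> complex) \<Rightarrow>
     complex \<Rightarrow> nat" where
  "system_order E \<Phi> d m F \<xi> = (THE \<tau>. system_pole_of_order E \<Phi> d m F \<xi> \<tau>)"

definition system_pole_poly ::
    "complex set \<Rightarrow> (complex \<Rightarrow> complex) \<Rightarrow> nat \<Rightarrow> (nat \<Rightarrow> nat) \<Rightarrow> (nat \<Rightarrow> complex \<Rightarrow> complex) \<Rightarrow>
     complex poly" where
  "system_pole_poly E \<Phi> d m F =
     (\<Prod>\<xi>\<in>system_poles E \<Phi> d m F. [:- \<xi>, 1:] ^ system_order E \<Phi> d m F \<xi>)"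


section \<open>The indices governing the rates of convergence\<close>

text \<open>\<open>\<rho>\<^sub>\<xi>\<^sub>,\<^sub>t(F,m)\<close>, its running minimum over \<open>1, \<dots>, t\<close> (boldface in the paper), and
  the value of the latter at the order of \<open>\<xi>\<close>.\<close>

definition rho_pole ::
    "complex set \<Rightarrow> (complex \<Rightarrow> complex) \<Rightarrow> nat \<Rightarrow> (nat \<Rightarrow> nat) \<Rightarrow> (nat \<Rightarrow> complex \<Rightarrow> complex) \<Rightarrow>
     complex \<Rightarrow> nat \<Rightarrow> ereal" where
  "rho_pole E \<Phi> d m F \<xi> t = (SUP G\<in>pole_combs E \<Phi> d m F \<xi> t. rho_mero E \<Phi> t G)"

definition bold_rho_pole ::
    "complex set \<Rightarrow> (complex \<Rightarrow> complex) \<Rightarrow> nat \<Rightarrow> (nat \<Rightarrow> nat) \<Rightarrow> (nat \<Rightarrow> complex \<Rightarrow> complex) \<Rightarrow>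
     complex \<Rightarrow> nat \<Rightarrow> ereal" where
  "bold_rho_pole E \<Phi> d m F \<xi> t = Min (rho_pole E \<Phi> d m F \<xi> ` {1..t})"

definition bold_rho ::
    "complex set \<Rightarrow> (complex \<Rightarrow> complex) \<Rightarrow> nat \<Rightarrow> (nat \<Rightarrow> nat) \<Rightarrow> (nat \<Rightarrow> complex \<Rightarrow> complex) \<Rightarrow>
     complex \<Rightarrow> ereal" where
  "bold_rho E \<Phi> d m F \<xi> = bold_rho_pole E \<Phi> d m F \<xi> (system_order E \<Phi> d m F \<xi>)"

text \<open>The index of \<open>D\<^sub>\<alpha>(F,m)\<close>; as for \<^const>\<open>rho_mero\<close>, the supremum is attained.\<close>

definition rho_comp ::
    "complex set \<Rightarrow> (complex \<Rightarrow> complex) \<Rightarrow> nat \<Rightarrow> (nat \<Rightarrow> nat) \<Rightarrow> (nat \<Rightarrow> complex \<Rightarrow> complex) \<Rightarrow>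
     nat \<Rightarrow> ereal" where
  "rho_comp E \<Phi> d m F \<alpha> = Sup {\<rho>. 1 < \<rho> \<and>
     (\<exists>g. is_mero_ext E (canonical_domain E \<Phi> \<rho>) (F \<alpha>) g \<and>
          (\<forall>z\<in>poles_in g (canonical_domain E \<Phi> \<rho>).
             z \<in> system_poles E \<Phi> d m F \<and> pole_order g z \<le> system_order E \<Phi> d m F z))}"

text \<open>If \<open>F\<^sub>\<alpha>\<close> has no poles in \<open>D\<^sub>\<alpha>(F,m)\<close>, the infimum is \<open>\<infinity>\<close> and drops out.\<close>

definition rho_star ::
    "complex set \<Rightarrow> (complex \<Rightarrow> complex) \<Rightarrow> nat \<Rightarrow> (nat \<Rightarrow> nat) \<Rightarrow> (nat \<Rightarrow> complex \<Rightarrow> complex) \<Rightarrow>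
     nat \<Rightarrow> ereal" where
  "rho_star E \<Phi> d m F \<alpha> =
     (let D = canonical_domain E \<Phi> (rho_comp E \<Phi> d m F \<alpha>);
          f = mero_ext E D (F \<alpha>)
      in min (rho_comp E \<Phi> d m F \<alpha>)
             (INF \<xi>\<in>poles_in f D. bold_rho_pole E \<Phi> d m F \<xi> (pole_order f \<xi>)))"

definition D_star ::
    "complex set \<Rightarrow> (complex \<Rightarrow> complex) \<Rightarrow> nat \<Rightarrow> (nat \<Rightarrow> nat) \<Rightarrow> (nat \<Rightarrow> complex \<Rightarrow> complex) \<Rightarrow>
     nat \<Rightarrow> complex set" where
  "D_star E \<Phi> d m F \<alpha> = canonical_domain E \<Phi> (rho_star E \<Phi> d m F \<alpha>)"


section \<open>Norms\<close>

definition coeff_norm :: "complex poly \<Rightarrow> real" where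
  "coeff_norm p = Max ((\<lambda>i. norm (coeff p i)) ` {..degree p})"

text \<open>The inserted \<open>0\<close> makes the norm over the empty set \<open>0\<close> and has no other effect. On an
  unbounded function the value is unspecified.\<close>

definition sup_norm :: "complex set \<Rightarrow> (complex \<Rightarrow> complex) \<Rightarrow> real" where
  "sup_norm K f = Sup (insert 0 ((\<lambda>z. norm (f z)) ` K))"

definition Phi_norm :: "complex set \<Rightarrow> (complex \<Rightarrow> complex) \<Rightarrow> complex set \<Rightarrow> real" where
  "Phi_norm E \<Phi> K = (if K \<subseteq> E then 1 else sup_norm (K - E) \<Phi>)"

end

theory Submission
  imports Defs
begin

text \<open>
  Write \<open>\<Psi>\<close> for the inverse of \<open>\<Phi>\<close>. The Faber coefficients of \<open>G\<close> are the Laurent coefficients of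
  \<open>G \<circ> \<Psi>\<close>, and by Cauchy's formula on the level curves of \<open>\<Phi>\<close> their decay determines the largest
  canonical domain to which \<open>G\<close> extends holomorphically. A monic denominator \<open>q\<close> satisfies
  \<open>[q G]\<^sub>n = 0\<close> for every polynomial combination \<open>G\<close> of the system. Applied to combinations whose only
  pole is the system pole \<open>\<xi>\<close>, of order \<open>1, 2, \<dots>\<close> in turn, this forces the Taylor coefficients of \<open>q\<close>
  at \<open>\<xi>\<close> of index below the order of \<open>\<xi>\<close> to decay geometrically. There are \<open>|m|\<close> of them in total, and
  together with the leading coefficient they determine \<open>q\<close> by Hermite interpolation; hence \<open>q\<close> is
  eventually unique and converges at the stated rate.

  Conversely, if the denominators \<open>q\<^sub>n\<close> converged to \<open>Q\<close> at a rate \<open>\<theta>\<close>, then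
  \<open>[Q G]\<^sub>n = [(Q - q\<^sub>n) G]\<^sub>n\<close> would be small enough for \<open>Q G\<close> to extend to a canonical domain whose index
  is governed by \<open>\<theta>\<close>; clearing the poles of \<open>G\<close> other than \<open>\<xi>\<close> by subtracting combinations bounds
  \<open>\<theta>\<close> from below.

  For the approximants, split \<open>q z\<^sup>k F\<^sub>\<alpha>\<close> into partial fractions at the system poles. Expanding \<open>q\<close> at each
  pole, the numerator is a sum of Faber sections weighted with the Taylor coefficients of \<open>q\<close>, whose
  decay compensates the growth of the sections outside the level curve through the pole. The
  resulting bound on level curves is carried to compact sets by the maximum principle.
\<close>

section \<open>Integrals over circles\<close>

text \<open>Faber polynomials are not constructed. In the coordinate w = \<Phi> z the kernel
  \<Psi>'(w) / (\<Psi> w - z) behaves like 1 / w at infinity, so it annihilates the principal part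
  of N \<circ> \<Psi>; hence N is recovered from its coefficients of nonnegative index, with one
  constant that serves all N at once. The pole orders are treated in turn because a multiple pole
  would contribute a polynomial in n times a power of \<Phi> \<xi>. After expanding q at \<xi>, a
  pole of order i + 1 leaves a simple pole exactly in the term of index i, and its contribution is
  known exactly. The price is a slightly larger radius for the lower indices; it is harmless, since
  all radii stay strictly below the index. The obstacle in the lower bound is that Q also vanishes
  at the other system poles, so an extension of Q G leaves possible poles of G beyond the level of
  \<xi>. Clearing them requires combinations for the outer poles that reach the same radius, whence
  an induction on the number of system poles beyond \<xi>. Partial fractions are used for the
  approximants because an expansion of q at one pole shows only the decay that belongs to that
  pole.\<close>

definition circle_coeff :: "(complex \<Rightarrow> complex) \<Rightarrow> real \<Rightarrow> nat \<Rightarrow> complex" where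
  "circle_coeff f r n =
     1 / (2 * of_real pi * \<i>) * contour_integral (circlepath 0 r) (\<lambda>w. f w / w ^ (n + 1))"

text \<open>The straight segments between corresponding points of the two circles stay in the closed
  annulus, so the circles are homotopic in S.\<close>

lemma contour_integral_circle_radius:
  fixes f :: "complex \<Rightarrow> complex"
  assumes "0 < r" "r \<le> s" and S: "open S" "{w. r \<le> norm w \<and> norm w \<le> s} \<subseteq> S"
    and f: "f holomorphic_on S"
  shows "contour_integral (circlepath 0 r) f = contour_integral (circlepath 0 s) f"
proof (rule Cauchy_theorem_homotopic_loops[OF _ S(1) f])
  show "homotopic_loops S (circlepath 0 r) (circlepath 0 s)"
  proof (rule homotopic_loops_linear)
    fix t :: real
    show "closed_segment (circlepath 0 r t) (circlepath 0 s t) \<subseteq> S"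
    proof
      fix x assume "x \<in> closed_segment (circlepath 0 r t) (circlepath 0 s t)"
      then obtain u where u: "0 \<le> u" "u \<le> 1"
        "x = (1 - u) *\<^sub>R circlepath 0 r t + u *\<^sub>R circlepath 0 s t"
        by (auto simp: closed_segment_def)
      have "x = of_real ((1 - u) * r + u * s) * exp (2 * of_real pi * \<i> * of_real t)"
        by (simp add: u(3) circlepath scaleR_conv_of_real algebra_simps)
      then have "norm x = \<bar>(1 - u) * r + u * s\<bar>"
        by (simp only: norm_mult norm_of_real) (simp add: norm_exp_eq_Re)
      moreover have "r \<le> (1 - u) * r + u * s"
        using mult_left_mono[OF assms(2) u(1)] by (simp add: algebra_simps)
      moreover have "(1 - u) * r + u * s \<le> s"
        using mult_left_mono[OF assms(2), of "1 - u"] u by (simp add: algebra_simps)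
      ultimately show "x \<in> S" using S(2) assms(1) by auto
    qed
  qed auto
qed auto

lemma circle_coeff_radius:
  assumes "0 < r" "r \<le> s" and S: "open S" "{w. r \<le> norm w \<and> norm w \<le> s} \<subseteq> S"
    and f: "f holomorphic_on S"
  shows "circle_coeff f r n = circle_coeff f s n"
proof -
  have "contour_integral (circlepath 0 r) (\<lambda>w. f w / w ^ (n + 1)) =
    contour_integral (circlepath 0 s) (\<lambda>w. f w / w ^ (n + 1))"
    by (rule contour_integral_circle_radius[of r s "S - {0}"])
      (use assms in \<open>auto intro!: holomorphic_intros intro: holomorphic_on_subset\<close>)
  then show ?thesis by (simp add: circle_coeff_def)
qed

lemma circle_coeff_bound:
  assumes "0 < r" and c: "continuous_on (sphere 0 r) f" and B: "\<And>w. norm w = r \<Longrightarrow> norm (f w) \<le> B"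
  shows "norm (circle_coeff f r n) \<le> B / r ^ n"
proof -
  have "(\<lambda>w. f w / w ^ (n + 1)) contour_integrable_on (circlepath 0 r)"
    by (rule contour_integrable_continuous_circlepath)
      (use assms(1) c in \<open>auto intro!: continuous_intros\<close>)
  then have "((\<lambda>w. f w / w ^ (n + 1)) has_contour_integral
     contour_integral (circlepath 0 r) (\<lambda>w. f w / w ^ (n + 1))) (circlepath 0 r)"
    by (rule has_contour_integral_integral)
  moreover have "norm (f (of_real r)) \<le> B" using B[of "of_real r"] assms(1) by simp
  then have "0 \<le> B" using norm_ge_zero order_trans by blast
  ultimately have "norm (contour_integral (circlepath 0 r) (\<lambda>w. f w / w ^ (n + 1))) \<le>
      B / r ^ (n + 1) * (2 * pi * r)"
    using assms(1) B
    by (intro has_contour_integral_bound_circlepath[where z = 0])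
      (auto simp: norm_divide norm_power norm_mult intro!: divide_right_mono)
  then have "norm (circle_coeff f r n) \<le> 1 / (2 * pi) * (B / r ^ (n + 1) * (2 * pi * r))"
    unfolding circle_coeff_def
    by (simp add: norm_divide norm_mult field_simps del: power_Suc)
  also have "\<dots> = B / r ^ n" using assms(1) by (simp add: field_simps)
  finally show ?thesis .
qed

lemma circle_coeff_cong:
  assumes "0 < r" "\<And>w. norm w = r \<Longrightarrow> f w = g w"
  shows "circle_coeff f r n = circle_coeff g r n"
  unfolding circle_coeff_def
  by (intro arg_cong[of _ _ "\<lambda>x. 1 / (2 * of_real pi * \<i>) * x"] contour_integral_cong)
    (use assms in auto)

lemma circle_coeff_add:
  assumes "0 < r" "continuous_on (sphere 0 r) f" "continuous_on (sphere 0 r) g"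
  shows "circle_coeff (\<lambda>w. f w + g w) r n = circle_coeff f r n + circle_coeff g r n"
proof -
  have "(\<lambda>w. f w / w ^ (n + 1)) contour_integrable_on (circlepath 0 r)"
    "(\<lambda>w. g w / w ^ (n + 1)) contour_integrable_on (circlepath 0 r)"
    by (rule contour_integrable_continuous_circlepath;
        use assms in \<open>auto intro!: continuous_intros\<close>)+
  from contour_integral_add[OF this] show ?thesis
    by (simp add: circle_coeff_def add_divide_distrib)
qed

lemma circle_coeff_cmult:
  assumes "0 < r" "continuous_on (sphere 0 r) f"
  shows "circle_coeff (\<lambda>w. c * f w) r n = c * circle_coeff f r n"
proof -
  have "(\<lambda>w. f w / w ^ (n + 1)) contour_integrable_on (circlepath 0 r)"
    by (rule contour_integrable_continuous_circlepath;
        use assms in \<open>auto intro!: continuous_intros\<close>)+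
  from contour_integral_lmul[OF this, of c] show ?thesis
    by (simp add: circle_coeff_def mult.assoc)
qed

lemma circle_coeff_diff:
  assumes "0 < r" "continuous_on (sphere 0 r) f" "continuous_on (sphere 0 r) g"
  shows "circle_coeff (\<lambda>w. f w - g w) r n = circle_coeff f r n - circle_coeff g r n"
proof -
  have "circle_coeff (\<lambda>w. f w + (-1) * g w) r n = circle_coeff f r n + (-1) * circle_coeff g r n"
    using assms circle_coeff_cmult[OF assms(1,3), of "-1"]
    by (subst circle_coeff_add) (auto intro!: continuous_intros)
  then show ?thesis by simp
qed

lemma circle_coeff_sum:
  assumes "0 < r" "\<And>i. i \<in> I \<Longrightarrow> continuous_on (sphere 0 r) (f i)"
  shows "circle_coeff (\<lambda>w. \<Sum>i\<in>I. f i w) r n = (\<Sum>i\<in>I. circle_coeff (f i) r n)"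
  using assms(2)
proof (induction I rule: infinite_finite_induct)
  case (insert i I)
  then show ?case using assms(1)
    by (simp add: circle_coeff_add continuous_on_sum)
qed (auto simp: circle_coeff_def)

text \<open>The radius may be sent to infinity, where f differs from l w^n by at most e |w|^n. It is
  used in three ways: to discard principal parts, to evaluate the Cauchy kernel of \<Psi>, and to
  find the top coefficient of a polynomial in \<Psi>.\<close>

lemma circle_coeff_lim:
  assumes "0 \<le> A" "A < r" and f: "f holomorphic_on {w. A < norm w}"
    and lim: "((\<lambda>w. f w / w ^ n) \<longlongrightarrow> l) at_infinity"
  shows "circle_coeff f r n = l"
proof -
  have op: "open {w::complex. A < norm w}" by (intro open_Collect_less continuous_intros)
  have cont: "continuous_on (sphere 0 s) f" if "s \<ge> r" for s
    by (rule continuous_on_subset[OF holomorphic_on_imp_continuous_on[OF f]]) (use assms that in auto)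
  have one: "circle_coeff (\<lambda>w. l * w ^ n) s n = l" if "s \<ge> r" for s
  proof -
    have "contour_integral (circlepath 0 s) (\<lambda>w. w ^ n / w ^ (n + 1)) =
       contour_integral (circlepath 0 s) (\<lambda>w. 1 / (w - 0))"
      by (rule contour_integral_cong) (use assms that in auto)
    also have "\<dots> = 2 * of_real pi * \<i>"
      by (rule contour_integral_circlepath) (use assms that in auto)
    finally have "circle_coeff (\<lambda>w. w ^ n) s n = 1" by (simp add: circle_coeff_def)
    then show ?thesis using assms that by (subst circle_coeff_cmult) (auto intro!: continuous_intros)
  qed
  have "norm (circle_coeff f r n - l) \<le> e" if "e > 0" for e
  proof -
    from lim that obtain b where b: "\<And>w. norm w \<ge> b \<Longrightarrow> norm (f w / w ^ n - l) < e"
      unfolding tendsto_iff eventually_at_infinity dist_norm by blast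
    define s where "s = max r b"
    have s: "s \<ge> r" "s \<ge> b" "s > 0" using assms by (auto simp: s_def)
    have "circle_coeff f r n - l = circle_coeff f s n - circle_coeff (\<lambda>w. l * w ^ n) s n"
      unfolding one[OF s(1)] using circle_coeff_radius[of r s "{w. A < norm w}" f n] assms s op by force
    also have "\<dots> = circle_coeff (\<lambda>w. f w - l * w ^ n) s n"
      by (rule circle_coeff_diff[symmetric]) (use s cont in \<open>auto intro!: continuous_intros\<close>)
    also have "norm \<dots> \<le> (e * s ^ n) / s ^ n"
    proof (rule circle_coeff_bound)
      fix w :: complex assume w: "norm w = s"
      then have "w \<noteq> 0" using s by auto
      then have "f w - l * w ^ n = (f w / w ^ n - l) * w ^ n" by (simp add: field_simps)
      then show "norm (f w - l * w ^ n) \<le> e * s ^ n"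
        using b[of w] w s by (auto simp: norm_mult norm_power intro!: mult_right_mono less_imp_le)
    qed (use s cont in \<open>auto intro!: continuous_intros\<close>)
    finally show ?thesis using s by simp
  qed
  then show ?thesis
    by (metis dense eq_iff_diff_eq_0 norm_le_zero_iff not_le)
qed

text \<open>The difference quotient of f at a is holomorphic on S and so has the same integral over
  both circles. What remains is f a times the integral of 1 / (w - a), which is 2 pi i outside and 0
  inside.\<close>

lemma annulus_Cauchy:
  assumes "0 < r" and a: "r < norm a" "norm a < s"
    and S: "open S" "{w. r \<le> norm w \<and> norm w \<le> s} \<subseteq> S" and f: "f holomorphic_on S"
  shows "contour_integral (circlepath 0 s) (\<lambda>w. f w / (w - a)) -
         contour_integral (circlepath 0 r) (\<lambda>w. f w / (w - a)) = 2 * of_real pi * \<i> * f a"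
proof -
  define q where "q = (\<lambda>w. if w = a then deriv f a else (f w - f a) / (w - a))"
  have qh: "q holomorphic_on S" unfolding q_def by (rule pole_lemma_open) fact+
  have eq: "contour_integral (circlepath 0 r) q = contour_integral (circlepath 0 s) q"
    by (rule contour_integral_circle_radius[OF _ _ S qh]) (use assms in auto)
  have *: "contour_integral (circlepath 0 t) (\<lambda>w. f w / (w - a)) =
     contour_integral (circlepath 0 t) q + f a * contour_integral (circlepath 0 t) (\<lambda>w. 1 / (w - a))"
    if t: "t \<in> {r, s}" for t
  proof -
    have t': "0 < t" "t \<noteq> norm a" using t assms by auto
    have "contour_integral (circlepath 0 t) (\<lambda>w. f w / (w - a)) =
      contour_integral (circlepath 0 t) (\<lambda>w. q w + f a * (1 / (w - a)))"
      by (rule contour_integral_cong)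
        (use t' in \<open>auto simp: q_def diff_divide_distrib\<close>)
    also have "\<dots> = contour_integral (circlepath 0 t) q +
        contour_integral (circlepath 0 t) (\<lambda>w. f a * (1 / (w - a)))"
    proof (rule contour_integral_add; rule contour_integrable_continuous_circlepath)
      show "continuous_on (path_image (circlepath 0 t)) q"
        by (rule continuous_on_subset[OF holomorphic_on_imp_continuous_on[OF qh]])
          (use S t t' assms in auto)
      show "continuous_on (path_image (circlepath 0 t)) (\<lambda>w. f a * (1 / (w - a)))"
        using t' by (auto intro!: continuous_intros)
    qed
    also have "contour_integral (circlepath 0 t) (\<lambda>w. f a * (1 / (w - a))) =
       f a * contour_integral (circlepath 0 t) (\<lambda>w. 1 / (w - a))"
      by (rule contour_integral_lmul, rule contour_integrable_continuous_circlepath)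
       (use t' in \<open>auto intro!: continuous_intros\<close>)
    finally show ?thesis .
  qed
  have 1: "contour_integral (circlepath 0 s) (\<lambda>w. 1 / (w - a)) = 2 * of_real pi * \<i>"
    using Cauchy_integral_circlepath_simple[of "\<lambda>_. 1" 0 s a] a
    by (auto intro: contour_integral_unique)
  have 2: "contour_integral (circlepath 0 r) (\<lambda>w. 1 / (w - a)) = 0"
    by (rule contour_integral_unique, rule Cauchy_theorem_disc_simple[of _ 0 "norm a"])
     (use a assms in \<open>auto intro!: holomorphic_intros\<close>)
  show ?thesis using *[of r] *[of s] eq 1 2 by simp
qed

text \<open>Cauchy's formula for the annulus, applied to f w / w^(n+1). The identity is exact, so it
  later yields a nonzero multiple of a^(-n) and not merely a bound.\<close>

lemma circle_coeff_pole:
  assumes "0 < r" and a: "r < norm a" "norm a < s"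
    and S: "open S" "{w. r \<le> norm w \<and> norm w \<le> s} \<subseteq> S" and f: "f holomorphic_on S"
  shows "circle_coeff (\<lambda>w. f w / (w - a)) s n - circle_coeff (\<lambda>w. f w / (w - a)) r n
    = f a / a ^ (n + 1)"
proof -
  have "(\<lambda>w. f w / w ^ (n + 1)) holomorphic_on S - {0}"
    by (auto intro!: holomorphic_intros holomorphic_on_subset[OF f])
  moreover have "{w. r \<le> norm w \<and> norm w \<le> s} \<subseteq> S - {0}" using S(2) assms(1) by auto
  ultimately have "contour_integral (circlepath 0 s) (\<lambda>w. f w / w ^ (n + 1) / (w - a)) -
         contour_integral (circlepath 0 r) (\<lambda>w. f w / w ^ (n + 1) / (w - a)) =
         2 * of_real pi * \<i> * (f a / a ^ (n + 1))"
    by (intro annulus_Cauchy[OF assms(1) a open_delete[OF S(1)]])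
  then show ?thesis unfolding circle_coeff_def
    by (simp add: diff_divide_distrib[symmetric] mult.commute)
qed

text \<open>The Cauchy integral over the outer circle is u, minus the one over the inner circle is
  v. The latter is O(1 / |w|) by the length estimate.\<close>

lemma Laurent_split:
  assumes "0 < r1" "r1 < r2" and S: "open S" "{w. r1 \<le> norm w \<and> norm w \<le> r2} \<subseteq> S"
    and f: "f holomorphic_on S"
  obtains u v where "u holomorphic_on ball 0 r2" "v holomorphic_on {w. r1 < norm w}"
    "(v \<longlongrightarrow> 0) at_infinity" "\<And>w. r1 < norm w \<Longrightarrow> norm w < r2 \<Longrightarrow> f w = u w + v w"
proof -
  define I where "I = (\<lambda>r w. 1 / (2 * of_real pi * \<i>) *
    contour_integral (circlepath 0 r) (\<lambda>s. f s / (s - w)))"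
  have cont: "continuous_on (sphere 0 r) f" if "r \<in> {r1, r2}" for r
    by (rule continuous_on_subset[OF holomorphic_on_imp_continuous_on[OF f]]) (use assms that in auto)
  have int: "((\<lambda>s. f s / (s - w)) has_contour_integral
       contour_integral (circlepath 0 r) (\<lambda>s. f s / (s - w))) (circlepath 0 r)"
    if "r \<in> {r1, r2}" "norm w \<noteq> r" for r w
    by (rule has_contour_integral_integral, rule contour_integrable_continuous_circlepath)
     (use that assms(1,2) in \<open>auto intro!: continuous_intros cont\<close>)
  have hol: "I r holomorphic_on - sphere 0 r" if r: "r \<in> {r1, r2}" for r
  proof -
    have rp: "r > 0" using r assms by auto
    have "(\<lambda>w. contour_integral (circlepath 0 r) (\<lambda>s. f s / (s - w))) holomorphic_on - sphere 0 r"
    proof (rule holomorphic_onI)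
      fix w assume w: "w \<in> - sphere (0::complex) r"
      have "((\<lambda>w. contour_integral (circlepath 0 r) (\<lambda>s. f s / (s - w))) has_field_derivative
         of_nat 1 * contour_integral (circlepath 0 r) (\<lambda>u. f u / (u - w) ^ Suc 1)) (at w)"
        by (rule Cauchy_next_derivative(2)[where S = UNIV and B = "2 * pi * \<bar>r\<bar>"])
         (use r rp w int cont in \<open>auto simp: vector_derivative_circlepath norm_mult\<close>)
      then show "(\<lambda>w. contour_integral (circlepath 0 r) (\<lambda>s. f s / (s - w)))
        field_differentiable at w within - sphere 0 r"
        using field_differentiable_at_within field_differentiable_def by blast
    qed
    then show ?thesis unfolding I_def by (intro holomorphic_intros)
  qed
  have lim: "(I r1 \<longlongrightarrow> 0) at_infinity"
  proof -
    have "bounded (f ` sphere 0 r1)"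
      by (intro compact_imp_bounded compact_continuous_image cont) auto
    then obtain B where B: "B > 0" "\<And>w. norm w = r1 \<Longrightarrow> norm (f w) \<le> B"
      by (auto simp: bounded_pos)
    have "eventually (\<lambda>w. norm (I r1 w) \<le> B * r1 / (norm w - r1)) at_infinity"
      unfolding eventually_at_infinity
    proof (intro exI allI impI)
      fix w :: complex assume w: "norm w \<ge> r1 + 1"
      have "norm (contour_integral (circlepath 0 r1) (\<lambda>s. f s / (s - w))) \<le>
         B / (norm w - r1) * (2 * pi * r1)"
      proof (rule has_contour_integral_bound_circlepath[OF int])
        fix x :: complex assume x: "norm (x - 0) = r1"
        have "norm w - r1 \<le> norm (x - w)"
          using norm_triangle_ineq2[of w x] x by (simp add: norm_minus_commute)
        then show "norm (f x / (x - w)) \<le> B / (norm w - r1)"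
          unfolding norm_divide using w x B by (intro frac_le) auto
      qed (use w B assms in auto)
      then have "norm (I r1 w) \<le> 1 / (2 * pi) * (B / (norm w - r1) * (2 * pi * r1))"
        unfolding I_def by (simp add: norm_divide norm_mult field_simps)
      then show "norm (I r1 w) \<le> B * r1 / (norm w - r1)" by (simp add: field_simps)
    qed
    moreover have "((\<lambda>w. B * r1 / (norm w - r1)) \<longlongrightarrow> 0) (at_infinity :: complex filter)"
      by (intro tendsto_divide_0[OF tendsto_const] filterlim_at_top_imp_at_infinity)
        (use filterlim_tendsto_add_at_top[OF tendsto_const[of "- r1"] filterlim_norm_at_top] in simp)
    ultimately show ?thesis by (rule Lim_null_comparison)
  qed
  show thesis
  proof (rule that[of "I r2" "\<lambda>w. - I r1 w"])
    show "I r2 holomorphic_on ball 0 r2"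
      by (rule holomorphic_on_subset[OF hol]) auto
    show "(\<lambda>w. - I r1 w) holomorphic_on {w. r1 < norm w}"
      by (rule holomorphic_on_minus, rule holomorphic_on_subset[OF hol]) auto
    show "((\<lambda>w. - I r1 w) \<longlongrightarrow> 0) at_infinity" using tendsto_minus[OF lim] by simp
    fix w :: complex assume "r1 < norm w" "norm w < r2"
    from annulus_Cauchy[OF assms(1) this S f]
    show "f w = I r2 w + - I r1 w" unfolding I_def
      by (simp add: field_simps)
  qed
qed

lemma holomorphic_imp_circle_coeff_sums:
  assumes u: "u holomorphic_on ball 0 R" and r: "0 < r" "r < R" and w: "norm w < R"
  shows "(\<lambda>n. circle_coeff u r n * w ^ n) sums u w"
proof -
  have "(deriv ^^ n) u 0 / fact n = circle_coeff u r n" for n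
  proof -
    have "contour_integral (circlepath 0 r) (\<lambda>x. u x / (x - 0) ^ Suc n) =
        (2 * pi * \<i>) * (deriv ^^ n) u 0 / fact n"
      by (rule Cauchy_contour_integral_circlepath)
       (use r in \<open>auto intro: holomorphic_on_subset[OF u]
          intro!: continuous_on_subset[OF holomorphic_on_imp_continuous_on[OF u]]\<close>)
    then show ?thesis unfolding circle_coeff_def by simp
  qed
  with holomorphic_power_series[OF u, of w] w show ?thesis by simp
qed

text \<open>The principal part v tends to 0 at infinity and so has no coefficient of index n \<ge>
  0; the coefficients of f are therefore the Taylor coefficients of the regular part.\<close>

lemma Laurent_split_coeff:
  assumes "0 < r1" "r1 < r" "r < r2" and S: "open S" "{w. r1 \<le> norm w \<and> norm w \<le> r2} \<subseteq> S"
    and f: "f holomorphic_on S"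
  obtains v where "v holomorphic_on {w. r1 < norm w}" "(v \<longlongrightarrow> 0) at_infinity"
    "\<And>w. r1 < norm w \<Longrightarrow> norm w < r2 \<Longrightarrow> (\<lambda>n. circle_coeff f r n * w ^ n) sums (f w - v w)"
proof -
  obtain u v where uv: "u holomorphic_on ball 0 r2" "v holomorphic_on {w. r1 < norm w}"
    "(v \<longlongrightarrow> 0) at_infinity" "\<And>w. r1 < norm w \<Longrightarrow> norm w < r2 \<Longrightarrow> f w = u w + v w"
    using Laurent_split[of r1 r2 S f] assms by auto
  have "circle_coeff f r n = circle_coeff u r n" for n
  proof -
    have "circle_coeff f r n = circle_coeff (\<lambda>w. u w + v w) r n"
      by (rule circle_coeff_cong) (use assms uv in auto)
    also have "\<dots> = circle_coeff u r n + circle_coeff v r n"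
      by (rule circle_coeff_add; use assms in
        \<open>auto intro!: continuous_on_subset[OF holomorphic_on_imp_continuous_on[OF uv(1)]]
           continuous_on_subset[OF holomorphic_on_imp_continuous_on[OF uv(2)]]\<close>)
    also have "circle_coeff v r n = 0"
    proof (rule circle_coeff_lim[OF _ assms(2) uv(2)])
      have "((\<lambda>w. 1 / w ^ n) \<longlongrightarrow> (if n = 0 then 1 else 0)) (at_infinity :: complex filter)"
        by (cases "n = 0") (auto intro!: tendsto_divide_0[OF tendsto_const] filterlim_power_at_infinity filterlim_ident)
      from tendsto_mult[OF uv(3) this]
      show "((\<lambda>w. v w / w ^ n) \<longlongrightarrow> 0) at_infinity" by simp
    qed (use assms in auto)
    finally show ?thesis by simp
  qed
  with holomorphic_imp_circle_coeff_sums[OF uv(1), of r] uv assms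
  show thesis by (intro that[of v]) auto
qed

section \<open>The exterior map and the canonical domains\<close>

locale exterior_domain =
  fixes E :: "complex set" and \<Phi> :: "complex \<Rightarrow> complex"
  assumes compact_E: "compact E" and zero_in_E: "0 \<in> E" and exterior: "exterior_map E \<Phi>"
begin

definition \<Psi> :: "complex \<Rightarrow> complex" where "\<Psi> = inv_into (- E) \<Phi>"

abbreviation D :: "real \<Rightarrow> complex set" where "D \<rho> \<equiv> canonical_domain E \<Phi> (ereal \<rho>)"

lemma mem_D: "z \<in> D \<rho> \<longleftrightarrow> z \<in> E \<or> norm (\<Phi> z) < \<rho>"
  by (auto simp: canonical_domain_def)

lemma holomorphic_Phi: "\<Phi> holomorphic_on - E"
  and bij_Phi: "bij_betw \<Phi> (- E) {w. 1 < norm w}"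
  using exterior by (auto simp: exterior_map_def)

lemma open_compl_E: "open (- E)"
  using compact_E by (simp add: compact_imp_closed open_Compl)

lemma norm_Phi: "z \<notin> E \<Longrightarrow> 1 < norm (\<Phi> z)"
  using bij_Phi by (auto simp: bij_betw_def)

lemma Psi_Phi: "z \<notin> E \<Longrightarrow> \<Psi> (\<Phi> z) = z"
  using bij_Phi by (auto simp: \<Psi>_def bij_betw_def)

lemma Psi_notin: "1 < norm w \<Longrightarrow> \<Psi> w \<notin> E"
  using bij_Phi by (metis ComplD \<Psi>_def bij_betwE bij_betw_inv_into mem_Collect_eq)

lemma Phi_Psi: "1 < norm w \<Longrightarrow> \<Phi> (\<Psi> w) = w"
  using bij_Phi by (auto simp: \<Psi>_def bij_betw_inv_into_right)

lemma open_exterior_disc: "open {w::complex. r < norm w}"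
  by (intro open_Collect_less continuous_intros)

lemma holomorphic_Psi: "\<Psi> holomorphic_on {w. 1 < norm w}"
  and deriv_Phi_Psi: "1 < norm w \<Longrightarrow> deriv \<Phi> (\<Psi> w) * deriv \<Psi> w = 1"
proof -
  have inj: "inj_on \<Phi> (- E)" and im: "\<Phi> ` (- E) = {w. 1 < norm w}"
    using bij_Phi by (auto simp: bij_betw_def)
  obtain g where g: "g holomorphic_on (\<Phi> ` (- E))"
    "\<And>z. z \<in> - E \<Longrightarrow> deriv \<Phi> z * deriv g (\<Phi> z) = 1"
    "\<And>z. z \<in> - E \<Longrightarrow> g (\<Phi> z) = z"
    using holomorphic_has_inverse[OF holomorphic_Phi open_compl_E inj] by metis
  have eq: "g w = \<Psi> w" if "w \<in> {w. 1 < norm w}" for w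
    using g(3)[of "\<Psi> w"] that Psi_notin Phi_Psi by simp
  show "\<Psi> holomorphic_on {w. 1 < norm w}"
    using holomorphic_transform[OF g(1)] eq im by auto
  assume w: "1 < norm w"
  have "deriv g w = deriv \<Psi> w"
    by (rule deriv_cong_ev[OF eventually_mono[OF eventually_nhds_in_open[OF open_exterior_disc[of 1]]]])
     (use w eq in auto)
  then show "deriv \<Phi> (\<Psi> w) * deriv \<Psi> w = 1"
    using g(2)[of "\<Psi> w"] w Psi_notin Phi_Psi by simp
qed

lemma isCont_Phi: "z \<notin> E \<Longrightarrow> isCont \<Phi> z"
  using holomorphic_on_imp_continuous_on[OF holomorphic_Phi] open_compl_E
  by (simp add: continuous_on_eq_continuous_at)

lemma isCont_Psi: "1 < norm w \<Longrightarrow> isCont \<Psi> w"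
  using holomorphic_on_imp_continuous_on[OF holomorphic_Psi] open_exterior_disc
  by (metis continuous_on_eq_continuous_at mem_Collect_eq)

subsection \<open>Behaviour at infinity\<close>

text \<open>This is \<Phi>'(\<infinity>), the reciprocal of the logarithmic capacity of E.\<close>

definition cap :: real where "cap = (SOME c. 0 < c \<and> ((\<lambda>z. \<Phi> z / z) \<longlongrightarrow> of_real c) at_infinity)"

lemma cap_pos: "0 < cap" and Phi_at_infinity: "((\<lambda>z. \<Phi> z / z) \<longlongrightarrow> of_real cap) at_infinity"
  using someI_ex[of "\<lambda>c::real. 0 < c \<and> ((\<lambda>z. \<Phi> z / z) \<longlongrightarrow> of_real c) at_infinity"] exterior
  by (auto simp: cap_def exterior_map_def)

text \<open>The function 1 / \<Phi>(1 / u) extends holomorphically to u = 0 with value 0 and is not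
  constant. By the open mapping theorem it takes every small value 1 / w near 0, so every large w is
  \<Phi> of a large point, and by injectivity that point is \<Psi> w.\<close>

lemma filterlim_Psi: "filterlim \<Psi> at_infinity at_infinity"
proof -
  obtain B where B: "B > 0" "\<And>z. z \<in> E \<Longrightarrow> norm z \<le> B"
    using compact_imp_bounded[OF compact_E] by (auto simp: bounded_pos)
  define \<phi> where "\<phi> = (\<lambda>u. if u = 0 then 0 else 1 / \<Phi> (1 / u))"
  have out: "1 / u \<notin> E" if "u \<in> ball 0 (1 / B) - {0}" for u
    using that B(2)[of "1 / u"] B(1) by (auto simp: norm_divide field_simps)
  have nz: "\<Phi> z \<noteq> 0" if "z \<notin> E" for z using norm_Phi[OF that] by auto
  have hol': "\<phi> holomorphic_on ball 0 (1 / B) - {0}"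
  proof -
    have "(\<lambda>u. 1 / \<Phi> (1 / u)) holomorphic_on ball 0 (1 / B) - {0}"
      using out nz by (auto intro!: holomorphic_intros holomorphic_on_compose_gen[of _ _ \<Phi> "- E", unfolded o_def] holomorphic_Phi)
    then show ?thesis by (rule holomorphic_transform) (auto simp: \<phi>_def)
  qed
  have lim: "(\<phi> \<longlongrightarrow> \<phi> 0) (at 0)"
  proof -
    have "((\<lambda>z. inverse (\<Phi> z / z) * inverse z) \<longlongrightarrow> inverse (of_real cap) * 0) at_infinity"
      by (intro tendsto_intros Phi_at_infinity tendsto_inverse_0) (use cap_pos in auto)
    moreover have "\<forall>\<^sub>F z in at_infinity. inverse (\<Phi> z / z) * inverse z = 1 / \<Phi> z"
      using eventually_not_equal_at_infinity[of 0] by eventually_elim (auto simp: field_simps)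
    ultimately have "((\<lambda>z. 1 / \<Phi> z) \<longlongrightarrow> 0) at_infinity"
      using Lim_transform_eventually by fastforce
    then have "((\<lambda>u. 1 / \<Phi> (1 / u)) \<longlongrightarrow> 0) (at 0)"
      by (simp add: lim_at_infinity_0 o_def divide_inverse)
    then show ?thesis
      by (rule Lim_transform_eventually[THEN tendsto_eq_rhs]) (auto simp: \<phi>_def eventually_at_filter)
  qed
  have hol: "\<phi> holomorphic_on ball 0 (1 / B)"
  proof (rule no_isolated_singularity'[of "{0}"])
    show "(\<phi> \<longlongrightarrow> \<phi> z) (at z within ball 0 (1 / B))" if "z \<in> {0}" for z
      using that lim tendsto_within_subset by blast
  qed (use hol' in auto)
  have nc: "\<not> \<phi> constant_on ball 0 (1 / B)"
  proof
    assume "\<phi> constant_on ball 0 (1 / B)"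
    then obtain k where "\<And>u. u \<in> ball 0 (1 / B) \<Longrightarrow> \<phi> u = k" by (auto simp: constant_on_def)
    moreover have "1 / (2 * B) < 1 / B" using B(1) by (simp add: divide_strict_left_mono)
    then have b: "of_real (1 / (2 * B)) \<in> ball (0::complex) (1 / B) - {0}"
      using B(1) by (simp add: norm_divide norm_mult)
    ultimately have "\<phi> (of_real (1 / (2 * B))) = \<phi> 0" using B(1) by simp
    then show False using nz[OF out[OF b]] B(1) by (simp add: \<phi>_def)
  qed
  show ?thesis unfolding filterlim_at_infinity[OF order_refl]
  proof (intro allI impI)
    fix r :: real assume r: "0 < r"
    define e where "e = min (1 / B) (1 / r)"
    have e: "e > 0" using B r by (simp add: e_def)
    have "open (\<phi> ` ball 0 e)"
      by (rule open_mapping_thm[OF hol _ _ _ _ nc]) (auto simp: e_def)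
    moreover have "0 \<in> \<phi> ` ball 0 e" using e by (auto simp: \<phi>_def image_iff intro!: bexI[of _ 0])
    ultimately obtain \<delta> where \<delta>: "\<delta> > 0" "ball 0 \<delta> \<subseteq> \<phi> ` ball 0 e"
      by (meson open_contains_ball)
    show "\<forall>\<^sub>F w in at_infinity. r \<le> norm (\<Psi> w)"
    proof (rule eventually_at_infinityI[of "max 2 (2 / \<delta>)"])
      fix w :: complex assume w: "max 2 (2 / \<delta>) \<le> norm w"
      have wp: "norm w > 0" using w by linarith
      have "1 / w \<in> ball 0 \<delta>" using w wp \<delta> by (auto simp: norm_divide field_simps)
      then obtain u where u: "u \<in> ball 0 e" "\<phi> u = 1 / w" using \<delta> by (metis imageE subsetD)
      have u0: "u \<noteq> 0" using u(2) wp by (auto simp: \<phi>_def)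
      have nE: "1 / u \<notin> E" using out u u0 by (auto simp: e_def)
      have "\<Phi> (1 / u) = w" using u(2) u0 wp nz[OF nE] by (simp add: \<phi>_def field_simps)
      then have "\<Psi> w = 1 / u" using Psi_Phi[OF nE] by simp
      moreover have "norm u < 1 / r" using u by (auto simp: e_def)
      moreover have "norm u * r < 1" using calculation(2) r by (simp only: pos_less_divide_eq)
      then have "r \<le> 1 / norm u" using u0 by (simp add: pos_le_divide_eq mult.commute)
      ultimately show "r \<le> norm (\<Psi> w)" by (simp add: norm_divide)
    qed
  qed
qed

lemma Psi_at_infinity: "((\<lambda>w. \<Psi> w / w) \<longlongrightarrow> 1 / of_real cap) at_infinity"
proof -
  have "((\<lambda>w. inverse (\<Phi> (\<Psi> w) / \<Psi> w)) \<longlongrightarrow> inverse (of_real cap)) at_infinity"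
    by (intro tendsto_inverse filterlim_compose[OF Phi_at_infinity filterlim_Psi]) (use cap_pos in auto)
  then show ?thesis
    unfolding inverse_eq_divide
    by (rule Lim_transform_eventually) (auto intro!: eventually_at_infinityI[of 2] simp: Phi_Psi field_simps)
qed

text \<open>The singularity of u \<Psi>(1 / u) at 0 is removable. Differentiating \<Psi> w = w
  \<kappa>(1 / w) gives \<Psi>' in terms of \<kappa> and \<kappa>', which are continuous at
  0.\<close>

lemma deriv_Psi_at_infinity: "(deriv \<Psi> \<longlongrightarrow> 1 / of_real cap) at_infinity"
proof -
  define \<kappa> where "\<kappa> = (\<lambda>u. if u = 0 then 1 / of_real cap else u * \<Psi> (1 / u))"
  have hol': "\<kappa> holomorphic_on ball 0 1 - {0}"
  proof -
    have "(\<lambda>u. u * \<Psi> (1 / u)) holomorphic_on ball 0 1 - {0}"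
      by (auto intro!: holomorphic_intros holomorphic_on_compose_gen[of _ _ \<Psi> "{w. 1 < norm w}", unfolded o_def] holomorphic_Psi
        simp: norm_divide)
    then show ?thesis by (rule holomorphic_transform) (auto simp: \<kappa>_def)
  qed
  have lim: "(\<kappa> \<longlongrightarrow> \<kappa> 0) (at 0)"
  proof -
    have "((\<lambda>u. u * \<Psi> (1 / u)) \<longlongrightarrow> 1 / of_real cap) (at 0)"
      using Psi_at_infinity by (simp add: lim_at_infinity_0 o_def divide_inverse mult.commute)
    then show ?thesis
      by (rule Lim_transform_eventually[THEN tendsto_eq_rhs]) (auto simp: \<kappa>_def eventually_at_filter)
  qed
  have hol: "\<kappa> holomorphic_on ball 0 1"
  proof (rule no_isolated_singularity'[of "{0}"])
    show "(\<kappa> \<longlongrightarrow> \<kappa> z) (at z within ball 0 1)" if "z \<in> {0}" for z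
      using that lim tendsto_within_subset by blast
  qed (use hol' in auto)
  have d: "deriv \<Psi> w = \<kappa> (1 / w) - deriv \<kappa> (1 / w) / w" if w: "1 < norm w" for w
  proof -
    have w0: "w \<noteq> 0" using w by auto
    have "(\<kappa> has_field_derivative deriv \<kappa> (1 / w)) (at (1 / w))"
      by (rule holomorphic_derivI[OF hol open_ball]) (use w in \<open>simp add: norm_divide divide_less_eq\<close>)
    then have "((\<lambda>w. w * \<kappa> (1 / w)) has_field_derivative
       (\<kappa> (1 / w) + w * (deriv \<kappa> (1 / w) * (- 1 / w\<^sup>2)))) (at w)"
      using w0 by (auto intro!: derivative_eq_intros DERIV_chain2[of \<kappa>] simp: power2_eq_square)
    then have "(\<Psi> has_field_derivative (\<kappa> (1 / w) + w * (deriv \<kappa> (1 / w) * (- 1 / w\<^sup>2)))) (at w)"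
      by (rule has_field_derivative_transform_within_open[OF _ open_exterior_disc[of 1]])
       (use w in \<open>auto simp: \<kappa>_def\<close>)
    then show ?thesis using w0 by (auto dest!: DERIV_imp_deriv simp: power2_eq_square)
  qed
  have inv: "((\<lambda>w. 1 / w) \<longlongrightarrow> 0) (at_infinity :: complex filter)"
    by (intro tendsto_divide_0[OF tendsto_const] filterlim_ident)
  have c1: "isCont \<kappa> 0" "isCont (deriv \<kappa>) 0"
    using holomorphic_on_imp_continuous_on[OF hol] holomorphic_on_imp_continuous_on[OF holomorphic_deriv[OF hol open_ball]]
    by (auto simp: continuous_on_eq_continuous_at)
  have "((\<lambda>w. \<kappa> (1 / w) - deriv \<kappa> (1 / w) * (1 / w)) \<longlongrightarrow> \<kappa> 0 - deriv \<kappa> 0 * 0) at_infinity"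
    by (intro tendsto_intros isCont_tendsto_compose[OF c1(1) inv] isCont_tendsto_compose[OF c1(2) inv] inv)
  then have "((\<lambda>w. \<kappa> (1 / w) - deriv \<kappa> (1 / w) * (1 / w)) \<longlongrightarrow> 1 / of_real cap) at_infinity"
    by (simp add: \<kappa>_def)
  then show ?thesis
    by (rule Lim_transform_eventually) (auto intro!: eventually_at_infinityI[of 2] simp: d)
qed

subsection \<open>Topology of the canonical domains\<close>

text \<open>For r > 1 this is the closure of \<open>D r\<close>, and for r = 1 it is E. Having it
  explicitly makes its compactness accessible through \<Phi>.\<close>

definition Dc :: "real \<Rightarrow> complex set" where "Dc r = E \<union> {z. z \<notin> E \<and> norm (\<Phi> z) \<le> r}"

text \<open>Continuity of \<Phi> says nothing at points of E, so the set is described through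
  \<Psi>: since \<Psi> tends to infinity, inside a unit ball it is covered by the \<Psi>-image of a
  compact annulus.\<close>

lemma closed_outside:
  assumes "1 < r"
  shows "closed {z. z \<notin> E \<and> r \<le> norm (\<Phi> z)}" (is "closed ?S")
proof -
  have "\<exists>T. open T \<and> z \<in> T \<and> T \<subseteq> - ?S" if z: "z \<notin> ?S" for z
  proof -
    obtain M where M: "\<And>w. M \<le> norm w \<Longrightarrow> norm z + 2 \<le> norm (\<Psi> w)"
      using filterlim_Psi[unfolded filterlim_at_infinity[OF order_refl], rule_format, of "norm z + 2"]
      by (auto simp: eventually_at_infinity add_nonneg_pos)
    define K where "K = \<Psi> ` {w. r \<le> norm w \<and> norm w \<le> M}"
    have "{w::complex. r \<le> norm w \<and> norm w \<le> M} = cball 0 M \<inter> - ball 0 r" by auto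
    moreover have "closed (- ball (0::complex) r)" by (intro closed_Compl) auto
    ultimately have "compact {w::complex. r \<le> norm w \<and> norm w \<le> M}"
      by (simp add: compact_Int_closed)
    then have "compact K" unfolding K_def
      by (rule compact_continuous_image[rotated], intro continuous_at_imp_continuous_on)
        (use assms isCont_Psi in auto)
    then have "open (ball z 1 - K)" by (simp add: compact_imp_closed open_Diff)
    moreover have "K \<subseteq> ?S" using assms Psi_notin Phi_Psi by (auto simp: K_def)
    moreover have "ball z 1 \<inter> ?S \<subseteq> K"
    proof
      fix y assume y: "y \<in> ball z 1 \<inter> ?S"
      have "norm y < norm z + 2"
        using y norm_triangle_ineq2[of y z] by (auto simp: dist_norm norm_minus_commute)
      then have "norm (\<Phi> y) \<le> M" using M[of "\<Phi> y"] y Psi_Phi by force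
      then show "y \<in> K" using y Psi_Phi by (auto simp: K_def image_iff intro!: bexI[of _ "\<Phi> y"])
    qed
    ultimately show ?thesis using z by (intro exI[of _ "ball z 1 - K"]) auto
  qed
  then have "open (- ?S)" by (subst open_subopen) (metis ComplD)
  then show ?thesis by (simp add: closed_def)
qed

lemma open_D: "1 < r \<Longrightarrow> open (D r)"
proof -
  assume "1 < r"
  have "D r = - {z. z \<notin> E \<and> r \<le> norm (\<Phi> z)}" by (auto simp: mem_D)
  then show ?thesis using closed_outside[OF \<open>1 < r\<close>] by (simp add: open_Compl)
qed

lemma open_canonical_domain:
  assumes "1 < \<rho>" shows "open (canonical_domain E \<Phi> \<rho>)"
proof -
  have "canonical_domain E \<Phi> \<rho> = (\<Union>r\<in>{r. 1 < r \<and> ereal r < \<rho>}. D r)"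
  proof (intro equalityI subsetI)
    fix z assume z: "z \<in> canonical_domain E \<Phi> \<rho>"
    have "\<exists>r. max 1 (if z \<in> E then 1 else norm (\<Phi> z)) < r \<and> ereal r < \<rho>"
      using z assms ereal_dense2[of "ereal (max 1 (if z \<in> E then 1 else norm (\<Phi> z)))" \<rho>]
      by (auto simp: canonical_domain_def one_ereal_def max_def split: if_splits)
    then show "z \<in> (\<Union>r\<in>{r. 1 < r \<and> ereal r < \<rho>}. D r)" by (auto simp: mem_D split: if_splits)
  next
    fix z assume "z \<in> (\<Union>r\<in>{r. 1 < r \<and> ereal r < \<rho>}. D r)"
    then obtain r where "ereal r < \<rho>" "z \<in> D r" by auto
    then show "z \<in> canonical_domain E \<Phi> \<rho>"
      by (auto simp: canonical_domain_def intro: less_trans[of _ "ereal r"])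
  qed
  then show ?thesis using open_D by auto
qed

lemma E_subset_canonical: "E \<subseteq> canonical_domain E \<Phi> \<rho>"
  by (auto simp: canonical_domain_def)

lemma canonical_domain_mono: "\<rho> \<le> \<rho>' \<Longrightarrow> canonical_domain E \<Phi> \<rho> \<subseteq> canonical_domain E \<Phi> \<rho>'"
  by (auto simp: canonical_domain_def intro: less_le_trans)

text \<open>The part A outside E is the image of an annulus, hence connected, so one of two
  separating open sets misses A. Its trace on the domain then lies in E and is both open and
  compact, hence empty.\<close>

lemma connected_canonical_domain:
  assumes "1 < \<rho>" shows "connected (canonical_domain E \<Phi> \<rho>)" (is "connected ?D")
proof -
  define A where "A = \<Psi> ` {w. 1 < norm w \<and> ereal (norm w) < \<rho>}"
  have A_eq: "?D = E \<union> A"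
    by (auto simp: A_def canonical_domain_def Psi_notin Phi_Psi image_iff intro!: exI[of _ "\<Phi> _"])
     (metis Psi_Phi norm_Phi)+
  have "connected {w::complex. 1 < norm w \<and> ereal (norm w) < \<rho>}"
  proof (cases \<rho>)
    case (real r)
    have "{w::complex. 1 < norm w \<and> ereal (norm w) < \<rho>} = ball 0 r - cball 0 1" using real by auto
    then show ?thesis using connected_annulus(1)[of 1 "0::complex" r]
      by (simp add: real)
  next
    case PInf
    have "{w::complex. 1 < norm w \<and> ereal (norm w) < \<rho>} = - cball 0 1" using PInf by auto
    then show ?thesis using connected_complement_bounded_convex[of "cball (0::complex) 1"]
      by simp
  qed (use assms in auto)
  then have cA: "connected A" unfolding A_def
    by (rule connected_continuous_image[rotated], intro continuous_at_imp_continuous_on)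
      (auto intro: isCont_Psi)
  show ?thesis unfolding connected_def
  proof (intro notI, elim exE conjE)
    fix U V assume UV: "open U" "open V" "?D \<subseteq> U \<union> V" "U \<inter> V \<inter> ?D = {}" "U \<inter> ?D \<noteq> {}" "V \<inter> ?D \<noteq> {}"
    have key: False if UV: "open U" "open V" "?D \<subseteq> U \<union> V" "U \<inter> V \<inter> ?D = {}" "V \<inter> ?D \<noteq> {}" "V \<inter> A = {}"
      for U V
    proof -
      define W where "W = V \<inter> ?D"
      have "W \<subseteq> E" using UV A_eq by (auto simp: W_def)
      have "open W" using UV open_canonical_domain[OF assms] by (auto simp: W_def)
      moreover have "W = E - U" using \<open>W \<subseteq> E\<close> UV(3,4) A_eq by (auto simp: W_def)
      then have "compact W" using compact_E UV by (simp add: compact_diff)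
      ultimately have "W = {}"
        by (metis clopen compact_imp_bounded compact_imp_closed not_bounded_UNIV)
      then show False using UV W_def by auto
    qed
    have "U \<inter> A = {} \<or> V \<inter> A = {}"
      using cA UV A_eq by (auto simp: connected_def)
    then show False using key[of U V] key[of V U] UV by (auto simp: Int_ac Un_ac)
  qed
qed

lemma D_subset_Dc: "D r \<subseteq> Dc r" by (auto simp: mem_D Dc_def)

lemma Dc_subset_D: "r < s \<Longrightarrow> Dc r \<subseteq> D s" by (auto simp: mem_D Dc_def)

lemma closed_Dc: "closed (Dc r)"
proof -
  have "- Dc r = (- E) \<inter> \<Phi> -` {w. r < norm w}" by (auto simp: Dc_def)
  also have "open \<dots>"
    by (rule continuous_open_preimage[OF holomorphic_on_imp_continuous_on[OF holomorphic_Phi]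
          open_compl_E open_exterior_disc])
  finally show ?thesis by (simp add: closed_def)
qed

lemma bounded_Dc: "bounded (Dc r)"
proof -
  have "\<forall>\<^sub>F z in at_infinity. dist (\<Phi> z / z) (of_real cap) < cap / 2"
    using Phi_at_infinity cap_pos unfolding tendsto_iff by (meson half_gt_zero)
  then obtain B where B: "\<And>z. norm z \<ge> B \<Longrightarrow> dist (\<Phi> z / z) (of_real cap) < cap / 2"
    by (auto simp: eventually_at_infinity)
  obtain B' where B': "\<And>z. z \<in> E \<Longrightarrow> norm z \<le> B'"
    using compact_imp_bounded[OF compact_E] by (auto simp: bounded_iff)
  have "norm z \<le> max B' (max (max 1 B) (2 * r / cap))" if z: "z \<in> Dc r" for z
  proof (rule ccontr)
    assume "\<not> ?thesis"
    then have n: "norm z > B'" "norm z > 1" "norm z > B" "norm z > 2 * r / cap" by auto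
    have "z \<notin> E" using n B' by force
    then have *: "norm (\<Phi> z) \<le> r" using z by (auto simp: Dc_def)
    have "norm (\<Phi> z / z) \<ge> norm (of_real cap :: complex) - norm (\<Phi> z / z - of_real cap)"
      using norm_triangle_ineq2[of "of_real cap" "of_real cap - \<Phi> z / z"] by (simp add: norm_minus_commute)
    then have "norm (\<Phi> z / z) > cap / 2" using B[of z] n cap_pos by (auto simp: dist_norm)
    moreover have "0 < norm z" using n by linarith
    ultimately have "norm (\<Phi> z) > cap / 2 * norm z"
      by (simp only: norm_divide pos_less_divide_eq)
    then show False using * n cap_pos by (simp add: field_simps)
  qed
  then show ?thesis by (auto simp: bounded_iff)
qed

lemma compact_Dc: "compact (Dc r)"
  using closed_Dc bounded_Dc compact_eq_bounded_closed by blast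

lemma closure_D_subset: "closure (D r) \<subseteq> Dc r"
  by (simp add: closed_Dc closure_minimal D_subset_Dc)

lemma frontier_D_subset: "1 < r \<Longrightarrow> frontier (D r) \<subseteq> {z. z \<notin> E \<and> norm (\<Phi> z) = r}"
proof -
  assume r: "1 < r"
  have "frontier (D r) = closure (D r) - D r"
    using open_D[OF r] by (simp add: frontier_def interior_open)
  also have "\<dots> \<subseteq> Dc r - D r" using closure_D_subset by auto
  finally show ?thesis by (auto simp: Dc_def mem_D)
qed

lemma Dc_subset_closure:
  assumes "1 < r" shows "Dc r \<subseteq> closure (D r)"
proof
  fix z assume z: "z \<in> Dc r"
  show "z \<in> closure (D r)"
  proof (cases "z \<in> D r")
    case False
    then have zE: "z \<notin> E" "norm (\<Phi> z) = r" using z by (auto simp: Dc_def mem_D)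
    \<comment> \<open>The factor moves from inside (1 / r, 1) up to 1, so the points stay strictly
      between the levels 1 and r. The double \<open>Suc\<close> keeps the inverse strictly below 1,
      which excludes the level 1.\<close>
    let ?t = "\<lambda>n. complex_of_real (1 - (1 - 1 / r) * inverse (real (Suc (Suc n)))) * \<Phi> z"
    have t: "1 < norm (?t n) \<and> norm (?t n) < r" for n
    proof -
      define x where "x = inverse (real (Suc (Suc n)))"
      have x: "0 < x" "x < 1" by (auto simp: x_def field_simps)
      have e: "1 - (1 - 1 / r) * x > 1 / r"
      proof -
        have "0 < 1 - 1 / r" using assms by simp
        from mult_strict_left_mono[OF x(2) this] show ?thesis by simp
      qed
      have "norm (?t n) = (1 - (1 - 1 / r) * x) * r"
        unfolding x_def[symmetric] norm_mult norm_of_real zE(2)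
        using e assms by (smt (verit) divide_pos_pos)
      moreover have "1 / r * r < (1 - (1 - 1 / r) * x) * r"
        by (rule mult_strict_right_mono[OF e]) (use assms in simp)
      then have "(1 - (1 - 1 / r) * x) * r > 1" using assms by (simp only: divide_self_if mult.commute) auto
      moreover have "(1 - (1 - 1 / r) * x) < 1" using x assms by (auto intro!: mult_pos_pos)
      then have "(1 - (1 - 1 / r) * x) * r < 1 * r" by (rule mult_strict_right_mono) (use assms in simp)
      ultimately show ?thesis by linarith
    qed
    have lim: "?t \<longlonglongrightarrow> complex_of_real (1 - (1 - 1 / r) * 0) * \<Phi> z"
      by (intro tendsto_intros LIMSEQ_Suc[OF LIMSEQ_inverse_real_of_nat])
    have "(\<lambda>n. \<Psi> (?t n)) \<longlonglongrightarrow> \<Psi> (\<Phi> z)"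
      by (rule isCont_tendsto_compose[OF isCont_Psi]) (use lim zE assms in auto)
    moreover have "\<Psi> (?t n) \<in> D r" for n using t[of n] Phi_Psi by (simp add: mem_D)
    ultimately show ?thesis unfolding closure_sequential Psi_Phi[OF zE(1)]
      by (intro exI[of _ "\<lambda>n. \<Psi> (?t n)"]) simp
  qed (use closure_subset in auto)
qed

lemma Dc_1: "Dc 1 = E" using norm_Phi by (force simp: Dc_def)

text \<open>On the compact set \<open>Dc (r + 1) - U\<close> the modulus of \<Phi> attains its
  minimum, which exceeds r; below that minimum (and below r + 1) every point lies in U. With r = 1
  this handles germs along E, with r = |\<Phi> \<xi>| the neighbourhoods in the definition of a
  system pole.\<close>

lemma D_shrinks:
  assumes "open U" "Dc r \<subseteq> U" "1 \<le> r"
  obtains s where "r < s" "D s \<subseteq> U"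
proof -
  define K where "K = Dc (r + 1) - U"
  have "compact K" using compact_Dc assms(1) by (simp add: K_def compact_diff)
  have K: "z \<notin> E \<and> norm (\<Phi> z) > r" if "z \<in> K" for z
    using that assms by (auto simp: K_def Dc_def)
  show thesis
  proof (cases "K = {}")
    case True
    then show ?thesis using that[of "r + 1"] D_subset_Dc[of "r + 1"] by (auto simp: K_def)
  next
    case False
    have "continuous_on K (\<lambda>z. norm (\<Phi> z))"
      by (intro continuous_intros continuous_at_imp_continuous_on) (use K isCont_Phi in auto)
    from continuous_attains_inf[OF \<open>compact K\<close> False this]
    obtain z0 where z0: "z0 \<in> K" "\<And>z. z \<in> K \<Longrightarrow> norm (\<Phi> z0) \<le> norm (\<Phi> z)" by auto
    define s where "s = min (r + 1) (norm (\<Phi> z0))"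
    have s: "s \<le> r + 1" "s \<le> norm (\<Phi> z0)" by (auto simp: s_def)
    show ?thesis
    proof (rule that[of s])
      show "r < s" using K[OF z0(1)] by (auto simp: s_def)
      show "D s \<subseteq> U"
      proof
        fix z assume z: "z \<in> D s"
        show "z \<in> U"
        proof (rule ccontr)
          assume "z \<notin> U"
          moreover have "z \<notin> E" using \<open>z \<notin> U\<close> assms(2) by (auto simp: Dc_def)
          ultimately have "z \<in> K" using z s by (auto simp: K_def Dc_def mem_D)
          then show False using z0(2)[of z] z s \<open>z \<notin> E\<close> by (auto simp: mem_D)
        qed
      qed
    qed
  qed
qed

lemma compact_subset_D:
  assumes "compact K" "K \<subseteq> canonical_domain E \<Phi> \<rho>" "1 < \<rho>"
  obtains r where "1 < r" "ereal r < \<rho>" "K \<subseteq> D r"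
proof -
  define \<C> where "\<C> = D ` {r. 1 < r \<and> ereal r < \<rho>}"
  have "K \<subseteq> \<Union>\<C>"
  proof
    fix z assume "z \<in> K"
    then have z: "z \<in> canonical_domain E \<Phi> \<rho>" using assms by auto
    have "\<exists>r. max 1 (if z \<in> E then 1 else norm (\<Phi> z)) < r \<and> ereal r < \<rho>"
      using z assms ereal_dense2[of "ereal (max 1 (if z \<in> E then 1 else norm (\<Phi> z)))" \<rho>]
      by (auto simp: canonical_domain_def one_ereal_def max_def split: if_splits)
    then show "z \<in> \<Union>\<C>" by (auto simp: \<C>_def mem_D split: if_splits)
  qed
  moreover have "\<And>T. T \<in> \<C> \<Longrightarrow> open T" using open_D by (auto simp: \<C>_def)
  ultimately obtain \<F> where F: "\<F> \<subseteq> \<C>" "finite \<F>" "K \<subseteq> \<Union>\<F>"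
    using compactE[OF assms(1)] by metis
  then obtain R where R: "R \<subseteq> {r. 1 < r \<and> ereal r < \<rho>}" "finite R" "\<F> = D ` R"
    unfolding \<C>_def by (meson finite_subset_image)
  obtain r0 where r0: "1 < r0" "ereal r0 < \<rho>" using ereal_dense2[of 1 \<rho>] assms by (auto simp: one_ereal_def)
  define r where "r = Max (insert r0 R)"
  have "r \<in> insert r0 R" unfolding r_def by (rule Max_in) (use R in auto)
  then have "1 < r" "ereal r < \<rho>" using R r0 by auto
  moreover have "K \<subseteq> D r"
  proof
    fix z assume "z \<in> K"
    then obtain s where "s \<in> R" "z \<in> D s" using F R by auto
    moreover have "s \<le> r" using \<open>s \<in> R\<close> R by (simp add: r_def)
    ultimately show "z \<in> D r" by (auto simp: mem_D)
  qed
  ultimately show thesis using that by blast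
qed

end

section \<open>Meromorphic functions with finitely many poles\<close>

text \<open>The identity theorem gives equality on a punctured neighbourhood of each point. The
  normalization, value 0 at poles and continuity elsewhere, then forces equality at the point
  itself.\<close>

lemma nicely_meromorphic_eqI:
  assumes g: "g nicely_meromorphic_on A" and h: "h nicely_meromorphic_on A"
    and A: "open A" "connected A" and U: "open U" "U \<inter> A \<noteq> {}" "\<And>z. z \<in> U \<inter> A \<Longrightarrow> g z = h z"
    and z: "z \<in> A"
  shows "g z = h z"
proof -
  have m: "(\<lambda>z. g z - h z) meromorphic_on A"
    using g h by (auto simp: nicely_meromorphic_on_def intro: meromorphic_intros)
  have "\<not> (\<forall>\<^sub>F z in cosparse A. g z - h z \<noteq> 0)"
  proof
    assume ev: "\<forall>\<^sub>F z in cosparse A. g z - h z \<noteq> 0"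
    obtain x where x: "x \<in> U" "x \<in> A" using U by auto
    have "\<forall>\<^sub>F z in at x. g z - h z \<noteq> 0"
      using ev x A by (auto simp: eventually_cosparse_open_eq)
    moreover have "\<forall>\<^sub>F z in at x. z \<in> U \<inter> A"
      using x U A by (intro eventually_at_in_open') auto
    ultimately have "\<forall>\<^sub>F z in at x. False" by eventually_elim (use U in auto)
    then show False by simp
  qed
  then have "\<forall>\<^sub>F z in cosparse A. g z - h z = 0"
    using meromorphic_imp_constant_or_avoid[OF m A, of 0] by blast
  then have ev: "\<forall>\<^sub>F w in at z. g w = h w"
    using z A by (auto simp: eventually_cosparse_open_eq elim: eventually_mono)
  have cg: "is_pole g z \<and> g z = 0 \<or> g \<midarrow>z\<rightarrow> g z" and ch: "is_pole h z \<and> h z = 0 \<or> h \<midarrow>z\<rightarrow> h z"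
    using g h z by (auto simp: nicely_meromorphic_on_def)
  have ip: "is_pole g z \<longleftrightarrow> is_pole h z" by (rule is_pole_cong[OF ev refl])
  show ?thesis
  proof (cases "is_pole g z")
    case True
    then have "\<not> g \<midarrow>z\<rightarrow> g z" "\<not> h \<midarrow>z\<rightarrow> h z"
      using ip unfolding is_pole_def
      by (meson at_neq_bot not_tendsto_and_filterlim_at_infinity)+
    then show ?thesis using cg ch by auto
  next
    case False
    then have "g \<midarrow>z\<rightarrow> g z" "h \<midarrow>z\<rightarrow> h z" using cg ch ip by auto
    moreover have "h \<midarrow>z\<rightarrow> g z" using calculation(1) tendsto_cong[OF ev] by auto
    ultimately show ?thesis using LIM_unique by blast
  qed
qed

lemma pole_order_pos:
  assumes "g nicely_meromorphic_on A" "z \<in> A" "is_pole g z"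
  shows "0 < pole_order g z"
proof -
  have "isolated_singularity_at g z"
    using assms by (auto simp: nicely_meromorphic_on_def intro: meromorphic_on_isolated_singularity meromorphic_on_subset)
  then have "zorder g z < 0" using isolated_pole_imp_neg_zorder assms by blast
  then show ?thesis by (simp add: pole_order_def)
qed

text \<open>At each pole the local factorization of g shows that the product has a finite nonzero
  limit, so filling in the limits removes all singularities and leaves no zero there. From here on
  poles are handled through such numerators.\<close>

lemma nicely_meromorphic_numerator:
  assumes g: "g nicely_meromorphic_on A" and A: "open A" and fin: "finite (poles_in g A)"
  obtains N where "N holomorphic_on A"
    "\<And>z. z \<in> A - poles_in g A \<Longrightarrow> N z = (\<Prod>\<xi>\<in>poles_in g A. (z - \<xi>) ^ pole_order g \<xi>) * g z"
    "\<And>\<xi>. \<xi> \<in> poles_in g A \<Longrightarrow> N \<xi> \<noteq> 0"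
proof -
  define S where "S = poles_in g A"
  define q where "q = (\<lambda>z. \<Prod>\<xi>\<in>S. (z - \<xi>) ^ pole_order g \<xi>)"
  have fS: "finite S" and SA: "S \<subseteq> A" using fin by (auto simp: S_def poles_in_def)
  have an: "g analytic_on A - S"
    using g nicely_meromorphic_on_imp_analytic_at
    by (subst analytic_on_analytic_at) (auto simp: S_def poles_in_def)
  have hol: "g holomorphic_on A - S" using an by (rule analytic_imp_holomorphic)
  have "\<exists>L. L \<noteq> 0 \<and> ((\<lambda>z. q z * g z) \<longlongrightarrow> L) (at \<xi>)" if \<xi>: "\<xi> \<in> S" for \<xi>
  proof -
    define B where "B = A - (S - {\<xi>})"
    have B: "open B" "\<xi> \<in> B" using A fS SA \<xi> by (auto simp: B_def intro: open_Diff finite_imp_closed)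
    have "g holomorphic_on B - {\<xi>}" by (rule holomorphic_on_subset[OF hol]) (auto simp: B_def)
    moreover have "is_pole g \<xi>" using \<xi> by (auto simp: S_def poles_in_def)
    ultimately have zp: "zorder g \<xi> < 0" "zor_poly g \<xi> \<xi> \<noteq> 0"
      "\<exists>r. r>0 \<and> cball \<xi> r \<subseteq> B \<and> zor_poly g \<xi> holomorphic_on cball \<xi> r
        \<and> (\<forall>w\<in>cball \<xi> r - {\<xi>}. g w = zor_poly g \<xi> w / (w-\<xi>) ^ nat (- zorder g \<xi>) \<and> zor_poly g \<xi> w \<noteq>0)"
      using zorder_exist_pole[OF _ B] by auto
    then obtain r where r: "r > 0" "zor_poly g \<xi> holomorphic_on cball \<xi> r"
      "\<And>w. w\<in>cball \<xi> r - {\<xi>} \<Longrightarrow> g w = zor_poly g \<xi> w / (w-\<xi>) ^ pole_order g \<xi>"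
      by (auto simp: pole_order_def)
    define q' where "q' = (\<lambda>z. \<Prod>\<eta>\<in>S-{\<xi>}. (z - \<eta>) ^ pole_order g \<eta>)"
    have q: "q z = (z - \<xi>) ^ pole_order g \<xi> * q' z" for z
      unfolding q_def q'_def by (rule prod.remove[OF fS \<xi>])
    have "isCont (zor_poly g \<xi>) \<xi>"
      using r by (meson centre_in_ball continuous_on_eq_continuous_at holomorphic_on_imp_continuous_on
          ball_subset_cball holomorphic_on_subset open_ball)
    moreover have "isCont q' \<xi>" unfolding q'_def by (intro continuous_intros)
    ultimately have "(\<lambda>z. q' z * zor_poly g \<xi> z) \<midarrow>\<xi>\<rightarrow> q' \<xi> * zor_poly g \<xi> \<xi>"
      by (intro tendsto_mult isContD)
    then have "(\<lambda>z. q z * g z) \<midarrow>\<xi>\<rightarrow> q' \<xi> * zor_poly g \<xi> \<xi>"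
    proof (rule Lim_transform_eventually)
      have "\<forall>\<^sub>F z in at \<xi>. z \<in> ball \<xi> r - {\<xi>}" using r(1) by (intro eventually_at_in_open) auto
      then show "\<forall>\<^sub>F z in at \<xi>. q' z * zor_poly g \<xi> z = q z * g z"
        by eventually_elim (use r(3) in \<open>auto simp: q\<close>)
    qed
    moreover have "q' \<xi> \<noteq> 0" unfolding q'_def using fS by (subst prod_zero_iff) auto
    ultimately show ?thesis using zp(2) by (intro exI[of _ "q' \<xi> * zor_poly g \<xi> \<xi>"]) auto
  qed
  then obtain L where L: "\<And>\<xi>. \<xi> \<in> S \<Longrightarrow> L \<xi> \<noteq> 0"
      "\<And>\<xi>. \<xi> \<in> S \<Longrightarrow> ((\<lambda>z. q z * g z) \<longlongrightarrow> L \<xi>) (at \<xi>)"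
    by metis
  define N where "N = (\<lambda>z. if z \<in> S then L z else q z * g z)"
  have "N holomorphic_on A"
  proof (rule no_isolated_singularity'[OF _ _ A fS])
    have "(\<lambda>z. q z * g z) holomorphic_on A - S"
      unfolding q_def by (intro holomorphic_intros hol)
    then show "N holomorphic_on A - S" by (rule holomorphic_transform) (auto simp: N_def)
    fix \<xi> assume \<xi>: "\<xi> \<in> S"
    have "(N \<longlongrightarrow> L \<xi>) (at \<xi>)"
    proof (rule Lim_transform_eventually[OF L(2)[OF \<xi>]])
      have "\<forall>\<^sub>F z in at \<xi>. z \<in> - (S - {\<xi>}) - {\<xi>}"
        by (intro eventually_at_in_open open_Compl finite_imp_closed) (use fS in auto)
      then show "\<forall>\<^sub>F z in at \<xi>. q z * g z = N z" by eventually_elim (auto simp: N_def)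
    qed
    then show "(N \<longlongrightarrow> N \<xi>) (at \<xi> within A)"
      using \<xi> by (auto simp: N_def intro: tendsto_within_subset)
  qed
  then show thesis
    by (rule that) (use L in \<open>auto simp: N_def S_def[symmetric] q_def\<close>)
qed

text \<open>The converse passage from a numerator to a function with one pole. The value 0 at \<xi>
  is the one that \<open>nicely_meromorphic_on\<close> prescribes at a pole.\<close>

lemma nicely_meromorphic_single_pole:
  assumes N: "N holomorphic_on A" and A: "open A" and \<xi>: "\<xi> \<in> A" "N \<xi> \<noteq> 0" and t: "1 \<le> t"
  defines "g \<equiv> (\<lambda>z. if z = \<xi> then 0 else N z / (z - \<xi>) ^ t)"
  shows "g nicely_meromorphic_on A" "poles_in g A = {\<xi>}" "pole_order g \<xi> = t"
proof -
  have hol: "g holomorphic_on A - {\<xi>}"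
  proof -
    have "(\<lambda>z. N z / (z - \<xi>) ^ t) holomorphic_on A - {\<xi>}"
      by (intro holomorphic_intros holomorphic_on_subset[OF N]) auto
    then show ?thesis by (rule holomorphic_transform) (auto simp: g_def)
  qed
  have an: "g analytic_on A - {\<xi>}" using hol A by (simp add: analytic_on_open open_delete)
  have cN: "isCont N \<xi>"
    using N A \<xi> by (meson continuous_on_eq_continuous_at holomorphic_on_imp_continuous_on)
  have "is_pole (\<lambda>z. N z / (z - \<xi>) ^ t) \<xi>"
    by (rule is_pole_divide[OF cN]) (use \<xi> t in \<open>auto intro!: filterlim_atI tendsto_eq_intros simp: eventually_at_filter\<close>)
  then have pole: "is_pole g \<xi>"
    by (rule is_pole_transform) (auto simp: g_def eventually_at_filter)
  have np: "\<not> is_pole g z" if "z \<in> A - {\<xi>}" for z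
    by (rule analytic_at_imp_no_pole, rule analytic_on_subset[OF an]) (use that in auto)
  show "g nicely_meromorphic_on A"
  proof (rule nicely_meromorphic_onI_open[OF A an])
    show "isolated_singularity_at g x" if "x \<in> A" for x
    proof (cases "x = \<xi>")
      case True
      then show ?thesis using isolated_singularity_at_holomorphic[OF hol A \<xi>(1)] by simp
    next
      case False
      then show ?thesis
        by (intro isolated_singularity_at_analytic analytic_on_subset[OF an]) (use that in auto)
    qed
  qed (use pole in \<open>auto simp: g_def\<close>)
  show "poles_in g A = {\<xi>}" using pole np \<xi> by (auto simp: poles_in_def)
  have "zorder g \<xi> = - int t"
    by (rule zorder_eqI[OF A \<xi>(1) N \<xi>(2)]) (auto simp: g_def power_int_minus field_simps)
  then show "pole_order g \<xi> = t" by (simp add: pole_order_def)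
qed

section \<open>Continuation of germs along E to canonical domains\<close>

context exterior_domain
begin

text \<open>N continues the germ of f along E to \<open>D \<rho>\<close>; away from E the values of
  f are irrelevant. A pole is expressed by continuing (z - \<xi>)^t G instead of G.\<close>

definition hext :: "real \<Rightarrow> (complex \<Rightarrow> complex) \<Rightarrow> (complex \<Rightarrow> complex) \<Rightarrow> bool" where
  "hext \<rho> f N \<longleftrightarrow> N holomorphic_on D \<rho> \<and> (\<exists>U. open U \<and> E \<subseteq> U \<and> (\<forall>z\<in>U. N z = f z))"

lemma hext_holomorphic: "hext \<rho> f N \<Longrightarrow> N holomorphic_on D \<rho>" by (simp add: hext_def)

lemma D_mono: "\<rho> \<le> \<rho>' \<Longrightarrow> D \<rho> \<subseteq> D \<rho>'" by (auto simp: mem_D)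

lemma hext_mono: "hext \<rho>' f N \<Longrightarrow> \<rho> \<le> \<rho>' \<Longrightarrow> hext \<rho> f N"
  unfolding hext_def using holomorphic_on_subset[OF _ D_mono, of N \<rho>' \<rho>] by blast

lemma hext_add:
  assumes "hext \<rho> f N" "hext \<rho> g M" shows "hext \<rho> (\<lambda>z. f z + g z) (\<lambda>z. N z + M z)"
proof -
  obtain U V where "open U" "E \<subseteq> U" "\<forall>z\<in>U. N z = f z" "open V" "E \<subseteq> V" "\<forall>z\<in>V. M z = g z"
    using assms by (auto simp: hext_def)
  then show ?thesis using assms unfolding hext_def
    by (intro conjI holomorphic_intros exI[of _ "U \<inter> V"]) auto
qed

lemma hext_mult_entire:
  assumes "h holomorphic_on UNIV" "hext \<rho> f N" shows "hext \<rho> (\<lambda>z. h z * f z) (\<lambda>z. h z * N z)"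
proof -
  have "h holomorphic_on D \<rho>" by (rule holomorphic_on_subset[OF assms(1)]) simp
  moreover obtain U where "open U" "E \<subseteq> U" "\<forall>z\<in>U. N z = f z" using assms(2) by (auto simp: hext_def)
  ultimately show ?thesis using assms(2) unfolding hext_def
    by (intro conjI holomorphic_intros exI[of _ U]) auto
qed

lemma hext_mult_poly: "hext \<rho> f N \<Longrightarrow> hext \<rho> (\<lambda>z. poly p z * f z) (\<lambda>z. poly p z * N z)"
  by (rule hext_mult_entire[of "poly p"]) (intro holomorphic_intros)

lemma hext_cong: "(\<And>z. f z = g z) \<Longrightarrow> hext \<rho> f N = hext \<rho> g N" by (simp add: hext_def)

lemma hext_unique:
  assumes "hext \<rho> f N" "hext \<rho>' f N'" "1 < \<rho>" "\<rho> \<le> \<rho>'" "z \<in> D \<rho>"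
  shows "N z = N' z"
proof -
  obtain U V where UV: "open U" "E \<subseteq> U" "\<forall>z\<in>U. N z = f z" "open V" "E \<subseteq> V" "\<forall>z\<in>V. N' z = f z"
    using assms by (auto simp: hext_def)
  have "0 \<in> U \<inter> V \<inter> D \<rho>" using UV zero_in_E by (auto simp: mem_D)
  moreover have "open (D \<rho>)" by (rule open_D) fact
  moreover have "connected (D \<rho>)" by (rule connected_canonical_domain) (use assms in auto)
  ultimately show ?thesis
    by (intro analytic_continuation_open[OF _ _ _ _ _ hext_holomorphic[OF assms(1)]
          hext_holomorphic[OF hext_mono[OF assms(2,4)]] _ assms(5), of "U \<inter> V \<inter> D \<rho>"])
       (use UV in \<open>blast | simp\<close>)+
qed

lemma analytic_hext:
  assumes "f analytic_on E" obtains \<rho> where "1 < \<rho>" "hext \<rho> f f"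
proof -
  obtain U where U: "open U" "E \<subseteq> U" "f holomorphic_on U"
    using assms by (auto simp: analytic_on_holomorphic)
  obtain s where "1 < s" "D s \<subseteq> U" using D_shrinks[of U 1] U Dc_1 by auto
  then show thesis using U holomorphic_on_subset[OF U(3), of "D s"]
    by (intro that[of s]) (auto simp: hext_def)
qed

lemma hext_imp_is_mero_ext:
  assumes "hext \<rho> f N" "1 < \<rho>"
  shows "is_mero_ext E (D \<rho>) f N" "poles_in N (D \<rho>) = {}"
proof -
  have an: "N analytic_on D \<rho>" using assms by (simp add: hext_def analytic_on_open open_D)
  then show "is_mero_ext E (D \<rho>) f N"
    using assms by (auto simp: hext_def is_mero_ext_def intro: analytic_on_imp_nicely_meromorphic_on)
  show "poles_in N (D \<rho>) = {}"
  proof -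
    have "\<not> is_pole N z" if "z \<in> D \<rho>" for z
      by (rule analytic_at_imp_no_pole, rule analytic_on_subset[OF an]) (use that in auto)
    then show ?thesis unfolding poles_in_def by blast
  qed
qed

lemma is_mero_ext_mono: "is_mero_ext E B G g \<Longrightarrow> A \<subseteq> B \<Longrightarrow> is_mero_ext E A G g"
  by (auto simp: is_mero_ext_def intro: nicely_meromorphic_on_subset)

lemma is_mero_ext_unique:
  assumes "is_mero_ext E A G g" "is_mero_ext E B G h" "1 < \<rho>"
    "canonical_domain E \<Phi> \<rho> \<subseteq> A \<inter> B" "z \<in> canonical_domain E \<Phi> \<rho>"
  shows "g z = h z"
proof -
  obtain U V where UV: "open U" "E \<subseteq> U" "\<forall>z\<in>U. g z = G z" "open V" "E \<subseteq> V" "\<forall>z\<in>V. h z = G z"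
    using assms by (auto simp: is_mero_ext_def)
  show ?thesis
  proof (rule nicely_meromorphic_eqI[where g = g and h = h and z = z and A = "canonical_domain E \<Phi> \<rho>" and U = "U \<inter> V"])
    show "g nicely_meromorphic_on canonical_domain E \<Phi> \<rho>" "h nicely_meromorphic_on canonical_domain E \<Phi> \<rho>"
      using assms by (auto simp: is_mero_ext_def intro: nicely_meromorphic_on_subset)
    show "open (U \<inter> V)" "U \<inter> V \<inter> canonical_domain E \<Phi> \<rho> \<noteq> {}"
      using UV zero_in_E by (auto simp: canonical_domain_def)
    show "open (canonical_domain E \<Phi> \<rho>)" "connected (canonical_domain E \<Phi> \<rho>)"
      using assms(3) by (rule open_canonical_domain connected_canonical_domain)+
  qed (use UV assms(5) in auto)
qed

lemma nicely_meromorphic_transform_open: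
  assumes "g nicely_meromorphic_on A" "open A" "\<And>z. z \<in> A \<Longrightarrow> g z = h z"
  shows "h nicely_meromorphic_on A"
proof -
  have ev: "\<forall>\<^sub>F w in at z. g w = h w" if "z \<in> A" for z
    using eventually_at_in_open'[OF assms(2) that] by eventually_elim (use assms(3) in auto)
  have "h meromorphic_on A"
  proof (subst meromorphic_on_cong)
    show "\<forall>\<^sub>F w in at z. h w = g w" if "z \<in> A" for z
      using ev[OF that] by eventually_elim simp
  qed (use assms in \<open>auto simp: nicely_meromorphic_on_def\<close>)
  moreover have "is_pole h z \<and> h z = 0 \<or> h \<midarrow>z\<rightarrow> h z" if "z \<in> A" for z
    using assms(1,3) that is_pole_cong[OF ev[OF that] refl] tendsto_cong[OF ev[OF that]]
    by (auto simp: nicely_meromorphic_on_def)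
  ultimately show ?thesis by (simp add: nicely_meromorphic_on_def)
qed

lemma canonical_domain_Sup: "S \<noteq> {} \<Longrightarrow> canonical_domain E \<Phi> (Sup S) = (\<Union>\<rho>\<in>S. canonical_domain E \<Phi> \<rho>)"
  by (auto simp: canonical_domain_def less_Sup_iff)

text \<open>Extensions to two canonical domains agree on the smaller one, so they glue. This makes
  the supremum of admissible indices attained and ensures that the choice in \<open>mero_ext\<close>
  picks a genuine extension, which is unique on that domain.\<close>

lemma mero_ext_Sup:
  assumes S: "S \<noteq> {}" "\<And>\<rho>. \<rho> \<in> S \<Longrightarrow> 1 < \<rho> \<and> is_mero_ext E (canonical_domain E \<Phi> \<rho>) G (h \<rho>)"
  defines "g \<equiv> mero_ext E (canonical_domain E \<Phi> (Sup S)) G"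
  shows "is_mero_ext E (canonical_domain E \<Phi> (Sup S)) G g"
    "\<And>\<rho> z. \<rho> \<in> S \<Longrightarrow> z \<in> canonical_domain E \<Phi> \<rho> \<Longrightarrow> g z = h \<rho> z"
proof -
  let ?C = "canonical_domain E \<Phi>"
  define k where "k = (\<lambda>z. h (SOME \<rho>. \<rho> \<in> S \<and> z \<in> ?C \<rho>) z)"
  have k: "h \<rho> z = k z" if "\<rho> \<in> S" "z \<in> ?C \<rho>" for \<rho> z
  proof -
    define \<rho>' where "\<rho>' = (SOME \<rho>. \<rho> \<in> S \<and> z \<in> ?C \<rho>)"
    have \<rho>': "\<rho>' \<in> S" "z \<in> ?C \<rho>'"
      using someI[of "\<lambda>\<rho>. \<rho> \<in> S \<and> z \<in> ?C \<rho>" \<rho>] that unfolding \<rho>'_def by auto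
    have "h \<rho> z = h \<rho>' z"
    proof (rule is_mero_ext_unique[of "?C \<rho>" G "h \<rho>" "?C \<rho>'" "h \<rho>'" "min \<rho> \<rho>'"])
      show "?C (min \<rho> \<rho>') \<subseteq> ?C \<rho> \<inter> ?C \<rho>'" by (simp add: canonical_domain_mono)
      show "z \<in> ?C (min \<rho> \<rho>')" using that \<rho>' by (auto simp: canonical_domain_def)
    qed (use S that \<rho>' in auto)
    then show ?thesis by (simp add: k_def \<rho>'_def)
  qed
  have "is_mero_ext E (?C (Sup S)) G k" unfolding is_mero_ext_def
  proof
    have nm: "k nicely_meromorphic_on ?C \<rho>" if "\<rho> \<in> S" for \<rho>
      using S(2)[OF that] k[OF that] open_canonical_domain
      by (auto simp: is_mero_ext_def intro: nicely_meromorphic_transform_open)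
    show "k nicely_meromorphic_on ?C (Sup S)"
      using nm unfolding nicely_meromorphic_on_def canonical_domain_Sup[OF S(1)]
      by (auto simp: meromorphic_on_UN)
    obtain \<rho> where \<rho>: "\<rho> \<in> S" using S by auto
    obtain U where U: "open U" "E \<subseteq> U" "\<forall>z\<in>U. h \<rho> z = G z"
      using S(2)[OF \<rho>] by (auto simp: is_mero_ext_def)
    show "\<exists>U. open U \<and> E \<subseteq> U \<and> (\<forall>z\<in>U. k z = G z)"
      by (rule exI[of _ "U \<inter> ?C \<rho>"])
       (use U k[OF \<rho>] S(2)[OF \<rho>] open_canonical_domain[of \<rho>] E_subset_canonical[of \<rho>] in \<open>auto intro: open_Int\<close>)
  qed
  then show g: "is_mero_ext E (?C (Sup S)) G g"
    unfolding g_def mero_ext_def by (rule someI[of "is_mero_ext E (?C (Sup S)) G"])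
  fix \<rho> z assume \<rho>: "\<rho> \<in> S" "z \<in> ?C \<rho>"
  show "g z = h \<rho> z"
    by (rule is_mero_ext_unique[OF g, of "?C \<rho>" "h \<rho>" \<rho>])
      (use S(2)[OF \<rho>(1)] \<rho> canonical_domain_mono[OF Sup_upper[OF \<rho>(1)]] in auto)
qed

section \<open>Faber coefficients as Laurent coefficients in the exterior coordinate\<close>

lemma holomorphic_comp_Psi:
  assumes "N holomorphic_on D \<rho>" shows "(\<lambda>w. N (\<Psi> w)) holomorphic_on {w. 1 < norm w \<and> norm w < \<rho>}"
proof -
  have "\<Psi> holomorphic_on {w. 1 < norm w \<and> norm w < \<rho>}"
    by (rule holomorphic_on_subset[OF holomorphic_Psi]) auto
  then have "(N \<circ> \<Psi>) holomorphic_on {w. 1 < norm w \<and> norm w < \<rho>}"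
    by (rule holomorphic_on_compose_gen[OF _ assms]) (auto simp: mem_D Phi_Psi)
  then show ?thesis by (simp add: o_def)
qed

lemma open_annulus: "open {w::complex. a < norm w \<and> norm w < b}"
  by (intro open_Collect_conj open_Collect_less continuous_intros)

lemma continuous_comp_Psi:
  assumes "N holomorphic_on D \<rho>" "1 < r" "r < \<rho>" shows "continuous_on (sphere 0 r) (\<lambda>w. N (\<Psi> w))"
  by (rule continuous_on_subset[OF holomorphic_on_imp_continuous_on[OF holomorphic_comp_Psi[OF assms(1)]]])
    (use assms in auto)

lemma circle_coeff_Psi_radius:
  assumes "N holomorphic_on D \<rho>" "1 < r" "r < \<rho>" "1 < s" "s < \<rho>"
  shows "circle_coeff (\<lambda>w. N (\<Psi> w)) r n = circle_coeff (\<lambda>w. N (\<Psi> w)) s n"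
proof -
  have *: "circle_coeff (\<lambda>w. N (\<Psi> w)) r n = circle_coeff (\<lambda>w. N (\<Psi> w)) s n"
    if "1 < r" "r \<le> s" "s < \<rho>" for r s
    by (rule circle_coeff_radius[OF _ _ open_annulus _ holomorphic_comp_Psi[OF assms(1)]])
      (use that in auto)
  show ?thesis
  proof (cases "r \<le> s")
    case True
    then show ?thesis by (intro * assms)
  next
    case False
    then show ?thesis by (intro *[symmetric] assms) simp
  qed
qed

text \<open>Substitution t = \<Psi> w; the factor \<Phi>'(t) cancels \<Psi>'(w).\<close>

lemma contour_integral_level_path:
  assumes r: "1 < r"
  shows "1 / (2 * of_real pi * \<i>) * contour_integral (level_path E \<Phi> r) (\<lambda>t. g t * deriv \<Phi> t / \<Phi> t ^ (n + 1))
       = circle_coeff (\<lambda>w. g (\<Psi> w)) r n"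
proof -
  have "contour_integral (\<Psi> \<circ> circlepath 0 r) (\<lambda>t. g t * deriv \<Phi> t / \<Phi> t ^ (n + 1)) =
     contour_integral (circlepath 0 r) (\<lambda>w. deriv \<Psi> w * (g (\<Psi> w) * deriv \<Phi> (\<Psi> w) / \<Phi> (\<Psi> w) ^ (n + 1)))"
    by (rule contour_integral_comp_analyticW[of _ "{w. 1 < norm w}"])
      (use r holomorphic_Psi in \<open>auto simp: analytic_on_open open_exterior_disc\<close>)
  also have "\<dots> = contour_integral (circlepath 0 r) (\<lambda>w. g (\<Psi> w) / w ^ (n + 1))"
  proof (rule contour_integral_cong[OF refl])
    fix w assume "w \<in> path_image (circlepath 0 r)"
    then have w: "1 < norm w" using r by auto
    have "deriv \<Psi> w * (g (\<Psi> w) * deriv \<Phi> (\<Psi> w) / \<Phi> (\<Psi> w) ^ (n + 1)) =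
      (deriv \<Phi> (\<Psi> w) * deriv \<Psi> w) * (g (\<Psi> w) / w ^ (n + 1))"
      using w by (simp add: Phi_Psi)
    then show "deriv \<Psi> w * (g (\<Psi> w) * deriv \<Phi> (\<Psi> w) / \<Phi> (\<Psi> w) ^ (n + 1)) = g (\<Psi> w) / w ^ (n + 1)"
      using deriv_Phi_Psi[OF w] by simp
  qed
  finally show ?thesis by (simp add: level_path_def circle_coeff_def \<Psi>_def)
qed

text \<open>The definition refers to the maximal extension and to all radii below its index. That
  extension is holomorphic on every admissible domain, so the integral does not depend on the
  radius, and it agrees with N on \<open>D \<rho>\<close>; the given r is itself admissible, which
  gives uniqueness.\<close>

lemma faber_coeff_eq:
  assumes N: "hext \<rho> f N" and r: "1 < r" "r < \<rho>"
  shows "faber_coeff E \<Phi> f n = circle_coeff (\<lambda>w. N (\<Psi> w)) r n"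
proof -
  let ?C = "canonical_domain E \<Phi>"
  define ok where "ok = (\<lambda>\<rho> g. is_mero_ext E (?C \<rho>) f g \<and> finite (poles_in g (?C \<rho>)) \<and>
          (\<Sum>z\<in>poles_in g (?C \<rho>). pole_order g z) \<le> 0)"
  define S where "S = {\<rho>. 1 < \<rho> \<and> (\<exists>g. ok \<rho> g)}"
  define R where "R = rho_mero E \<Phi> 0 f"
  have R: "R = Sup S" by (simp add: R_def rho_mero_def S_def ok_def)
  define h where "h = (\<lambda>\<rho>. SOME g. ok \<rho> g)"
  have h: "1 < \<rho>" "is_mero_ext E (?C \<rho>) f (h \<rho>)" "poles_in (h \<rho>) (?C \<rho>) = {}" if "\<rho> \<in> S" for \<rho>
  proof -
    have *: "ok \<rho> (h \<rho>)"
      using someI_ex[of "ok \<rho>"] that by (simp add: S_def h_def)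
    then show "is_mero_ext E (?C \<rho>) f (h \<rho>)" by (simp add: ok_def)
    show "1 < \<rho>" using that by (simp add: S_def)
    \<comment> \<open>A pole has positive order, so total order at most 0 leaves no pole.\<close>
    show "poles_in (h \<rho>) (?C \<rho>) = {}"
    proof (rule ccontr)
      assume "poles_in (h \<rho>) (?C \<rho>) \<noteq> {}"
      then obtain z where z: "z \<in> poles_in (h \<rho>) (?C \<rho>)" by auto
      then have "pole_order (h \<rho>) z > 0"
        using * pole_order_pos[of "h \<rho>" "?C \<rho>" z] by (auto simp: ok_def is_mero_ext_def poles_in_def)
      then show False using * z by (auto simp: ok_def sum_eq_0_iff)
    qed
  qed
  have \<rho>S: "ereal \<rho> \<in> S"
  proof -
    have "1 < \<rho>" using r by simp
    from hext_imp_is_mero_ext[OF N this] this show ?thesis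
      unfolding S_def ok_def by (auto intro!: exI[of _ N])
  qed
  define g where "g = mero_ext E (?C R) f"
  have g: "is_mero_ext E (?C R) f g" "\<And>s z. s \<in> S \<Longrightarrow> z \<in> ?C s \<Longrightarrow> g z = h s z"
    using mero_ext_Sup[of S f h] \<rho>S h unfolding g_def R by auto
  have hol: "g holomorphic_on ?C s" if "s \<in> S" for s
  proof -
    have "h s analytic_on ?C s"
      using h[OF that] nicely_meromorphic_without_singularities
      by (auto simp: is_mero_ext_def poles_in_def)
    from holomorphic_transform[OF analytic_imp_holomorphic[OF this]] show ?thesis
      using g(2)[OF that] by auto
  qed
  have eqN: "g z = N z" if "z \<in> D \<rho>" for z
  proof (rule is_mero_ext_unique[OF g(1) hext_imp_is_mero_ext(1)[OF N], of \<rho>])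
    have "canonical_domain E \<Phi> (ereal \<rho>) \<subseteq> ?C R"
      unfolding R by (intro canonical_domain_mono Sup_upper \<rho>S)
    then show "canonical_domain E \<Phi> (ereal \<rho>) \<subseteq> ?C R \<inter> D \<rho>" by auto
  qed (use r that in auto)
  have val: "circle_coeff (\<lambda>w. g (\<Psi> w)) s n = circle_coeff (\<lambda>w. N (\<Psi> w)) r n" if s: "1 < s" "ereal s < R" for s
  proof -
    obtain \<sigma> where \<sigma>: "\<sigma> \<in> S" "ereal s < \<sigma>" using s unfolding R less_Sup_iff by auto
    \<comment> \<open>An admissible index above both s and r, so that the integrals over the two
      circles can be compared within one domain of holomorphy.\<close>
    define \<sigma>' where "\<sigma>' = max \<sigma> (ereal \<rho>)"
    have \<sigma>': "\<sigma>' \<in> S" using \<sigma> \<rho>S by (simp add: \<sigma>'_def max_def)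
    have "ereal s < \<sigma>'" by (rule less_le_trans[OF \<sigma>(2)]) (simp add: \<sigma>'_def)
    moreover have "ereal r < \<sigma>'" by (rule less_le_trans[of _ "ereal \<rho>"]) (use r in \<open>simp_all add: \<sigma>'_def\<close>)
    ultimately have "ereal (max s r) < \<sigma>'" by (simp only: max_def split: if_split) simp
    then obtain u where u: "max s r < u" "ereal u < \<sigma>'"
      using ereal_dense2[of "ereal (max s r)" \<sigma>'] by (metis less_ereal.simps(1))
    have "g holomorphic_on D u"
      by (rule holomorphic_on_subset[OF hol[OF \<sigma>'] canonical_domain_mono]) (use u in auto)
    then have "circle_coeff (\<lambda>w. g (\<Psi> w)) s n = circle_coeff (\<lambda>w. g (\<Psi> w)) r n"
      by (rule circle_coeff_Psi_radius) (use u s r in auto)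
    also have "\<dots> = circle_coeff (\<lambda>w. N (\<Psi> w)) r n"
      by (rule circle_coeff_cong) (use r eqN in \<open>auto simp: mem_D Phi_Psi\<close>)
    finally show ?thesis .
  qed
  have "ereal r < R" unfolding R by (rule less_le_trans[OF _ Sup_upper[OF \<rho>S]]) (use r in auto)
  let ?J = "\<lambda>s. 1 / (2 * of_real pi * \<i>) *
      contour_integral (level_path E \<Phi> s) (\<lambda>t. g t * deriv \<Phi> t / \<Phi> t ^ (n + 1))"
  have eqv: "?J s = circle_coeff (\<lambda>w. N (\<Psi> w)) r n" if "1 < s" "ereal s < R" for s
    by (rule trans[OF contour_integral_level_path[OF that(1)] val[OF that]])
  show ?thesis unfolding faber_coeff_def R_def[symmetric] g_def[symmetric]
  proof (rule the_equality)
    show "\<forall>s. 1 < s \<and> ereal s < R \<longrightarrow> circle_coeff (\<lambda>w. N (\<Psi> w)) r n = ?J s"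
      by (intro allI impI, elim conjE, rule sym, rule eqv)
    fix c assume "\<forall>s. 1 < s \<and> ereal s < R \<longrightarrow> c = ?J s"
    then have "c = ?J r" using r(1) \<open>ereal r < R\<close> by blast
    also have "\<dots> = circle_coeff (\<lambda>w. N (\<Psi> w)) r n" by (rule eqv[OF r(1) \<open>ereal r < R\<close>])
    finally show "c = circle_coeff (\<lambda>w. N (\<Psi> w)) r n" .
  qed
qed

section \<open>Faber coefficients and the Cauchy formula on level curves\<close>

text \<open>Faber coefficients, computed on the level curve of index \<open>r\<close>; see \<open>faber_coeff_eq\<close>.\<close>

abbreviation cf :: "(complex \<Rightarrow> complex) \<Rightarrow> real \<Rightarrow> nat \<Rightarrow> complex" where
  "cf N r n \<equiv> circle_coeff (\<lambda>w. N (\<Psi> w)) r n"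

lemma Psi_eq_iff: "1 < norm w \<Longrightarrow> \<Psi> w = z \<longleftrightarrow> z \<notin> E \<and> w = \<Phi> z"
  by (auto simp: Phi_Psi Psi_notin Psi_Phi)

text \<open>After multiplication by w the integrand tends to l, because \<Psi>' and \<Psi> w / w
  have the same limit 1 / \<open>cap\<close>; so its coefficient of index 0 is l. With v = 1 this is
  a winding number, with l = 0 it discards a principal part.\<close>

lemma Cauchy_kernel_at_infinity:
  assumes v: "v holomorphic_on {w. A < norm w}" "(v \<longlongrightarrow> l) at_infinity" and r: "0 \<le> A" "A < r" "1 < r" and z: "z \<in> D r"
  shows "1 / (2 * of_real pi * \<i>) * contour_integral (circlepath 0 r) (\<lambda>w. v w * deriv \<Psi> w / (\<Psi> w - z)) = l"
proof -
  \<comment> \<open>Beyond B the denominator \<Psi> w - z has no zero. On E, where \<Phi> carries no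
    information, the level 1 is used.\<close>
  define B where "B = max A (max 1 (if z \<in> E then 1 else norm (\<Phi> z)))"
  have B: "A \<le> B" "1 \<le> B" "B < r" "z \<notin> E \<Longrightarrow> norm (\<Phi> z) \<le> B" using r z by (auto simp: B_def mem_D)
  define f where "f = (\<lambda>w. v w * deriv \<Psi> w * w / (\<Psi> w - z))"
  have ne: "\<Psi> w \<noteq> z" if "B < norm w" for w using that B Psi_eq_iff[of w z] by auto
  have "circle_coeff f r 0 = l"
  proof (rule circle_coeff_lim[OF _ B(3)])
    have "deriv \<Psi> holomorphic_on {w. 1 < norm w}" "\<Psi> holomorphic_on {w. 1 < norm w}"
      using holomorphic_Psi by (auto intro: holomorphic_deriv open_exterior_disc)
    then have "deriv \<Psi> holomorphic_on {w. B < norm w}" "\<Psi> holomorphic_on {w. B < norm w}"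
      "v holomorphic_on {w. B < norm w}"
      using B v(1) by (auto elim!: holomorphic_on_subset)
    then show "f holomorphic_on {w. B < norm w}" unfolding f_def
      by (intro holomorphic_intros open_exterior_disc) (use ne in auto)
    have inv: "((\<lambda>w. 1 / w) \<longlongrightarrow> 0) (at_infinity :: complex filter)"
      by (intro tendsto_divide_0[OF tendsto_const] filterlim_ident)
    have "((\<lambda>w. v w * deriv \<Psi> w / (\<Psi> w / w - z * (1 / w))) \<longlongrightarrow>
        l * (1 / of_real cap) / (1 / of_real cap - z * 0)) at_infinity"
      by (intro tendsto_intros v(2) deriv_Psi_at_infinity Psi_at_infinity inv) (use cap_pos in auto)
    then have "((\<lambda>w. v w * deriv \<Psi> w / (\<Psi> w / w - z * (1 / w))) \<longlongrightarrow> l) at_infinity"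
      using cap_pos by simp
    then show "((\<lambda>w. f w / w ^ 0) \<longlongrightarrow> l) at_infinity"
    proof (rule Lim_transform_eventually)
      show "\<forall>\<^sub>F w in at_infinity. v w * deriv \<Psi> w / (\<Psi> w / w - z * (1 / w)) = f w / w ^ 0"
      proof (rule eventually_at_infinityI[of "B + 1"])
        fix w :: complex assume w: "B + 1 \<le> norm w"
        then have "w \<noteq> 0" "\<Psi> w - z \<noteq> 0" using B ne[of w] by auto
        moreover have "\<Psi> w / w - z * (1 / w) = (\<Psi> w - z) / w" by (simp add: diff_divide_distrib)
        ultimately show "v w * deriv \<Psi> w / (\<Psi> w / w - z * (1 / w)) = f w / w ^ 0"
          by (simp add: f_def)
      qed
    qed
  qed (use B in auto)
  moreover have "contour_integral (circlepath 0 r) (\<lambda>w. f w / w ^ (0 + 1)) =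
     contour_integral (circlepath 0 r) (\<lambda>w. v w * deriv \<Psi> w / (\<Psi> w - z))"
    by (rule contour_integral_cong) (use r in \<open>auto simp: f_def\<close>)
  ultimately show ?thesis by (simp only: circle_coeff_def)
qed

lemma level_path_facts:
  assumes "1 < r"
  shows "valid_path (\<Psi> \<circ> circlepath 0 r)" "pathfinish (\<Psi> \<circ> circlepath 0 r) = pathstart (\<Psi> \<circ> circlepath 0 r)"
    "path_image (\<Psi> \<circ> circlepath 0 r) = {z. z \<notin> E \<and> norm (\<Phi> z) = r}"
proof -
  show "valid_path (\<Psi> \<circ> circlepath 0 r)"
    by (rule valid_path_compose_holomorphic[OF _ holomorphic_Psi open_exterior_disc]) (use assms in auto)
  show "pathfinish (\<Psi> \<circ> circlepath 0 r) = pathstart (\<Psi> \<circ> circlepath 0 r)"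
    by (simp add: pathfinish_compose pathstart_compose)
  show "path_image (\<Psi> \<circ> circlepath 0 r) = {z. z \<notin> E \<and> norm (\<Phi> z) = r}"
  proof -
    have "path_image (\<Psi> \<circ> circlepath 0 r) = \<Psi> ` sphere 0 r"
      using assms by (simp add: path_image_compose)
    also have "\<dots> = {z. z \<notin> E \<and> norm (\<Phi> z) = r}"
    proof (intro equalityI subsetI)
      fix z assume "z \<in> {z. z \<notin> E \<and> norm (\<Phi> z) = r}"
      then show "z \<in> \<Psi> ` sphere 0 r" using Psi_Phi by (intro image_eqI[of _ _ "\<Phi> z"]) auto
    qed (use assms Psi_notin Phi_Psi in auto)
    finally show ?thesis .
  qed
qed

lemma contour_integral_Psi:
  assumes "1 < r"
  shows "contour_integral (\<Psi> \<circ> circlepath 0 r) g = contour_integral (circlepath 0 r) (\<lambda>w. deriv \<Psi> w * g (\<Psi> w))"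
  by (rule contour_integral_comp_analyticW[of _ "{w. 1 < norm w}"])
      (use assms holomorphic_Psi in \<open>auto simp: analytic_on_open open_exterior_disc\<close>)

lemma winding_number_level_inside:
  assumes r: "1 < r" and z: "z \<in> D r" shows "winding_number (\<Psi> \<circ> circlepath 0 r) z = 1"
proof -
  have "z \<notin> path_image (\<Psi> \<circ> circlepath 0 r)" unfolding level_path_facts(3)[OF r] using z by (auto simp: mem_D)
  then have "winding_number (\<Psi> \<circ> circlepath 0 r) z =
     1 / (2 * of_real pi * \<i>) * contour_integral (circlepath 0 r) (\<lambda>w. deriv \<Psi> w * (1 / (\<Psi> w - z)))"
    using winding_number_valid_path[OF level_path_facts(1)[OF r]] contour_integral_Psi[OF r] by simp
  also have "\<dots> = 1"
    using Cauchy_kernel_at_infinity[of "\<lambda>_. 1" 0 1 r z] r z by simp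
  finally show ?thesis .
qed

text \<open>The points beyond the level r form a connected set, the image of |w| > r, that misses
  the curve and reaches arbitrarily far out, where the winding number is 0.\<close>

lemma winding_number_level_outside:
  assumes r: "1 < r" and z: "z \<notin> E" "r < norm (\<Phi> z)" shows "winding_number (\<Psi> \<circ> circlepath 0 r) z = 0"
proof -
  let ?\<gamma> = "\<Psi> \<circ> circlepath 0 r"
  have p: "path ?\<gamma>" using level_path_facts(1)[OF r] by (rule valid_path_imp_path)
  define S where "S = \<Psi> ` {w. r < norm w}"
  have "{w::complex. r < norm w} = - cball 0 r" by auto
  then have "connected {w::complex. r < norm w}"
    using connected_complement_bounded_convex[of "cball (0::complex) r"] by simp
  then have S: "connected S" unfolding S_def
    by (rule connected_continuous_image[rotated], intro continuous_at_imp_continuous_on)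
      (use r isCont_Psi in auto)
  have Sd: "S \<inter> path_image ?\<gamma> = {}"
  proof -
    have "norm (\<Phi> y) \<noteq> r" if "y \<in> S" for y
    proof -
      obtain w where w: "y = \<Psi> w" "r < norm w" using \<open>y \<in> S\<close> by (auto simp: S_def)
      then have "\<Phi> y = w" using r by (auto intro: Phi_Psi)
      then show ?thesis using w by simp
    qed
    then show ?thesis unfolding level_path_facts(3)[OF r] by blast
  qed
  obtain B where B: "\<And>z. B \<le> norm z \<Longrightarrow> winding_number ?\<gamma> z = 0"
    using winding_number_zero_at_infinity[OF p level_path_facts(2)[OF r]] by auto
  have "\<forall>\<^sub>F w in at_infinity. max 1 B \<le> norm (\<Psi> w)"
    using filterlim_Psi[unfolded filterlim_at_infinity[OF order_refl], rule_format, of "max 1 B"]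
    by (simp only: max.strict_coboundedI1 zero_less_one)
  then obtain b where b: "\<And>w. b \<le> norm w \<Longrightarrow> B \<le> norm (\<Psi> w)"
    by (auto simp: eventually_at_infinity)
  define w where "w = complex_of_real (max b (r + 1))"
  have nw: "norm w = max b (r + 1)" using r unfolding w_def norm_of_real by linarith
  have w: "r < norm w" "B \<le> norm (\<Psi> w)" using b[of w] by (auto simp: nw)
  have "\<Psi> w \<in> S" using w(1) by (simp add: S_def)
  moreover have "z \<in> S" unfolding S_def using z Psi_Phi[OF z(1)] by (intro image_eqI[of _ _ "\<Phi> z"]) simp_all
  ultimately have "winding_number ?\<gamma> z = winding_number ?\<gamma> (\<Psi> w)"
    by (intro winding_number_eq[OF p level_path_facts(2)[OF r] _ _ S Sd])
  then show ?thesis using B w by simp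
qed

lemma Cauchy_level:
  assumes N: "N holomorphic_on D \<rho>" and r: "1 < r" "r < \<rho>" and z: "z \<in> D r"
  shows "1 / (2 * of_real pi * \<i>) * contour_integral (circlepath 0 r) (\<lambda>w. N (\<Psi> w) * deriv \<Psi> w / (\<Psi> w - z)) = N z"
proof -
  have "((\<lambda>w. N w / (w - z)) has_contour_integral
      (2 * pi * \<i> * winding_number (\<Psi> \<circ> circlepath 0 r) z * N z)) (\<Psi> \<circ> circlepath 0 r)"
  proof (rule Cauchy_integral_formula_global[OF open_D N _ level_path_facts(1) _ level_path_facts(2)])
    show "z \<in> D \<rho>" using z r by (auto simp: mem_D)
    show "path_image (\<Psi> \<circ> circlepath 0 r) \<subseteq> D \<rho> - {z}"
      unfolding level_path_facts(3)[OF r(1)] using r z by (auto simp: mem_D)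
    fix w assume "w \<notin> D \<rho>"
    then show "winding_number (\<Psi> \<circ> circlepath 0 r) w = 0"
      by (intro winding_number_level_outside) (use r in \<open>auto simp: mem_D\<close>)
  qed (use r in auto)
  from contour_integral_unique[OF this]
  have "contour_integral (circlepath 0 r) (\<lambda>w. deriv \<Psi> w * (N (\<Psi> w) / (\<Psi> w - z))) =
      2 * pi * \<i> * N z"
    unfolding winding_number_level_inside[OF r(1) z] contour_integral_Psi[OF r(1)] by simp
  then show ?thesis by (simp add: mult_ac)
qed

text \<open>On the level curve the power series in w equals N \<circ> \<Psi> minus its principal
  part v. The kernel integral of v is 0, so Cauchy's formula for N survives when N \<circ> \<Psi> is
  replaced by the series.\<close>

lemma cf_summable:
  assumes N: "N holomorphic_on D \<rho>" and r: "1 < r" "r < \<rho>"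
  shows "summable (\<lambda>n. norm (cf N r n) * r ^ n)"
    and "z \<in> D r \<Longrightarrow> N z = 1 / (2 * of_real pi * \<i>) * contour_integral (circlepath 0 r)
      (\<lambda>w. (\<Sum>n. cf N r n * w ^ n) * deriv \<Psi> w / (\<Psi> w - z))"
proof -
  define r1 r2 where "r1 = (1 + r) / 2" and "r2 = (r + \<rho>) / 2"
  have rr: "0 < r1" "1 < r1" "r1 < r" "r < r2" "r2 < \<rho>" using r by (auto simp: r1_def r2_def)
  have NP: "(\<lambda>w. N (\<Psi> w)) holomorphic_on {w. 1 < norm w \<and> norm w < \<rho>}"
    by (rule holomorphic_comp_Psi[OF N])
  obtain v where v: "v holomorphic_on {w. r1 < norm w}" "(v \<longlongrightarrow> 0) at_infinity"
    "\<And>w. r1 < norm w \<Longrightarrow> norm w < r2 \<Longrightarrow> (\<lambda>n. cf N r n * w ^ n) sums (N (\<Psi> w) - v w)"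
  proof -
    have "{w::complex. r1 \<le> norm w \<and> norm w \<le> r2} \<subseteq> {w. 1 < norm w \<and> norm w < \<rho>}" using rr by auto
    from Laurent_split_coeff[OF rr(1,3,4) open_annulus this NP] that show thesis by blast
  qed
  \<comment> \<open>Convergence at a point of slightly larger modulus gives absolute convergence on
    the circle of radius r.\<close>
  define x where "x = complex_of_real ((r + r2) / 2)"
  have nx: "norm x = (r + r2) / 2" unfolding x_def norm_of_real using rr by simp
  have "summable (\<lambda>n. cf N r n * x ^ n)"
    by (rule sums_summable[OF v(3)]) (use rr in \<open>auto simp: nx\<close>)
  then have "summable (\<lambda>n. norm (cf N r n * (of_real r) ^ n))"
    by (rule powser_insidea) (use rr in \<open>simp add: nx\<close>)
  then show "summable (\<lambda>n. norm (cf N r n) * r ^ n)"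
    using r by (simp add: norm_mult norm_power)
  assume z: "z \<in> D r"
  have ne: "\<Psi> w \<noteq> z" if "norm w = r" for w using that r z Psi_eq_iff[of w z] by (auto simp: mem_D)
  have c: "continuous_on (sphere 0 r) (\<lambda>w. N (\<Psi> w))" "continuous_on (sphere 0 r) v"
    "continuous_on (sphere 0 r) (deriv \<Psi>)" "continuous_on (sphere 0 r) \<Psi>"
    using continuous_comp_Psi[OF N r] holomorphic_on_imp_continuous_on[OF v(1)]
      holomorphic_on_imp_continuous_on[OF holomorphic_Psi]
      holomorphic_on_imp_continuous_on[OF holomorphic_deriv[OF holomorphic_Psi open_exterior_disc]] r rr
    by (auto elim!: continuous_on_subset)
  have "contour_integral (circlepath 0 r) (\<lambda>w. (\<Sum>n. cf N r n * w ^ n) * deriv \<Psi> w / (\<Psi> w - z)) =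
     contour_integral (circlepath 0 r) (\<lambda>w. N (\<Psi> w) * deriv \<Psi> w / (\<Psi> w - z) - v w * deriv \<Psi> w / (\<Psi> w - z))"
  proof (rule contour_integral_cong[OF refl])
    fix w assume "w \<in> path_image (circlepath 0 r)"
    then have w: "norm w = r" using r by auto
    have "(\<Sum>n. cf N r n * w ^ n) = N (\<Psi> w) - v w" using v(3)[of w] w rr by (simp add: sums_iff)
    then show "(\<Sum>n. cf N r n * w ^ n) * deriv \<Psi> w / (\<Psi> w - z) =
       N (\<Psi> w) * deriv \<Psi> w / (\<Psi> w - z) - v w * deriv \<Psi> w / (\<Psi> w - z)"
      by (simp add: left_diff_distrib diff_divide_distrib)
  qed
  also have "\<dots> = contour_integral (circlepath 0 r) (\<lambda>w. N (\<Psi> w) * deriv \<Psi> w / (\<Psi> w - z)) -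
     contour_integral (circlepath 0 r) (\<lambda>w. v w * deriv \<Psi> w / (\<Psi> w - z))"
    by (rule contour_integral_diff; rule contour_integrable_continuous_circlepath)
      (use r ne c in \<open>auto intro!: continuous_intros\<close>)
  finally show "N z = 1 / (2 * of_real pi * \<i>) * contour_integral (circlepath 0 r)
      (\<lambda>w. (\<Sum>n. cf N r n * w ^ n) * deriv \<Psi> w / (\<Psi> w - z))"
    using Cauchy_level[OF N r z] Cauchy_kernel_at_infinity[OF v(1,2) _ rr(3) r(1) z] rr
    by (simp add: right_diff_distrib)
qed

text \<open>The kernel is continuous on the compact product of \<open>Dc s\<close> and the circle,
  hence bounded. The constant depends on r and s only, so the bound applies to whole families of
  functions and of polynomials, in the role usually played by estimates of Faber
  polynomials.\<close>

lemma Faber_bound: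
  assumes r: "1 < r" "s < r"
  obtains C where "0 \<le> C" "\<And>\<rho> N z. N holomorphic_on D \<rho> \<Longrightarrow> r < \<rho> \<Longrightarrow> z \<in> Dc s \<Longrightarrow>
     norm (N z) \<le> C * (\<Sum>n. norm (cf N r n) * r ^ n)"
proof -
  let ?h = "\<lambda>(z, w). deriv \<Psi> w / (\<Psi> w - z)"
  have ne: "\<Psi> w \<noteq> z" if "norm w = r" "z \<in> Dc s" for w z
    using that r Psi_eq_iff[of w z] by (auto simp: Dc_def)
  have c: "continuous_on (sphere 0 r) (deriv \<Psi>)" "continuous_on (sphere 0 r) \<Psi>"
    using holomorphic_on_imp_continuous_on[OF holomorphic_Psi]
      holomorphic_on_imp_continuous_on[OF holomorphic_deriv[OF holomorphic_Psi open_exterior_disc]] r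
    by (auto elim!: continuous_on_subset)
  have "continuous_on (Dc s \<times> sphere 0 r) ?h"
    unfolding split_beta
    by (intro continuous_intros continuous_on_compose2[OF c(1)] continuous_on_compose2[OF c(2)])
      (use ne in auto)
  then have "bounded (?h ` (Dc s \<times> sphere 0 r))"
    by (intro compact_imp_bounded compact_continuous_image compact_Times compact_Dc) auto
  then obtain B where B: "B > 0" "\<And>x. x \<in> Dc s \<times> sphere 0 r \<Longrightarrow> norm (?h x) \<le> B"
    unfolding bounded_pos by auto
  show thesis
  proof (rule that[of "B * r"])
    fix \<rho> N z assume N: "N holomorphic_on D \<rho>" and \<rho>: "r < \<rho>" and z: "z \<in> Dc s"
    define T where "T = (\<Sum>n. norm (cf N r n) * r ^ n)"
    have sm: "summable (\<lambda>n. norm (cf N r n) * r ^ n)" by (rule cf_summable(1)[OF N r(1) \<rho>])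
    have T0: "0 \<le> T" unfolding T_def by (rule suminf_nonneg[OF sm]) (use r in auto)
    have zr: "z \<in> D r" using z r by (auto simp: Dc_def mem_D)
    let ?g = "\<lambda>w. (\<Sum>n. cf N r n * w ^ n) * deriv \<Psi> w / (\<Psi> w - z)"
    have Tb: "norm (\<Sum>n. cf N r n * w ^ n) \<le> T" if "norm w = r" for w
      unfolding T_def using sm that by (intro norm_suminf_le) (auto simp: norm_mult norm_power)
    \<comment> \<open>For a non-integrable function \<open>contour_integral\<close> is 0 by
      convention, so the bound holds in that case as well.\<close>
    have "norm (contour_integral (circlepath 0 r) ?g) \<le> T * B * (2 * pi * r)"
    proof (cases "?g contour_integrable_on circlepath 0 r")
      case True
      show ?thesis
      proof (rule has_contour_integral_bound_circlepath[OF has_contour_integral_integral[OF True]])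
        fix x :: complex assume x: "norm (x - 0) = r"
        have "norm (?g x) = norm (\<Sum>n. cf N r n * x ^ n) * norm (?h (z, x))"
          by (simp add: norm_mult norm_divide)
        also have "\<dots> \<le> T * B" by (intro mult_mono Tb B) (use x z T0 in auto)
        finally show "norm (?g x) \<le> T * B" .
      qed (use T0 B r in auto)
    qed (use T0 B r in \<open>auto simp: not_integrable_contour_integral\<close>)
    then have "norm (N z) \<le> 1 / (2 * pi) * (T * B * (2 * pi * r))"
      unfolding cf_summable(2)[OF N r(1) \<rho> zr] norm_mult by (intro mult_mono) (auto simp: norm_divide norm_mult)
    also have "\<dots> = B * r * T" by simp
    finally show "norm (N z) \<le> B * r * (\<Sum>n. norm (cf N r n) * r ^ n)" by (simp add: T_def)
  qed (use B r in auto)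
qed

text \<open>Since \<Psi> w / w tends to 1 / \<open>cap\<close>, the polynomial divided by w^n has
  this limit. The coefficient map on polynomials is thus triangular with nonzero diagonal, and
  coefficients above the degree vanish.\<close>

lemma cf_poly:
  assumes "1 < r" "degree p \<le> n"
  shows "cf (poly p) r n = coeff p n / of_real cap ^ n"
proof (rule circle_coeff_lim[of 1])
  show "(\<lambda>w. poly p (\<Psi> w)) holomorphic_on {w. 1 < norm w}"
    by (intro holomorphic_intros holomorphic_Psi)
  have inv: "((\<lambda>w. 1 / w) \<longlongrightarrow> 0) (at_infinity :: complex filter)"
    by (intro tendsto_divide_0[OF tendsto_const] filterlim_ident)
  have "((\<lambda>w. \<Sum>i\<le>n. coeff p i * ((\<Psi> w / w) ^ i * (1 / w) ^ (n - i))) \<longlongrightarrow>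
     (\<Sum>i\<le>n. coeff p i * ((1 / of_real cap) ^ i * 0 ^ (n - i)))) at_infinity"
    by (intro tendsto_intros Psi_at_infinity inv)
  also have "(\<Sum>i\<le>n. coeff p i * ((1 / of_real cap) ^ i * 0 ^ (n - i))) =
      (\<Sum>i\<le>n. if i = n then coeff p n / of_real cap ^ n else 0)"
    by (rule sum.cong) (auto simp: power_0_left power_divide)
  also have "\<dots> = coeff p n / of_real cap ^ n" by simp
  finally show "((\<lambda>w. poly p (\<Psi> w) / w ^ n) \<longlongrightarrow> coeff p n / of_real cap ^ n) at_infinity"
  proof (rule Lim_transform_eventually)
    show "\<forall>\<^sub>F w in at_infinity. (\<Sum>i\<le>n. coeff p i * ((\<Psi> w / w) ^ i * (1 / w) ^ (n - i))) = poly p (\<Psi> w) / w ^ n"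
    proof (rule eventually_at_infinityI[of 1])
      fix w :: complex assume w: "1 \<le> norm w"
      have "poly p (\<Psi> w) = (\<Sum>i\<le>n. coeff p i * \<Psi> w ^ i)"
        unfolding poly_altdef using assms(2)
        by (intro sum.mono_neutral_left) (auto simp: coeff_eq_0)
      moreover have "(\<Psi> w / w) ^ i * (1 / w) ^ (n - i) = \<Psi> w ^ i / w ^ n" if "i \<le> n" for i
        using that by (simp add: power_divide power_add[symmetric])
      ultimately show "(\<Sum>i\<le>n. coeff p i * ((\<Psi> w / w) ^ i * (1 / w) ^ (n - i))) = poly p (\<Psi> w) / w ^ n"
        by (auto simp: sum_divide_distrib intro!: sum.cong)
    qed
  qed
qed (use assms in auto)

lemma holomorphic_poly_D: "poly p holomorphic_on D \<rho>"
  using holomorphic_on_subset[OF _ subset_UNIV, of "poly p"] by (simp add: holomorphic_intros)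

lemma cf_add:
  assumes "N holomorphic_on D \<rho>" "M holomorphic_on D \<rho>" "1 < r" "r < \<rho>"
  shows "cf (\<lambda>z. N z + M z) r n = cf N r n + cf M r n"
  using assms by (intro circle_coeff_add continuous_comp_Psi) auto

lemma cf_diff:
  assumes "N holomorphic_on D \<rho>" "M holomorphic_on D \<rho>" "1 < r" "r < \<rho>"
  shows "cf (\<lambda>z. N z - M z) r n = cf N r n - cf M r n"
  using assms by (intro circle_coeff_diff continuous_comp_Psi) auto

lemma cf_cmult:
  assumes "N holomorphic_on D \<rho>" "1 < r" "r < \<rho>"
  shows "cf (\<lambda>z. c * N z) r n = c * cf N r n"
  using assms by (intro circle_coeff_cmult continuous_comp_Psi) auto

lemma cf_sum:
  assumes "\<And>i. i \<in> I \<Longrightarrow> N i holomorphic_on D \<rho>" "1 < r" "r < \<rho>"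
  shows "cf (\<lambda>z. \<Sum>i\<in>I. N i z) r n = (\<Sum>i\<in>I. cf (N i) r n)"
  using assms by (intro circle_coeff_sum continuous_comp_Psi) auto

text \<open>Triangular solution: a monomial of degree n produces the value prescribed at index n,
  and a polynomial of smaller degree corrects the lower indices without affecting it. The data b
  must vary in the induction because of that correction.\<close>

lemma Faber_section_exists:
  assumes r: "1 < r"
  shows "\<exists>p. (\<forall>j<n. cf (poly p) r j = b j) \<and> (\<forall>i\<ge>n. coeff p i = 0)"
proof (induction n arbitrary: b)
  case 0
  show ?case by (intro exI[of _ 0]) auto
next
  case (Suc n)
  define q where "q = monom (b n * of_real cap ^ n) n"
  obtain p where p: "\<forall>j<n. cf (poly p) r j = b j - cf (poly q) r j" "\<forall>i\<ge>n. coeff p i = 0"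
    using Suc.IH[of "\<lambda>j. b j - cf (poly q) r j"] by auto
  have deg: "degree p \<le> n" "degree q \<le> n" using p(2) by (auto intro: degree_le simp: q_def degree_monom_le)
  have "cf (poly (p + q)) r j = b j" if "j < Suc n" for j
  proof -
    have "cf (poly (p + q)) r j = cf (poly p) r j + cf (poly q) r j"
      using cf_add[OF holomorphic_poly_D holomorphic_poly_D, of r "r + 1" p q j] r by simp
    also have "\<dots> = b j"
    proof (cases "j = n")
      case True
      have "of_real cap ^ n \<noteq> (0::complex)" using cap_pos by simp
      then show ?thesis unfolding True cf_poly[OF r deg(1)] cf_poly[OF r deg(2)]
        using p(2) by (simp add: q_def)
    qed (use p that in auto)
    finally show ?thesis .
  qed
  moreover have "coeff (p + q) i = 0" if "i \<ge> Suc n" for i using that p by (auto simp: q_def)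
  ultimately show ?case by blast
qed

lemma cf_poly_eq_0:
  assumes "1 < r" "\<And>j. j \<le> degree p \<Longrightarrow> cf (poly p) r j = 0"
  shows "p = 0"
proof -
  have "coeff p (degree p) / of_real cap ^ degree p = 0"
    using cf_poly[OF assms(1) order_refl, of p] assms(2)[of "degree p"] by simp
  then show ?thesis using cap_pos by simp
qed

lemma cf_bound:
  assumes N: "N holomorphic_on D \<rho>" and r: "1 < r" "r < \<rho>"
  obtains C where "0 \<le> C" "\<And>n. norm (cf N r n) \<le> C / r ^ n"
proof -
  have "bounded ((\<lambda>w. N (\<Psi> w)) ` sphere 0 r)"
    by (intro compact_imp_bounded compact_continuous_image continuous_comp_Psi[OF N r]) auto
  then obtain B where "B > 0" "\<And>w. norm w = r \<Longrightarrow> norm (N (\<Psi> w)) \<le> B"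
    unfolding bounded_pos by auto
  then show thesis using circle_coeff_bound[OF _ continuous_comp_Psi[OF N r]] r
    by (intro that[of B]) auto
qed

text \<open>The converse of the Cauchy estimate. The power series now converges for |w| < R, the
  principal part is holomorphic beyond r1, and their sum composed with \<Phi> agrees with N where
  both are defined, so the two pieces glue to an extension.\<close>

lemma hext_of_coeff_bound:
  assumes N: "hext \<rho> f N" and r: "1 < r" "r < \<rho>" and R: "r < R" and C: "\<And>n. norm (cf N r n) \<le> C / R ^ n"
  obtains M where "hext R f M"
proof -
  define r1 r2 where "r1 = (1 + r) / 2" and "r2 = (r + \<rho>) / 2"
  have rr: "0 < r1" "1 < r1" "r1 < r" "r < r2" "r2 < \<rho>" using r by (auto simp: r1_def r2_def)
  have Nh: "N holomorphic_on D \<rho>" using N by (rule hext_holomorphic)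
  obtain v where v: "v holomorphic_on {w. r1 < norm w}" "(v \<longlongrightarrow> 0) at_infinity"
    "\<And>w. r1 < norm w \<Longrightarrow> norm w < r2 \<Longrightarrow> (\<lambda>n. cf N r n * w ^ n) sums (N (\<Psi> w) - v w)"
  proof -
    have "{w::complex. r1 \<le> norm w \<and> norm w \<le> r2} \<subseteq> {w. 1 < norm w \<and> norm w < \<rho>}" using rr by auto
    from Laurent_split_coeff[OF rr(1,3,4) open_annulus this holomorphic_comp_Psi[OF Nh]] that
    show thesis by blast
  qed
  define u where "u = (\<lambda>w. \<Sum>n. cf N r n * w ^ n)"
  have u: "u holomorphic_on ball 0 R"
  proof (rule power_series_holomorphic)
    fix w :: complex assume "w \<in> ball 0 R"
    then have w: "norm w < R" by auto
    have "summable (\<lambda>n. C * (norm w / R) ^ n)"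
      using w R r by (intro summable_mult summable_geometric) auto
    then have "summable (\<lambda>n. cf N r n * w ^ n)"
    proof (rule summable_comparison_test'[of _ 0])
      fix n
      have "norm (cf N r n * w ^ n) \<le> C / R ^ n * norm w ^ n"
        unfolding norm_mult norm_power by (intro mult_right_mono C) auto
      then show "norm (cf N r n * w ^ n) \<le> C * (norm w / R) ^ n" by (simp add: power_divide)
    qed
    then show "(\<lambda>n. cf N r n * (w - 0) ^ n) sums u w" by (simp add: u_def summable_sums)
  qed
  define M where "M = (\<lambda>z. if z \<in> D r2 then N z else u (\<Phi> z) + v (\<Phi> z))"
  define A where "A = {z. z \<notin> E \<and> r1 < norm (\<Phi> z) \<and> norm (\<Phi> z) < R}"
  have A: "open A"
  proof -
    have "A = (- E) \<inter> \<Phi> -` {w. r1 < norm w \<and> norm w < R}" by (auto simp: A_def)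
    then show ?thesis
      using continuous_open_preimage[OF holomorphic_on_imp_continuous_on[OF holomorphic_Phi] open_compl_E open_annulus]
      by simp
  qed
  have eq: "N z = u (\<Phi> z) + v (\<Phi> z)" if "z \<in> A" "z \<in> D r2" for z
    using v(3)[of "\<Phi> z"] that by (auto simp: A_def mem_D u_def sums_iff Psi_Phi)
  have "M holomorphic_on D r2"
  proof (rule holomorphic_transform)
    show "N holomorphic_on D r2" by (rule holomorphic_on_subset[OF Nh D_mono]) (use rr in auto)
  qed (auto simp: M_def)
  moreover have "M holomorphic_on A"
  proof (rule holomorphic_transform)
    have "\<Phi> holomorphic_on A" by (rule holomorphic_on_subset[OF holomorphic_Phi]) (auto simp: A_def)
    then show "(\<lambda>z. u (\<Phi> z) + v (\<Phi> z)) holomorphic_on A"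
      by (intro holomorphic_intros holomorphic_on_compose_gen[OF _ u, unfolded o_def]
         holomorphic_on_compose_gen[OF _ v(1), unfolded o_def]) (auto simp: A_def)
  qed (use eq in \<open>auto simp: M_def\<close>)
  ultimately have "M holomorphic_on D r2 \<union> A"
    using A open_D rr by (intro holomorphic_on_Un) auto
  then have "M holomorphic_on D R"
    by (rule holomorphic_on_subset) (use rr in \<open>auto simp: mem_D A_def\<close>)
  moreover obtain U where "open U" "E \<subseteq> U" "\<forall>z\<in>U. N z = f z" using N by (auto simp: hext_def)
  ultimately have "hext R f M" unfolding hext_def using open_D[of r2] rr
    by (intro conjI exI[of _ "U \<inter> D r2"]) (auto simp: M_def mem_D)
  then show thesis by (rule that)
qed

text \<open>Write \<Psi> w - \<xi> = (w - a) k w with a = \<Phi> \<xi>. Injectivity of \<Psi> and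
  \<Psi>' a \<noteq> 0 make k zero-free, so a simple pole in z becomes a simple pole in w with
  nonzero residue.\<close>

lemma cf_simple_pole:
  assumes N: "N holomorphic_on D \<rho>" and \<xi>: "\<xi> \<notin> E" "N \<xi> \<noteq> 0" and r: "1 < r" "r < norm (\<Phi> \<xi>)" and s: "norm (\<Phi> \<xi>) < s" "s < \<rho>"
  obtains \<kappa> where "\<kappa> \<noteq> 0"
    "\<And>n. cf (\<lambda>z. N z / (z - \<xi>)) s n - cf (\<lambda>z. N z / (z - \<xi>)) r n = \<kappa> / \<Phi> \<xi> ^ n"
proof -
  define a where "a = \<Phi> \<xi>"
  have a: "1 < norm a" "\<Psi> a = \<xi>" "norm a < \<rho>" using \<xi> norm_Phi Psi_Phi s by (auto simp: a_def)
  define k where "k = (\<lambda>w. if w = a then deriv \<Psi> a else (\<Psi> w - \<Psi> a) / (w - a))"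
  have k: "k holomorphic_on {w. 1 < norm w}"
    unfolding k_def by (rule pole_lemma_open[OF holomorphic_Psi open_exterior_disc])
  have k0: "k w \<noteq> 0" if "1 < norm w" for w
  proof (cases "w = a")
    case True
    then show ?thesis using deriv_Phi_Psi[OF a(1)] by (auto simp: k_def)
  next
    case False
    then have "\<Psi> w \<noteq> \<Psi> a" using that a Phi_Psi by metis
    then show ?thesis using False by (simp add: k_def)
  qed
  define S where "S = {w::complex. 1 < norm w \<and> norm w < \<rho>}"
  define p where "p = (\<lambda>w. N (\<Psi> w) / k w)"
  have p: "p holomorphic_on S" unfolding p_def S_def
    by (intro holomorphic_intros holomorphic_comp_Psi[OF N] holomorphic_on_subset[OF k]) (use k0 in auto)
  have cc: "circle_coeff (\<lambda>w. N (\<Psi> w) / (\<Psi> w - \<xi>)) t n = circle_coeff (\<lambda>w. p w / (w - a)) t n"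
    if "1 < t" "t \<noteq> norm a" for t n
  proof (rule circle_coeff_cong)
    fix w :: complex assume w: "norm w = t"
    then have "w \<noteq> a" using that by auto
    then show "N (\<Psi> w) / (\<Psi> w - \<xi>) = p w / (w - a)" using a by (simp add: p_def k_def)
  qed (use that in auto)
  have "circle_coeff (\<lambda>w. p w / (w - a)) s n - circle_coeff (\<lambda>w. p w / (w - a)) r n = p a / a ^ (n + 1)" for n
    by (rule circle_coeff_pole[OF _ _ _ _ _ p]) (use r s a in \<open>auto simp: S_def a_def open_annulus\<close>)
  then have "cf (\<lambda>z. N z / (z - \<xi>)) s n - cf (\<lambda>z. N z / (z - \<xi>)) r n = (p a / a) / \<Phi> \<xi> ^ n" for n
    using cc[of s n] cc[of r n] r s by (simp add: a_def)
  moreover have "p a / a \<noteq> 0" using a \<xi> k0[of a] by (auto simp: p_def)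
  ultimately show thesis using that by blast
qed

end

section \<open>Taylor coefficients and partial fractions of polynomials\<close>

definition taylor_coeff :: "complex poly \<Rightarrow> complex \<Rightarrow> nat \<Rightarrow> complex" where
  "taylor_coeff q \<xi> i = coeff (pcompose q [:\<xi>, 1:]) i"

lemma poly_taylor:
  assumes "degree q \<le> n"
  shows "poly q z = (\<Sum>i\<le>n. taylor_coeff q \<xi> i * (z - \<xi>) ^ i)"
proof -
  have "degree (pcompose q [:\<xi>, 1:]) \<le> n" using assms by (simp add: degree_pcompose)
  then have "poly (pcompose q [:\<xi>, 1:]) (z - \<xi>) = (\<Sum>i\<le>n. coeff (pcompose q [:\<xi>, 1:]) i * (z - \<xi>) ^ i)"
    unfolding poly_altdef by (intro sum.mono_neutral_left) (auto simp: coeff_eq_0)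
  then show ?thesis by (simp add: poly_pcompose taylor_coeff_def)
qed

lemma taylor_expansion:
  assumes "degree q \<le> n"
  shows "q = (\<Sum>i\<le>n. smult (taylor_coeff q \<xi> i) ([:- \<xi>, 1:] ^ i))"
proof -
  have "poly q z = poly (\<Sum>i\<le>n. smult (taylor_coeff q \<xi> i) ([:- \<xi>, 1:] ^ i)) z" for z
    by (simp add: poly_taylor[OF assms, of z \<xi>] poly_sum)
  then show ?thesis by (intro poly_eqI_degree_lead_coeff poly_eq_poly_eq_iff[THEN iffD1] ext)
qed

definition l1_norm :: "nat \<Rightarrow> complex poly \<Rightarrow> real" where
  "l1_norm n q = (\<Sum>i\<le>n. norm (coeff q i))"

lemma l1_norm_nonneg: "0 \<le> l1_norm n q" by (simp add: l1_norm_def sum_nonneg)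

text \<open>A Taylor coefficient is a linear functional on the polynomials of degree at most n,
  hence bounded by its values on the monomials.\<close>

lemma taylor_coeff_bound:
  obtains K where "0 \<le> K" "\<And>q. degree q \<le> n \<Longrightarrow> norm (taylor_coeff q \<xi> i) \<le> K * l1_norm n q"
proof (rule that[of "\<Sum>j\<le>n. norm (taylor_coeff (monom 1 j) \<xi> i)"])
  fix q :: "complex poly" assume "degree q \<le> n"
  have "q = (\<Sum>j\<le>n. smult (coeff q j) (monom 1 j))"
    using poly_as_sum_of_monoms'[OF \<open>degree q \<le> n\<close>] by (simp add: smult_monom)
  then have "pcompose q [:\<xi>, 1:] = pcompose (\<Sum>j\<le>n. smult (coeff q j) (monom 1 j)) [:\<xi>, 1:]" by simp
  also have "\<dots> = (\<Sum>j\<le>n. smult (coeff q j) (pcompose (monom 1 j) [:\<xi>, 1:]))"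
    by (simp only: pcompose_sum pcompose_smult)
  finally have "taylor_coeff q \<xi> i = (\<Sum>j\<le>n. coeff q j * taylor_coeff (monom 1 j) \<xi> i)"
    by (simp add: taylor_coeff_def coeff_sum)
  also have "norm \<dots> \<le> (\<Sum>j\<le>n. norm (coeff q j) * norm (taylor_coeff (monom 1 j) \<xi> i))"
    by (rule order_trans[OF norm_sum]) (simp add: norm_mult)
  also have "\<dots> \<le> (\<Sum>j\<le>n. l1_norm n q * norm (taylor_coeff (monom 1 j) \<xi> i))"
    by (intro sum_mono mult_right_mono) (auto simp: l1_norm_def intro!: member_le_sum)
  finally show "norm (taylor_coeff q \<xi> i) \<le> (\<Sum>j\<le>n. norm (taylor_coeff (monom 1 j) \<xi> i)) * l1_norm n q"
    by (simp add: sum_distrib_left[symmetric] mult.commute)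
qed (simp add: sum_nonneg)

lemma bezout_mult:
  fixes p q r :: "'a::comm_ring_1"
  assumes "\<exists>a b. a * p + b * q = 1" "\<exists>a b. a * p + b * r = 1"
  shows "\<exists>a b. a * p + b * (q * r) = 1"
proof -
  obtain a b c d where ab: "a * p + b * q = 1" and cd: "c * p + d * r = 1" using assms by blast
  have "(a * c * p + a * d * r + b * q * c) * p + (b * d) * (q * r) = (a * p + b * q) * (c * p + d * r)"
    by (simp add: algebra_simps)
  then show ?thesis unfolding ab cd by auto
qed

lemma bezout_power:
  fixes p q :: "'a::comm_ring_1"
  assumes "\<exists>a b. a * p + b * q = 1" shows "\<exists>a b. a * p + b * q ^ n = 1"
proof (induction n)
  case 0
  show ?case by (intro exI[of _ 0] exI[of _ 1]) simp
next
  case (Suc n)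
  then show ?case using bezout_mult[OF assms Suc] by simp
qed

lemma bezout_linear_powers:
  assumes "finite X" "\<xi> \<notin> X"
  shows "\<exists>a b. a * [:- \<xi>, 1:] ^ k + b * (\<Prod>\<eta>\<in>X. [:- \<eta>, 1::complex:] ^ \<tau> \<eta>) = 1"
  using assms
proof (induction X rule: finite_induct)
  case empty
  show ?case by (intro exI[of _ 0] exI[of _ 1]) simp
next
  case (insert \<eta> X)
  have "\<exists>a b. a * [:- \<xi>, 1:] + b * [:- \<eta>, 1:] = 1"
    by (intro exI[of _ "[:1 / (\<eta> - \<xi>):]"] exI[of _ "[:- 1 / (\<eta> - \<xi>):]"])
      (use insert in \<open>auto simp: one_pCons diff_divide_distrib[symmetric] add_divide_distrib[symmetric]\<close>)
  from bezout_power[OF this] have "\<exists>a b. a * [:- \<eta>, 1:] ^ \<tau> \<eta> + b * [:- \<xi>, 1:] = 1"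
    by (metis add.commute)
  from bezout_power[OF this] have "\<exists>a b. a * [:- \<xi>, 1:] ^ k + b * [:- \<eta>, 1:] ^ \<tau> \<eta> = 1"
    by (metis add.commute)
  from bezout_mult[OF this] insert show ?case by simp
qed

text \<open>Dividing by the full product turns this into the partial fraction decomposition of its
  reciprocal. It is used with the orders of the system poles for Hermite interpolation, and with the
  pole orders of F_\<alpha> for the approximants. Induction by Bezout's identity for coprime
  powers.\<close>

lemma partial_fraction_unity:
  assumes "finite X" "X \<noteq> {}"
  shows "\<exists>p. (\<Sum>\<xi>\<in>X. p \<xi> * (\<Prod>\<eta>\<in>X - {\<xi>}. [:- \<eta>, 1::complex:] ^ \<tau> \<eta>)) = 1"
  using assms
proof (induction X rule: finite_ne_induct)
  case (singleton \<xi>)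
  show ?case by (intro exI[of _ "\<lambda>_. 1"]) simp
next
  case (insert \<xi> X)
  let ?L = "[:- \<xi>, 1:] ^ \<tau> \<xi>" and ?Q = "\<Prod>\<eta>\<in>X. [:- \<eta>, 1:] ^ \<tau> \<eta>"
  obtain p where p: "(\<Sum>\<zeta>\<in>X. p \<zeta> * (\<Prod>\<eta>\<in>X - {\<zeta>}. [:- \<eta>, 1:] ^ \<tau> \<eta>)) = 1" using insert by auto
  obtain a b where ab: "a * ?L + b * ?Q = 1"
    using bezout_linear_powers[of X \<xi> "\<tau> \<xi>" \<tau>] insert by blast
  define p' where "p' = (\<lambda>\<zeta>. if \<zeta> = \<xi> then b else a * p \<zeta>)"
  have "(\<Sum>\<zeta>\<in>X. p' \<zeta> * (\<Prod>\<eta>\<in>insert \<xi> X - {\<zeta>}. [:- \<eta>, 1:] ^ \<tau> \<eta>)) =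
     (\<Sum>\<zeta>\<in>X. a * ?L * (p \<zeta> * (\<Prod>\<eta>\<in>X - {\<zeta>}. [:- \<eta>, 1:] ^ \<tau> \<eta>)))"
  proof (rule sum.cong[OF refl])
    fix \<zeta> assume "\<zeta> \<in> X"
    then have "insert \<xi> X - {\<zeta>} = insert \<xi> (X - {\<zeta>})" "\<xi> \<notin> X - {\<zeta>}" "\<zeta> \<noteq> \<xi>" using insert by auto
    then show "p' \<zeta> * (\<Prod>\<eta>\<in>insert \<xi> X - {\<zeta>}. [:- \<eta>, 1:] ^ \<tau> \<eta>) =
       a * ?L * (p \<zeta> * (\<Prod>\<eta>\<in>X - {\<zeta>}. [:- \<eta>, 1:] ^ \<tau> \<eta>))"
      using insert(1) by (simp add: p'_def prod.insert mult_ac)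
  qed
  also have "\<dots> = a * ?L" by (simp only: sum_distrib_left[symmetric] p mult_1_right)
  finally have "(\<Sum>\<zeta>\<in>insert \<xi> X. p' \<zeta> * (\<Prod>\<eta>\<in>insert \<xi> X - {\<zeta>}. [:- \<eta>, 1:] ^ \<tau> \<eta>)) = b * ?Q + a * ?L"
    using insert by (simp add: p'_def)
  then show ?case using ab by (intro exI[of _ p']) (simp add: add.commute)
qed

lemma poly_mod_sum: "(\<Sum>i\<in>I. f i) mod (q :: complex poly) = (\<Sum>i\<in>I. f i mod q)"
  by (induction I rule: infinite_finite_induct) (auto simp: poly_mod_add_left)

text \<open>Hermite interpolation with fixed basis polynomials h. Multiply q by the decomposition of
  unity and expand q at \<xi> in the summand of \<xi>; the terms of index \<tau> \<xi> and higher
  are multiples of Q.\<close>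

lemma jet_interpolation:
  fixes \<tau> :: "complex \<Rightarrow> nat"
  assumes "finite X" "X \<noteq> {}"
  defines "Q \<equiv> \<Prod>\<xi>\<in>X. [:- \<xi>, 1::complex:] ^ \<tau> \<xi>"
  obtains h where "\<And>q. q mod Q = (\<Sum>\<xi>\<in>X. \<Sum>i<\<tau> \<xi>. smult (taylor_coeff q \<xi> i) (h \<xi> i))"
proof -
  define \<pi> where "\<pi> = (\<lambda>\<xi>. \<Prod>\<eta>\<in>X - {\<xi>}. [:- \<eta>, 1::complex:] ^ \<tau> \<eta>)"
  obtain p where p: "(\<Sum>\<xi>\<in>X. p \<xi> * \<pi> \<xi>) = 1"
    using partial_fraction_unity[OF assms(1,2), of \<tau>] by (auto simp: \<pi>_def)
  have Q: "Q = [:- \<xi>, 1:] ^ \<tau> \<xi> * \<pi> \<xi>" if "\<xi> \<in> X" for \<xi>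
    unfolding Q_def \<pi>_def by (rule prod.remove[OF assms(1) that])
  define h where "h = (\<lambda>\<xi> i. (p \<xi> * \<pi> \<xi> * [:- \<xi>, 1:] ^ i) mod Q)"
  show thesis
  proof (rule that[of h])
    fix q :: "complex poly"
    have one: "(p \<xi> * \<pi> \<xi> * q) mod Q = (\<Sum>i<\<tau> \<xi>. smult (taylor_coeff q \<xi> i) (h \<xi> i))" if "\<xi> \<in> X" for \<xi>
    proof -
      define n where "n = max (degree q) (\<tau> \<xi>)"
      have "p \<xi> * \<pi> \<xi> * q = p \<xi> * \<pi> \<xi> * (\<Sum>i\<le>n. smult (taylor_coeff q \<xi> i) ([:- \<xi>, 1:] ^ i))"
        using taylor_expansion[of q n \<xi>] by (simp add: n_def)
      also have "\<dots> = (\<Sum>i\<le>n. smult (taylor_coeff q \<xi> i) (p \<xi> * \<pi> \<xi> * [:- \<xi>, 1:] ^ i))"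
        by (simp add: sum_distrib_left)
      finally have "(p \<xi> * \<pi> \<xi> * q) mod Q = (\<Sum>i\<le>n. smult (taylor_coeff q \<xi> i) (h \<xi> i))"
        by (simp add: poly_mod_sum h_def mod_smult_left)
      also have "\<dots> = (\<Sum>i<\<tau> \<xi>. smult (taylor_coeff q \<xi> i) (h \<xi> i))"
      proof (rule sum.mono_neutral_right)
        show "\<forall>i\<in>{..n} - {..<\<tau> \<xi>}. smult (taylor_coeff q \<xi> i) (h \<xi> i) = 0"
        proof
          fix i assume "i \<in> {..n} - {..<\<tau> \<xi>}"
          then have "[:- \<xi>, 1:] ^ \<tau> \<xi> dvd [:- \<xi>, 1:] ^ i" by (intro le_imp_power_dvd) auto
          then have "Q dvd p \<xi> * \<pi> \<xi> * [:- \<xi>, 1:] ^ i"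
            unfolding Q[OF that] by (metis dvd_mult mult.assoc mult.commute mult_dvd_mono dvd_refl)
          then show "smult (taylor_coeff q \<xi> i) (h \<xi> i) = 0" by (simp add: h_def)
        qed
      qed (auto simp: n_def)
      finally show ?thesis .
    qed
    have "q mod Q = (\<Sum>\<xi>\<in>X. p \<xi> * \<pi> \<xi> * q) mod Q"
      using p by (simp add: sum_distrib_right[symmetric])
    also have "\<dots> = (\<Sum>\<xi>\<in>X. (p \<xi> * \<pi> \<xi> * q) mod Q)" by (rule poly_mod_sum)
    also have "\<dots> = (\<Sum>\<xi>\<in>X. \<Sum>i<\<tau> \<xi>. smult (taylor_coeff q \<xi> i) (h \<xi> i))"
      by (intro sum.cong one) auto
    finally show "q mod Q = (\<Sum>\<xi>\<in>X. \<Sum>i<\<tau> \<xi>. smult (taylor_coeff q \<xi> i) (h \<xi> i))" .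
  qed
qed

lemma prod_linear_powers:
  fixes \<tau> :: "complex \<Rightarrow> nat"
  defines "Q \<equiv> \<lambda>X. \<Prod>\<xi>\<in>X. [:- \<xi>, 1:] ^ \<tau> \<xi>"
  shows "finite X \<Longrightarrow> degree (Q X) = (\<Sum>\<xi>\<in>X. \<tau> \<xi>)" "lead_coeff (Q X) = 1" "Q X \<noteq> 0"
    "poly (Q X) z = (\<Prod>\<xi>\<in>X. (z - \<xi>) ^ \<tau> \<xi>)"
    "finite X \<Longrightarrow> poly (Q X) z = 0 \<longleftrightarrow> (\<exists>\<xi>\<in>X. z = \<xi> \<and> 0 < \<tau> \<xi>)"
proof -
  show "lead_coeff (Q X) = 1" by (simp add: Q_def lead_coeff_prod lead_coeff_power)
  then show "Q X \<noteq> 0" by auto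
  show "finite X \<Longrightarrow> degree (Q X) = (\<Sum>\<xi>\<in>X. \<tau> \<xi>)"
    unfolding Q_def by (subst degree_prod_sum_eq) (auto simp: degree_linear_power)
  show "poly (Q X) z = (\<Prod>\<xi>\<in>X. (z - \<xi>) ^ \<tau> \<xi>)" by (simp add: Q_def poly_prod)
  then show "finite X \<Longrightarrow> poly (Q X) z = 0 \<longleftrightarrow> (\<exists>\<xi>\<in>X. z = \<xi> \<and> 0 < \<tau> \<xi>)" by auto
qed

lemma mod_monic:
  assumes "lead_coeff Q = 1" "0 < degree (Q :: complex poly)" "degree q \<le> degree Q"
  shows "q mod Q = q - smult (coeff q (degree Q)) Q"
proof -
  define r where "r = q - smult (coeff q (degree Q)) Q"
  have "degree r < degree Q"
  proof (rule degree_lessI)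
    show "\<forall>k\<ge>degree Q. coeff r k = 0"
      using assms by (auto simp: r_def coeff_eq_0 le_less)
  qed (use assms in auto)
  then have "r mod Q = r" by (rule mod_poly_less)
  moreover have "q = r + smult (coeff q (degree Q)) Q" by (simp add: r_def)
  then have "q mod Q = r mod Q" by (metis mod_smult_left mod_self poly_mod_add_left smult_0_right add.right_neutral)
  ultimately show ?thesis by (simp add: r_def)
qed

section \<open>Norms of coefficient vectors\<close>

lemma l1_norm_sum_le: "l1_norm n (\<Sum>i\<in>I. f i) \<le> (\<Sum>i\<in>I. l1_norm n (f i))"
proof -
  have "l1_norm n (\<Sum>i\<in>I. f i) \<le> (\<Sum>j\<le>n. \<Sum>i\<in>I. norm (coeff (f i) j))"
    unfolding l1_norm_def coeff_sum by (intro sum_mono norm_sum)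
  also have "\<dots> = (\<Sum>i\<in>I. l1_norm n (f i))" unfolding l1_norm_def by (rule sum.swap)
  finally show ?thesis .
qed

lemma l1_norm_add_le: "l1_norm n (p + q) \<le> l1_norm n p + l1_norm n q"
  unfolding l1_norm_def by (simp add: sum.distrib[symmetric] sum_mono norm_triangle_ineq)

lemma l1_norm_smult: "l1_norm n (smult c q) = norm c * l1_norm n q"
  by (simp add: l1_norm_def norm_mult sum_distrib_left)

lemma l1_norm_eq_0: "degree q \<le> n \<Longrightarrow> l1_norm n q = 0 \<longleftrightarrow> q = 0"
  unfolding l1_norm_def
  by (subst sum_nonneg_eq_0_iff) (auto simp: poly_eq_iff, metis atMost_iff coeff_eq_0 le_less_trans not_le)

lemma coeff_norm_le_l1: "degree q \<le> n \<Longrightarrow> coeff_norm q \<le> l1_norm n q"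
  unfolding coeff_norm_def l1_norm_def
  by (subst Max_le_iff) (auto intro!: member_le_sum)

lemma norm_coeff_le_coeff_norm: "norm (coeff q i) \<le> coeff_norm q"
proof (cases "i \<le> degree q")
  case True
  then show ?thesis unfolding coeff_norm_def by (intro Max_ge) auto
next
  case False
  have "0 \<le> norm (coeff q 0)" by simp
  also have "\<dots> \<le> coeff_norm q" unfolding coeff_norm_def by (intro Max_ge) auto
  finally show ?thesis using False by (simp add: coeff_eq_0)
qed

section \<open>Systems of functions and their system poles\<close>

locale faber_system = exterior_domain +
  fixes d :: nat and m :: "nat \<Rightarrow> nat" and F :: "nat \<Rightarrow> complex \<Rightarrow> complex"
  assumes d_pos: "1 \<le> d" and F_analytic: "\<And>\<alpha>. \<alpha> \<in> {1..d} \<Longrightarrow> F \<alpha> analytic_on E"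
    and m_pos: "\<And>\<alpha>. \<alpha> \<in> {1..d} \<Longrightarrow> 1 \<le> m \<alpha>"
    and finite_poles: "finite (system_poles E \<Phi> d m F)"
    and count_poles: "(\<Sum>\<xi>\<in>system_poles E \<Phi> d m F. system_order E \<Phi> d m F \<xi>) = msize d m"
begin

abbreviation X :: "complex set" where "X \<equiv> system_poles E \<Phi> d m F"
abbreviation \<tau> :: "complex \<Rightarrow> nat" where "\<tau> \<equiv> system_order E \<Phi> d m F"
abbreviation M :: nat where "M \<equiv> msize d m"
abbreviation QF :: "complex poly" where "QF \<equiv> system_pole_poly E \<Phi> d m F"
abbreviation \<rho>p :: "complex \<Rightarrow> nat \<Rightarrow> ereal" where "\<rho>p \<equiv> rho_pole E \<Phi> d m F"
abbreviation \<rho>b :: "complex \<Rightarrow> nat \<Rightarrow> ereal" where "\<rho>b \<equiv> bold_rho_pole E \<Phi> d m F"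

definition comb :: "(complex \<Rightarrow> complex) \<Rightarrow> bool" where
  "comb G \<longleftrightarrow> (\<exists>v. (\<forall>\<alpha>\<in>{1..d}. degree (v \<alpha>) < m \<alpha>) \<and> G = poly_comb d F v)"

text \<open>The numerator of a function whose only pole in \<open>D R\<close> is \<xi>. Nonvanishing
  at \<xi> makes the order exactly t.\<close>

definition pole_form :: "real \<Rightarrow> complex \<Rightarrow> nat \<Rightarrow> (complex \<Rightarrow> complex) \<Rightarrow> (complex \<Rightarrow> complex) \<Rightarrow> bool" where
  "pole_form R \<xi> t G N \<longleftrightarrow> hext R (\<lambda>z. (z - \<xi>) ^ t * G z) N \<and> N \<xi> \<noteq> 0"

lemma mem_D_pole: "norm (\<Phi> \<xi>) < R \<Longrightarrow> \<xi> \<in> D R" by (simp add: mem_D)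

lemma pole_form_of_mero:
  assumes ext: "is_mero_ext E A G g" and A: "D R \<subseteq> A" "1 < R" and \<xi>: "\<xi> \<notin> E"
    and p: "poles_in g (D R) = {\<xi>}" "pole_order g \<xi> = t"
  obtains N where "pole_form R \<xi> t G N"
proof -
  have nm: "g nicely_meromorphic_on D R"
    using ext A nicely_meromorphic_on_subset by (auto simp: is_mero_ext_def)
  obtain N where N: "N holomorphic_on D R" "\<And>z. z \<in> D R - {\<xi>} \<Longrightarrow> N z = (z - \<xi>) ^ t * g z" "N \<xi> \<noteq> 0"
    using nicely_meromorphic_numerator[OF nm open_D[OF A(2)]] p by auto
  obtain U where U: "open U" "E \<subseteq> U" "\<forall>z\<in>U. g z = G z" using ext by (auto simp: is_mero_ext_def)
  have "hext R (\<lambda>z. (z - \<xi>) ^ t * G z) N" unfolding hext_def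
  proof (intro conjI N(1) exI[of _ "U \<inter> D R - {\<xi>}"])
    show "open (U \<inter> D R - {\<xi>})" using U open_D[OF A(2)] by auto
    show "E \<subseteq> U \<inter> D R - {\<xi>}" using U \<xi> by (auto simp: mem_D)
    show "\<forall>z\<in>U \<inter> D R - {\<xi>}. N z = (z - \<xi>) ^ t * G z" using N(2) U(3) by auto
  qed
  then show thesis using N(3) that by (auto simp: pole_form_def)
qed

lemma pole_combsD:
  assumes G: "G \<in> pole_combs E \<Phi> d m F \<xi> t" and \<xi>: "\<xi> \<notin> E"
  shows "comb G"
    and "\<exists>R N. norm (\<Phi> \<xi>) < R \<and> pole_form R \<xi> t G N"
    and "norm (\<Phi> \<xi>) < R \<Longrightarrow> ereal R < rho_mero E \<Phi> t G \<Longrightarrow> \<exists>N. pole_form R \<xi> t G N"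
proof -
  show "comb G" using G by (auto simp: pole_combs_def comb_def)
  have n1: "1 < norm (\<Phi> \<xi>)" by (rule norm_Phi[OF \<xi>])
  obtain V g where V: "open V" "closure (D (norm (\<Phi> \<xi>))) \<subseteq> V" "is_mero_ext E V G g"
    "poles_in g V = {\<xi>}" "pole_order g \<xi> = t"
    using G by (auto simp: pole_combs_def)
  have "Dc (norm (\<Phi> \<xi>)) \<subseteq> V" using Dc_subset_closure[OF n1] V(2) by blast
  then obtain s where s: "norm (\<Phi> \<xi>) < s" "D s \<subseteq> V" using D_shrinks[OF V(1)] n1 by (metis less_imp_le)
  have ps: "poles_in g (D s) = {\<xi>}" using V(4) s mem_D_pole[OF s(1)] by (auto simp: poles_in_def)
  show "\<exists>R N. norm (\<Phi> \<xi>) < R \<and> pole_form R \<xi> t G N"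
    using pole_form_of_mero[OF V(3) s(2) less_trans[OF n1 s(1)] \<xi> ps V(5)] s(1) by blast
  assume R: "norm (\<Phi> \<xi>) < R" "ereal R < rho_mero E \<Phi> t G"
  obtain \<rho> h where \<rho>: "ereal R < \<rho>" "1 < \<rho>" and h: "is_mero_ext E (canonical_domain E \<Phi> \<rho>) G h"
     "finite (poles_in h (canonical_domain E \<Phi> \<rho>))"
     "(\<Sum>z\<in>poles_in h (canonical_domain E \<Phi> \<rho>). pole_order h z) \<le> t"
    using R(2) unfolding rho_mero_def less_Sup_iff by auto
  have DR: "D R \<subseteq> canonical_domain E \<Phi> \<rho>" using \<rho> by (intro canonical_domain_mono) simp
  \<comment> \<open>The function g is known to have the single pole \<xi> on \<open>D s\<close>,
    while h is defined on \<open>D R\<close>; they are compared on the smaller of the two domains,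
    which still contains \<xi>.\<close>
  define u where "u = min s R"
  have u: "norm (\<Phi> \<xi>) < u" "u \<le> s" "u \<le> R" "1 < u" using s R n1 by (auto simp: u_def)
  have eq: "g z = h z" if "z \<in> D u" for z
  proof (rule is_mero_ext_unique[OF V(3) h(1), of "ereal u"])
    show "canonical_domain E \<Phi> (ereal u) \<subseteq> V \<inter> canonical_domain E \<Phi> \<rho>"
      using D_mono[OF u(2)] D_mono[OF u(3)] s DR by blast
  qed (use u that in auto)
  have "\<forall>\<^sub>F z in at \<xi>. g z = h z"
    using eventually_at_in_open'[OF open_D[OF u(4)] mem_D_pole[OF u(1)]] by eventually_elim (rule eq)
  then have "is_pole h \<xi>" "pole_order h \<xi> = t"
    using is_pole_cong[of g h \<xi> \<xi>] zorder_cong[of g h \<xi> \<xi>] V(4,5) by (auto simp: poles_in_def pole_order_def)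
  moreover have "\<xi> \<in> D R" by (rule mem_D_pole[OF R(1)])
  ultimately have \<xi>h: "\<xi> \<in> poles_in h (canonical_domain E \<Phi> \<rho>)" using DR by (auto simp: poles_in_def)
  have only: "z = \<xi>" if "z \<in> poles_in h (canonical_domain E \<Phi> \<rho>)" for z
  proof (rule ccontr)
    assume "z \<noteq> \<xi>"
    then have "(\<Sum>z\<in>{\<xi>, z}. pole_order h z) \<le> t"
      using order_trans[OF sum_mono2[OF h(2), of "{\<xi>, z}"] h(3)] \<xi>h that by auto
    moreover have "0 < pole_order h z"
      using pole_order_pos[of h "canonical_domain E \<Phi> \<rho>" z] h(1) that by (auto simp: is_mero_ext_def poles_in_def)
    ultimately show False using \<open>z \<noteq> \<xi>\<close> \<open>pole_order h \<xi> = t\<close> by simp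
  qed
  have "poles_in h (D R) \<subseteq> poles_in h (canonical_domain E \<Phi> \<rho>)" using DR unfolding poles_in_def by blast
  then have "poles_in h (D R) \<subseteq> {\<xi>}" using only by blast
  moreover have "\<xi> \<in> poles_in h (D R)" using \<xi>h \<open>\<xi> \<in> D R\<close> by (simp add: poles_in_def)
  ultimately have "poles_in h (D R) = {\<xi>}" by blast
  from pole_form_of_mero[OF h(1) DR less_trans[OF n1 R(1)] \<xi> this \<open>pole_order h \<xi> = t\<close>]
  show "\<exists>N. pole_form R \<xi> t G N" by blast
qed

lemma pole_combsI:
  assumes G: "comb G" and N: "pole_form R \<xi> t G N" and R: "norm (\<Phi> \<xi>) < R" and \<xi>: "\<xi> \<notin> E" and t: "1 \<le> t"
  shows "G \<in> pole_combs E \<Phi> d m F \<xi> t" "ereal R \<le> rho_mero E \<Phi> t G"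
proof -
  define g where "g = (\<lambda>z. if z = \<xi> then 0 else N z / (z - \<xi>) ^ t)"
  have R1: "1 < R" using norm_Phi[OF \<xi>] R by simp
  have NR: "N holomorphic_on D R" "N \<xi> \<noteq> 0" using N by (auto simp: pole_form_def hext_def)
  note g = nicely_meromorphic_single_pole[OF NR(1) open_D[OF R1] mem_D_pole[OF R] NR(2) t, folded g_def]
  obtain U where U: "open U" "E \<subseteq> U" "\<forall>z\<in>U. N z = (z - \<xi>) ^ t * G z"
    using N by (auto simp: pole_form_def hext_def)
  have ext: "is_mero_ext E (D R) G g" unfolding is_mero_ext_def
    by (intro conjI g(1) exI[of _ "U - {\<xi>}"]) (use U \<xi> in \<open>auto simp: g_def\<close>)
  have "closure (D (norm (\<Phi> \<xi>))) \<subseteq> D R" using closure_D_subset Dc_subset_D[OF R] by blast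
  then show "G \<in> pole_combs E \<Phi> d m F \<xi> t"
    using G ext g open_D[OF R1] by (auto simp: pole_combs_def comb_def intro!: exI[of _ "D R"] exI[of _ g])
  show "ereal R \<le> rho_mero E \<Phi> t G" unfolding rho_mero_def
    by (rule Sup_upper) (use ext g R1 in \<open>auto intro!: exI[of _ g]\<close>)
qed

lemma rho_pole_obtain:
  assumes "\<xi> \<notin> E" "norm (\<Phi> \<xi>) < R" "ereal R < \<rho>p \<xi> t"
  obtains G N where "comb G" "pole_form R \<xi> t G N"
proof -
  obtain G where "G \<in> pole_combs E \<Phi> d m F \<xi> t" "ereal R < rho_mero E \<Phi> t G"
    using assms(3) unfolding rho_pole_def less_SUP_iff by auto
  then show thesis using pole_combsD(1,3)[OF _ assms(1)] assms(2) that by metis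
qed

lemma rho_pole_ge:
  assumes "comb G" "pole_form R \<xi> t G N" "norm (\<Phi> \<xi>) < R" "\<xi> \<notin> E" "1 \<le> t"
  shows "ereal R \<le> \<rho>p \<xi> t"
  unfolding rho_pole_def using pole_combsI[OF assms] by (intro SUP_upper2) auto

lemma system_pole:
  assumes "\<xi> \<in> X"
  shows "\<xi> \<notin> E" "1 \<le> \<tau> \<xi>" "\<And>t. 1 \<le> t \<Longrightarrow> t \<le> \<tau> \<xi> \<Longrightarrow> pole_combs E \<Phi> d m F \<xi> t \<noteq> {}"
proof -
  obtain n where n: "system_pole_of_order E \<Phi> d m F \<xi> n" using assms by (auto simp: system_poles_def)
  have "\<tau> \<xi> = n" unfolding system_order_def
  proof (rule the_equality[of "system_pole_of_order E \<Phi> d m F \<xi>", OF n])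
    fix t assume t: "system_pole_of_order E \<Phi> d m F \<xi> t"
    have "t \<le> n" using n t unfolding system_pole_of_order_def by blast
    moreover have "n \<le> t" using n t unfolding system_pole_of_order_def by blast
    ultimately show "t = n" by simp
  qed
  then show "\<xi> \<notin> E" "1 \<le> \<tau> \<xi>" "\<And>t. 1 \<le> t \<Longrightarrow> t \<le> \<tau> \<xi> \<Longrightarrow> pole_combs E \<Phi> d m F \<xi> t \<noteq> {}"
    using n unfolding system_pole_of_order_def by (auto simp only: atLeastAtMost_iff)
qed

lemma rho_pole_gt:
  assumes "\<xi> \<in> X" "1 \<le> t" "t \<le> \<tau> \<xi>"
  shows "ereal (norm (\<Phi> \<xi>)) < \<rho>p \<xi> t"
proof -
  obtain G where G: "G \<in> pole_combs E \<Phi> d m F \<xi> t" using system_pole(3)[OF assms] by blast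
  obtain R N where R: "norm (\<Phi> \<xi>) < R" "pole_form R \<xi> t G N"
    using pole_combsD(2)[OF G] system_pole(1)[OF assms(1)] by blast
  have "ereal R \<le> \<rho>p \<xi> t"
    by (rule rho_pole_ge[OF pole_combsD(1)[OF G] R(2,1)]) (use system_pole assms in auto)
  then show ?thesis using R(1) by (metis less_ereal.simps(1) less_le_trans)
qed

lemma bold_rho_less:
  "1 \<le> t \<Longrightarrow> x < \<rho>b \<xi> t \<longleftrightarrow> (\<forall>k\<in>{1..t}. x < \<rho>p \<xi> k)"
  unfolding bold_rho_pole_def by (subst Min_gr_iff) auto

lemma bold_rho_gt:
  assumes "\<xi> \<in> X" "1 \<le> t" "t \<le> \<tau> \<xi>"
  shows "ereal (norm (\<Phi> \<xi>)) < \<rho>b \<xi> t"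
  using assms rho_pole_gt by (auto simp: bold_rho_less)

lemma QF_facts: "degree QF = M" "lead_coeff QF = 1" "QF \<noteq> 0" "poly QF z = (\<Prod>\<xi>\<in>X. (z - \<xi>) ^ \<tau> \<xi>)"
    "poly QF z = 0 \<longleftrightarrow> z \<in> X"
proof -
  note * = prod_linear_powers[where \<tau> = \<tau> and X = X, folded system_pole_poly_def]
  show "degree QF = M" using *(1)[OF finite_poles] count_poles by simp
  show "lead_coeff QF = 1" "QF \<noteq> 0" "poly QF z = (\<Prod>\<xi>\<in>X. (z - \<xi>) ^ \<tau> \<xi>)" by (rule *)+
  show "poly QF z = 0 \<longleftrightarrow> z \<in> X" unfolding *(5)[OF finite_poles]
    using system_pole(2) by (metis less_le_trans zero_less_one)
qed

lemma M_pos: "1 \<le> M"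
proof -
  have "m 1 \<le> M" unfolding msize_def using d_pos by (intro member_le_sum) auto
  then show ?thesis using m_pos[of 1] d_pos by simp
qed

lemma X_nonempty: "X \<noteq> {}" using count_poles M_pos by auto

subsection \<open>A common domain of holomorphy\<close>

text \<open>A canonical domain on which all the given functions themselves, and not just
  continuations of their germs, are holomorphic; the coefficients in the defining conditions are
  computed at a radius inside it.\<close>

definition \<rho>0 :: real where "\<rho>0 = (SOME \<rho>. 1 < \<rho> \<and> (\<forall>\<alpha>\<in>{1..d}. F \<alpha> holomorphic_on D \<rho>))"
definition r0 :: real where "r0 = (1 + \<rho>0) / 2"

lemma rho0: "1 < \<rho>0" and F_holomorphic: "\<alpha> \<in> {1..d} \<Longrightarrow> F \<alpha> holomorphic_on D \<rho>0"
proof -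
  have "\<forall>\<alpha>\<in>{1..d}. \<exists>\<rho>>1. F \<alpha> holomorphic_on D \<rho>"
    using F_analytic analytic_hext hext_holomorphic by metis
  then obtain \<rho> where \<rho>: "\<And>\<alpha>. \<alpha> \<in> {1..d} \<Longrightarrow> 1 < \<rho> \<alpha> \<and> F \<alpha> holomorphic_on D (\<rho> \<alpha>)" by metis
  define \<rho>' where "\<rho>' = Min (\<rho> ` {1..d})"
  have "1 < \<rho>'" unfolding \<rho>'_def using \<rho> d_pos by (subst Min_gr_iff) auto
  moreover have "F \<alpha> holomorphic_on D \<rho>'" if "\<alpha> \<in> {1..d}" for \<alpha>
  proof (rule holomorphic_on_subset)
    show "D \<rho>' \<subseteq> D (\<rho> \<alpha>)" using that by (intro D_mono) (simp add: \<rho>'_def)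
  qed (use \<rho>[OF that] in auto)
  ultimately have "\<exists>\<rho>. 1 < \<rho> \<and> (\<forall>\<alpha>\<in>{1..d}. F \<alpha> holomorphic_on D \<rho>)" by blast
  from someI_ex[OF this] show "1 < \<rho>0" "\<alpha> \<in> {1..d} \<Longrightarrow> F \<alpha> holomorphic_on D \<rho>0"
    by (auto simp: \<rho>0_def)
qed

lemma r0: "1 < r0" "r0 < \<rho>0" using rho0 by (auto simp: r0_def)

lemma hext_self: "f holomorphic_on D \<rho> \<Longrightarrow> 1 < \<rho> \<Longrightarrow> hext \<rho> f f"
  using open_D[of \<rho>] E_subset_canonical by (auto simp: hext_def)

lemma comb_holomorphic: "comb G \<Longrightarrow> G holomorphic_on D \<rho>0"
  unfolding comb_def poly_comb_def
  by (elim exE conjE) (auto intro!: holomorphic_intros F_holomorphic holomorphic_poly_D)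

text \<open>Both coefficients can be moved to one small radius, where the two continuations of the
  same germ coincide.\<close>

lemma cf_hext_eq:
  assumes "hext R f N" "hext R' f N'" "1 < r" "r < R" "1 < r'" "r' < R'"
  shows "cf N r n = cf N' r' n"
proof -
  define u where "u = (1 + min r r') / 2"
  have u: "1 < u" "u < r" "u < r'" using assms by (auto simp: u_def min_def)
  have "cf N r n = cf N u n" by (rule circle_coeff_Psi_radius[OF hext_holomorphic[OF assms(1)]]) (use u assms in auto)
  also have "\<dots> = cf N' u n"
  proof (rule circle_coeff_cong)
    fix w :: complex assume w: "norm w = u"
    define b where "b = min R R'"
    have b: "b \<le> R" "b \<le> R'" "u < b" using u assms by (auto simp: b_def)
    show "N (\<Psi> w) = N' (\<Psi> w)"
      by (rule hext_unique[OF hext_mono[OF assms(1) b(1)] assms(2) _ b(2)])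
        (use w u b in \<open>auto simp: mem_D Phi_Psi\<close>)
  qed (use u in auto)
  also have "\<dots> = cf N' r' n" by (rule circle_coeff_Psi_radius[OF hext_holomorphic[OF assms(2)]]) (use u assms in auto)
  finally show ?thesis .
qed

subsection \<open>The linear conditions on the denominators\<close>

text \<open>Since the numerators have degree below \<open>n\<close>, they do not enter the condition on the \<open>n\<close>-th
  coefficient; the conditions of smaller index only determine the numerators.\<close>

definition denom :: "nat \<Rightarrow> complex poly \<Rightarrow> bool" where
  "denom n q \<longleftrightarrow> degree q \<le> M \<and> (\<forall>\<alpha>\<in>{1..d}. \<forall>k<m \<alpha>. cf (\<lambda>z. poly q z * z ^ k * F \<alpha> z) r0 n = 0)"

lemma qF_holomorphic: "\<alpha> \<in> {1..d} \<Longrightarrow> (\<lambda>z. poly q z * z ^ k * F \<alpha> z) holomorphic_on D \<rho>0"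
  by (intro holomorphic_intros F_holomorphic holomorphic_poly_D)

lemma pade_faber_iff:
  "pade_faber E \<Phi> d m F n q P \<longleftrightarrow> lead_coeff q = 1 \<and> degree q \<le> M \<and>
     (\<forall>\<alpha>\<in>{1..d}. \<forall>k<m \<alpha>. degree (P k \<alpha>) \<le> n - 1 \<and>
        (\<forall>j\<le>n. cf (\<lambda>z. poly q z * z ^ k * F \<alpha> z) r0 j = cf (poly (P k \<alpha>)) r0 j))"
proof -
  have "faber_coeff E \<Phi> (\<lambda>z. poly q z * z ^ k * F \<alpha> z - poly (P k \<alpha>) z) j =
      cf (\<lambda>z. poly q z * z ^ k * F \<alpha> z) r0 j - cf (poly (P k \<alpha>)) r0 j" if "\<alpha> \<in> {1..d}" for \<alpha> k j
  proof -
    have "(\<lambda>z. poly q z * z ^ k * F \<alpha> z - poly (P k \<alpha>) z) holomorphic_on D \<rho>0"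
      by (intro holomorphic_on_diff qF_holomorphic holomorphic_poly_D that)
    from faber_coeff_eq[OF hext_self[OF this rho0] r0]
    show ?thesis using cf_diff[OF qF_holomorphic[OF that] holomorphic_poly_D r0] by simp
  qed
  then show ?thesis unfolding pade_faber_def by auto
qed

text \<open>For n \<ge> 1 the bound n - 1 on the degree means that the numerator has degree below n,
  hence n-th coefficient 0. For n = 0 the truncated difference would still allow a constant.\<close>

lemma pade_faber_denom:
  assumes "pade_faber E \<Phi> d m F n q P" "1 \<le> n" shows "denom n q"
proof -
  have "cf (\<lambda>z. poly q z * z ^ k * F \<alpha> z) r0 n = 0" if "\<alpha> \<in> {1..d}" "k < m \<alpha>" for \<alpha> k
  proof -
    have "degree (P k \<alpha>) \<le> n - 1 \<and> (\<forall>j\<le>n. cf (\<lambda>z. poly q z * z ^ k * F \<alpha> z) r0 j = cf (poly (P k \<alpha>)) r0 j)"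
      using assms(1) that unfolding pade_faber_iff by blast
    then have deg: "degree (P k \<alpha>) < n" and "cf (\<lambda>z. poly q z * z ^ k * F \<alpha> z) r0 n = cf (poly (P k \<alpha>)) r0 n"
      using assms(2) by auto
    moreover have "cf (poly (P k \<alpha>)) r0 n = 0"
      using cf_poly[OF r0(1), of "P k \<alpha>" n] deg by (simp add: coeff_eq_0)
    ultimately show ?thesis by simp
  qed
  then show ?thesis using assms(1) by (auto simp: denom_def pade_faber_iff)
qed

text \<open>A combination is a sum of terms z^k F_\<alpha> with k < m_\<alpha>, for each of which
  the condition holds; the coefficient depends linearly on the function and only on its germ, so any
  continuation N may be used.\<close>

lemma denom_comb:
  assumes q: "denom n q" and G: "comb G" and N: "hext R (\<lambda>z. poly q z * G z) N" and r: "1 < r" "r < R"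
  shows "cf N r n = 0"
proof -
  obtain v where v: "\<And>\<alpha>. \<alpha> \<in> {1..d} \<Longrightarrow> degree (v \<alpha>) < m \<alpha>" "G = poly_comb d F v"
    using G unfolding comb_def by blast
  have h: "(\<lambda>z. poly q z * G z) holomorphic_on D \<rho>0"
    by (intro holomorphic_intros comb_holomorphic G holomorphic_poly_D)
  have "cf N r n = cf (\<lambda>z. poly q z * G z) r0 n"
    by (rule cf_hext_eq[OF N hext_self[OF h rho0]]) (use r r0 in auto)
  also have "(\<lambda>z. poly q z * G z) = (\<lambda>z. \<Sum>\<alpha>=1..d. \<Sum>k\<le>degree (v \<alpha>). coeff (v \<alpha>) k * (poly q z * z ^ k * F \<alpha> z))"
    by (auto simp: v(2) poly_comb_def poly_altdef sum_distrib_left sum_distrib_right mult_ac)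
  also have "cf \<dots> r0 n = (\<Sum>\<alpha>=1..d. \<Sum>k\<le>degree (v \<alpha>). coeff (v \<alpha>) k * cf (\<lambda>z. poly q z * z ^ k * F \<alpha> z) r0 n)"
  proof (subst cf_sum[OF _ r0])
    show "(\<lambda>z. \<Sum>k\<le>degree (v \<alpha>). coeff (v \<alpha>) k * (poly q z * z ^ k * F \<alpha> z)) holomorphic_on D \<rho>0"
      if "\<alpha> \<in> {1..d}" for \<alpha>
      by (intro holomorphic_on_sum holomorphic_on_mult[OF holomorphic_on_const] qF_holomorphic that)
    show "(\<Sum>\<alpha>=1..d. cf (\<lambda>z. \<Sum>k\<le>degree (v \<alpha>). coeff (v \<alpha>) k * (poly q z * z ^ k * F \<alpha> z)) r0 n) =
       (\<Sum>\<alpha>=1..d. \<Sum>k\<le>degree (v \<alpha>). coeff (v \<alpha>) k * cf (\<lambda>z. poly q z * z ^ k * F \<alpha> z) r0 n)"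
    proof (rule sum.cong[OF refl])
      fix \<alpha> assume \<alpha>: "\<alpha> \<in> {1..d}"
      show "cf (\<lambda>z. \<Sum>k\<le>degree (v \<alpha>). coeff (v \<alpha>) k * (poly q z * z ^ k * F \<alpha> z)) r0 n =
        (\<Sum>k\<le>degree (v \<alpha>). coeff (v \<alpha>) k * cf (\<lambda>z. poly q z * z ^ k * F \<alpha> z) r0 n)"
        by (subst cf_sum[OF _ r0])
          (use \<alpha> in \<open>auto intro!: holomorphic_on_mult[OF holomorphic_on_const] qF_holomorphic sum.cong cf_cmult[OF qF_holomorphic r0]\<close>)
    qed
  qed
  also have "\<dots> = 0"
  proof (intro sum.neutral ballI)
    fix \<alpha> k assume \<alpha>: "\<alpha> \<in> {1..d}" and "k \<in> {..degree (v \<alpha>)}"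
    then have "k < m \<alpha>" using v(1)[OF \<alpha>] by simp
    then show "coeff (v \<alpha>) k * cf (\<lambda>z. poly q z * z ^ k * F \<alpha> z) r0 n = 0"
      using q \<alpha> by (simp add: denom_def)
  qed
  finally show ?thesis .
qed

section \<open>Decay of the Taylor coefficients of the denominators at system poles\<close>

text \<open>The polynomial q is replaced by its Taylor expansion at \<xi>. The radius r lies below
  |\<Phi> \<xi>|, where the separate quotients are holomorphic even though they have poles at
  \<xi>.\<close>

lemma denom_taylor_identity:
  assumes q: "denom n q" and G: "comb G" and N: "pole_form R \<xi> (Suc i) G N" and \<xi>: "\<xi> \<notin> E"
    and R: "norm (\<Phi> \<xi>) < R" and r: "1 < r" "r < norm (\<Phi> \<xi>)"
  shows "(\<Sum>j\<le>M. taylor_coeff q \<xi> j * cf (\<lambda>z. (z - \<xi>) ^ j * N z / (z - \<xi>) ^ Suc i) r n) = 0"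
proof -
  let ?a = "norm (\<Phi> \<xi>)"
  have \<xi>D: "\<xi> \<notin> D ?a" using \<xi> by (simp add: mem_D)
  have N': "N holomorphic_on D ?a"
    using N R holomorphic_on_subset[OF _ D_mono, of N R ?a] by (auto simp: pole_form_def hext_def)
  have h: "(\<lambda>z. (z - \<xi>) ^ j * N z / (z - \<xi>) ^ Suc i) holomorphic_on D ?a" for j
    by (intro holomorphic_intros N') (use \<xi>D in auto)
  define f where "f = (\<lambda>z. \<Sum>j\<le>M. taylor_coeff q \<xi> j * ((z - \<xi>) ^ j * N z / (z - \<xi>) ^ Suc i))"
  obtain U where U: "open U" "E \<subseteq> U" "\<forall>z\<in>U. N z = (z - \<xi>) ^ Suc i * G z"
    using N by (auto simp: pole_form_def hext_def)
  have deg: "degree q \<le> M" using q by (simp add: denom_def)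
  have "hext ?a (\<lambda>z. poly q z * G z) f" unfolding hext_def
  proof (intro conjI exI[of _ "U - {\<xi>}"])
    show "f holomorphic_on D ?a" unfolding f_def by (intro holomorphic_on_sum holomorphic_on_mult[OF holomorphic_on_const] h)
    show "\<forall>z\<in>U - {\<xi>}. f z = poly q z * G z"
    proof
      fix z assume z: "z \<in> U - {\<xi>}"
      then have ne: "(z - \<xi>) ^ Suc i \<noteq> 0" by auto
      have "(z - \<xi>) ^ j * N z / (z - \<xi>) ^ Suc i = (z - \<xi>) ^ j * G z" for j
        using U(3) z ne by simp
      then show "f z = poly q z * G z"
        by (simp only: f_def poly_taylor[OF deg, of z \<xi>] sum_distrib_right mult.assoc)
    qed
  qed (use U \<xi> in auto)
  then have "cf f r n = 0" by (rule denom_comb[OF q G _ r])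
  moreover have "cf f r n = (\<Sum>j\<le>M. cf (\<lambda>z. taylor_coeff q \<xi> j * ((z - \<xi>) ^ j * N z / (z - \<xi>) ^ Suc i)) r n)"
    unfolding f_def by (rule cf_sum[OF _ r]) (rule holomorphic_on_mult[OF holomorphic_on_const h])
  moreover have "\<dots> = (\<Sum>j\<le>M. taylor_coeff q \<xi> j * cf (\<lambda>z. (z - \<xi>) ^ j * N z / (z - \<xi>) ^ Suc i) r n)"
    by (intro sum.cong refl cf_cmult[OF h r])
  ultimately show ?thesis by simp
qed

text \<open>In \<open>denom_taylor_identity\<close> the terms with \<open>j > i\<close> have no pole and are \<open>O(R\<^sup>-\<^sup>n)\<close>, and the term with
  \<open>j = i\<close> has a simple pole, which contributes exactly a nonzero multiple of \<open>(\<Phi> \<xi>)\<^sup>-\<^sup>n\<close>. The terms with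
  \<open>j < i\<close> are bounded on the level curve of index \<open>r < |\<Phi> \<xi>|\<close>; they are \<open>O(R\<^sup>-\<^sup>n)\<close> if the hypothesis is
  available for the larger radius \<open>R' = |\<Phi> \<xi>| R / r\<close>.\<close>

lemma taylor_coeff_step:
  assumes N: "pole_form R' \<xi> (Suc i) G N" and G: "comb G" and \<xi>: "\<xi> \<notin> E"
    and R: "norm (\<Phi> \<xi>) < R" "R < R'" "R' < R * norm (\<Phi> \<xi>)"
    and IH: "\<And>j. j < i \<Longrightarrow> \<exists>C\<ge>0. \<forall>n q. denom n q \<longrightarrow>
        norm (taylor_coeff q \<xi> j) \<le> C * l1_norm M q * (norm (\<Phi> \<xi>) / R') ^ n"
  shows "\<exists>C\<ge>0. \<forall>n q. denom n q \<longrightarrow>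
        norm (taylor_coeff q \<xi> i) \<le> C * l1_norm M q * (norm (\<Phi> \<xi>) / R) ^ n"
proof -
  define a where "a = norm (\<Phi> \<xi>)"
  have a1: "1 < a" using norm_Phi[OF \<xi>] by (simp add: a_def)
  have Rs: "1 < R" "0 < R" "0 < R'" "a < R" "R < R'" using a1 R by (auto simp: a_def)
  \<comment> \<open>With this choice (a / R') / r = 1 / R. The hypothesis R < R' gives r < a, and R'
    < R a gives r > 1.\<close>
  define r where "r = a * R / R'"
  have "a * R < a * R'" using Rs a1 by (intro mult_strict_left_mono) auto
  moreover have "R' < a * R" using R(3) by (simp add: a_def mult.commute)
  ultimately have r: "1 < r" "r < a" using Rs by (simp_all add: r_def pos_less_divide_eq pos_divide_less_eq)
  define h where "h = (\<lambda>j z. (z - \<xi>) ^ j * N z / (z - \<xi>) ^ Suc i)"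
  have NR: "N holomorphic_on D R'" "N \<xi> \<noteq> 0" using N by (auto simp: pole_form_def hext_def)
  have "\<xi> \<notin> D a" using \<xi> by (simp add: mem_D a_def)
  then have hD: "h j holomorphic_on D a" for j unfolding h_def
    by (intro holomorphic_intros holomorphic_on_subset[OF NR(1) D_mono]) (use Rs in auto)
  have "\<exists>K. 0 \<le> K \<and> (\<forall>q. degree q \<le> M \<longrightarrow> norm (taylor_coeff q \<xi> j) \<le> K * l1_norm M q)" for j
    using taylor_coeff_bound[of M \<xi> j] by blast
  then have "\<exists>K. \<forall>j. 0 \<le> K j \<and> (\<forall>q. degree q \<le> M \<longrightarrow> norm (taylor_coeff q \<xi> j) \<le> K j * l1_norm M q)"
    by (intro choice allI)
  then obtain K where K: "\<And>j. 0 \<le> K j" "\<And>j q. degree q \<le> M \<Longrightarrow> norm (taylor_coeff q \<xi> j) \<le> K j * l1_norm M q"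
    by blast
  obtain \<kappa> where \<kappa>: "\<kappa> \<noteq> 0" "\<And>n. cf (\<lambda>z. N z / (z - \<xi>)) R n - cf (\<lambda>z. N z / (z - \<xi>)) r n = \<kappa> / \<Phi> \<xi> ^ n"
    using cf_simple_pole[OF NR(1) \<xi> NR(2) r(1) r(2)[unfolded a_def] R(1,2)] by blast
  have hi: "cf (h i) r n = cf (\<lambda>z. N z / (z - \<xi>)) r n" for n
  proof (rule circle_coeff_cong)
    fix w :: complex assume w: "norm w = r"
    then have "\<Psi> w \<noteq> \<xi>" using r Phi_Psi[of w] by (auto simp: a_def)
    then show "h i (\<Psi> w) = N (\<Psi> w) / (\<Psi> w - \<xi>)" by (simp add: h_def)
  qed (use r in auto)
  \<comment> \<open>The circle of radius R lies beyond the pole, so the standard estimate applies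
    there directly.\<close>
  have "\<exists>B\<ge>0. \<forall>n. norm (cf (\<lambda>z. N z / (z - \<xi>)) R n) \<le> B / R ^ n"
  proof -
    have ne: "\<Psi> w \<noteq> \<xi>" if "norm w = R" for w using that Rs Phi_Psi[of w] by (auto simp: a_def)
    have "continuous_on (sphere 0 R) \<Psi>"
      by (intro continuous_at_imp_continuous_on) (use Rs isCont_Psi in auto)
    then have c: "continuous_on (sphere 0 R) (\<lambda>w. N (\<Psi> w) / (\<Psi> w - \<xi>))"
      by (intro continuous_intros continuous_comp_Psi[OF NR(1)]) (use Rs ne in auto)
    then have "bounded ((\<lambda>w. N (\<Psi> w) / (\<Psi> w - \<xi>)) ` sphere 0 R)"
      by (intro compact_imp_bounded compact_continuous_image) auto
    then obtain B where "B > 0" "\<And>w. norm w = R \<Longrightarrow> norm (N (\<Psi> w) / (\<Psi> w - \<xi>)) \<le> B"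
      unfolding bounded_pos by auto
    then show ?thesis using circle_coeff_bound[OF Rs(2) c] by (intro exI[of _ B]) auto
  qed
  then obtain B0 where B0: "B0 \<ge> 0" "\<And>n. norm (cf (\<lambda>z. N z / (z - \<xi>)) R n) \<le> B0 / R ^ n" by blast
  have "\<exists>B\<ge>0. \<forall>n q. denom n q \<longrightarrow> norm (taylor_coeff q \<xi> j * cf (h j) r n) \<le> B * l1_norm M q / R ^ n"
    if "j \<noteq> i" for j
  proof (cases "j < i")
    case True
    obtain C where C: "C \<ge> 0" "\<And>n q. denom n q \<Longrightarrow> norm (taylor_coeff q \<xi> j) \<le> C * l1_norm M q * (a / R') ^ n"
      using IH[OF True] unfolding a_def by blast
    obtain B where B: "0 \<le> B" "\<And>n. norm (cf (h j) r n) \<le> B / r ^ n" using cf_bound[OF hD r] by blast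
    show ?thesis
    proof (intro exI[of _ "C * B"] conjI allI impI)
      fix n q assume "denom n q"
      then have "norm (taylor_coeff q \<xi> j * cf (h j) r n) \<le> (C * l1_norm M q * (a / R') ^ n) * (B / r ^ n)"
        unfolding norm_mult using B C a1 Rs by (intro mult_mono C B) (auto intro!: mult_nonneg_nonneg l1_norm_nonneg)
      also have "\<dots> = C * B * l1_norm M q * ((a / R') / r) ^ n" by (simp add: power_divide power_mult_distrib)
      also have "(a / R') / r = 1 / R" using Rs a1 by (simp add: r_def field_simps)
      finally show "norm (taylor_coeff q \<xi> j * cf (h j) r n) \<le> C * B * l1_norm M q / R ^ n"
        by (simp add: power_divide)
    qed (use B C in auto)
  next
    case False
    then have j: "j - Suc i + Suc i = j" using that by simp
    define h' where "h' = (\<lambda>z. (z - \<xi>) ^ (j - Suc i) * N z)"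
    have h': "h' holomorphic_on D R'" unfolding h'_def by (intro holomorphic_intros NR)
    have eq: "cf (h j) r n = cf h' R n" for n
    proof -
      have "cf (h j) r n = cf h' r n"
      proof (rule circle_coeff_cong)
        fix w :: complex assume w: "norm w = r"
        then have "\<Psi> w \<noteq> \<xi>" using r Phi_Psi[of w] by (auto simp: a_def)
        then have "(\<Psi> w - \<xi>) ^ Suc i \<noteq> 0" by simp
        moreover have "(\<Psi> w - \<xi>) ^ j = (\<Psi> w - \<xi>) ^ (j - Suc i) * (\<Psi> w - \<xi>) ^ Suc i"
          using power_add[of "\<Psi> w - \<xi>" "j - Suc i" "Suc i"] unfolding j .
        ultimately show "h j (\<Psi> w) = h' (\<Psi> w)" by (simp add: h_def h'_def del: power_Suc)
      qed (use r in auto)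
      also have "\<dots> = cf h' R n" by (rule circle_coeff_Psi_radius[OF h']) (use r Rs in auto)
      finally show ?thesis .
    qed
    obtain B where B: "0 \<le> B" "\<And>n. norm (cf h' R n) \<le> B / R ^ n" using cf_bound[OF h' Rs(1,5)] by blast
    show ?thesis
    proof (intro exI[of _ "K j * B"] conjI allI impI)
      fix n q assume "denom n q"
      then have "norm (taylor_coeff q \<xi> j * cf (h j) r n) \<le> (K j * l1_norm M q) * (B / R ^ n)"
        unfolding norm_mult eq using K B
        by (intro mult_mono K B) (auto simp: denom_def intro!: mult_nonneg_nonneg l1_norm_nonneg)
      then show "norm (taylor_coeff q \<xi> j * cf (h j) r n) \<le> K j * B * l1_norm M q / R ^ n" by (simp add: mult_ac)
    qed (use K B in auto)
  qed
  then have "\<exists>B. \<forall>j. j \<noteq> i \<longrightarrow> 0 \<le> B j \<and>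
     (\<forall>n q. denom n q \<longrightarrow> norm (taylor_coeff q \<xi> j * cf (h j) r n) \<le> B j * l1_norm M q / R ^ n)"
    by (intro choice) blast
  then obtain B where B: "\<And>j. j \<noteq> i \<Longrightarrow> 0 \<le> B j"
     "\<And>j n q. j \<noteq> i \<Longrightarrow> denom n q \<Longrightarrow> norm (taylor_coeff q \<xi> j * cf (h j) r n) \<le> B j * l1_norm M q / R ^ n"
    by blast
  define S where "S = K i * B0 + (\<Sum>j\<in>{..M} - {i}. B j)"
  have S0: "0 \<le> S" unfolding S_def using K B0 B by (intro add_nonneg_nonneg mult_nonneg_nonneg sum_nonneg) auto
  show ?thesis
  proof (intro exI[of _ "S / norm \<kappa>"] conjI allI impI)
    fix n q assume q: "denom n q"
    have deg: "degree q \<le> M" using q by (simp add: denom_def)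
    define T where "T = (\<Sum>j\<in>{..M} - {i}. taylor_coeff q \<xi> j * cf (h j) r n)"
    have T: "norm T \<le> (\<Sum>j\<in>{..M} - {i}. B j) * l1_norm M q / R ^ n"
    proof -
      have "norm T \<le> (\<Sum>j\<in>{..M} - {i}. B j * l1_norm M q / R ^ n)"
        unfolding T_def by (rule order_trans[OF norm_sum]) (use B q in \<open>auto intro!: sum_mono\<close>)
      then show ?thesis by (simp add: sum_distrib_right sum_divide_distrib)
    qed
    \<comment> \<open>For i > M the coefficient of index i vanishes and T is already the full sum,
      so the identity holds for every i.\<close>
    have "taylor_coeff q \<xi> i * cf (h i) r n + T = 0"
    proof (cases "i \<le> M")
      case True
      have "(\<Sum>j\<le>M. taylor_coeff q \<xi> j * cf (h j) r n) = 0"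
        using denom_taylor_identity[OF q G N \<xi> _ r(1) r(2)[unfolded a_def]] Rs by (simp add: h_def a_def del: power_Suc)
      then show ?thesis using True unfolding T_def by (subst (asm) sum.remove[of _ i]) auto
    next
      case False
      then have "taylor_coeff q \<xi> i = 0" unfolding taylor_coeff_def using deg
        by (intro coeff_eq_0) (simp add: degree_pcompose)
      moreover have "{..M} - {i} = {..M}" using False by auto
      ultimately show ?thesis
        using denom_taylor_identity[OF q G N \<xi> _ r(1) r(2)[unfolded a_def]] Rs
        by (simp add: h_def a_def T_def del: power_Suc)
    qed
    then have "taylor_coeff q \<xi> i * (\<kappa> / \<Phi> \<xi> ^ n) = taylor_coeff q \<xi> i * cf (\<lambda>z. N z / (z - \<xi>)) R n + T"
      using \<kappa>(2)[of n] hi[of n] by (simp add: algebra_simps)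
    then have "norm (taylor_coeff q \<xi> i) * (norm \<kappa> / a ^ n) \<le>
       norm (taylor_coeff q \<xi> i) * norm (cf (\<lambda>z. N z / (z - \<xi>)) R n) + norm T"
      by (metis a_def norm_divide norm_mult norm_power norm_triangle_ineq)
    also have "\<dots> \<le> (K i * l1_norm M q) * (B0 / R ^ n) + (\<Sum>j\<in>{..M} - {i}. B j) * l1_norm M q / R ^ n"
      by (intro add_mono mult_mono T B0 K deg) (auto intro!: mult_nonneg_nonneg l1_norm_nonneg K)
    also have "\<dots> = S * l1_norm M q / R ^ n" by (simp add: S_def add_divide_distrib algebra_simps)
    finally have "norm (taylor_coeff q \<xi> i) * norm \<kappa> \<le> S * l1_norm M q / R ^ n * a ^ n"
      using a1 by (simp add: pos_divide_le_eq)
    then have "norm (taylor_coeff q \<xi> i) \<le> (S * l1_norm M q / R ^ n * a ^ n) / norm \<kappa>"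
      by (rule pos_le_divide_eq[THEN iffD2, rotated]) (use \<kappa>(1) in simp)
    then show "norm (taylor_coeff q \<xi> i) \<le> S / norm \<kappa> * l1_norm M q * (norm (\<Phi> \<xi>) / R) ^ n"
      by (simp add: power_divide a_def mult_ac)
  qed (use S0 in simp)
qed

text \<open>Strong induction on i. The step loses a little of the radius, so the lower coefficients
  are taken at some R' > R that is still below the index; the strict inequality leaves room for this
  finitely many times.\<close>

lemma taylor_coeff_decay:
  assumes \<xi>: "\<xi> \<notin> E" and "i < t" and "norm (\<Phi> \<xi>) < R" "ereal R < \<rho>b \<xi> t"
  shows "\<exists>C\<ge>0. \<forall>n q. denom n q \<longrightarrow>
        norm (taylor_coeff q \<xi> i) \<le> C * l1_norm M q * (norm (\<Phi> \<xi>) / R) ^ n"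
  using assms(2-)
proof (induction i arbitrary: R rule: less_induct)
  case (less i)
  have a1: "1 < norm (\<Phi> \<xi>)" by (rule norm_Phi[OF \<xi>])
  have "R < R * norm (\<Phi> \<xi>)" using less.prems a1 by simp
  then have "ereal R < min (\<rho>b \<xi> t) (ereal (R * norm (\<Phi> \<xi>)))" using less.prems by simp
  then obtain R' where R': "R < R'" "ereal R' < \<rho>b \<xi> t" "R' < R * norm (\<Phi> \<xi>)"
    using ereal_dense2 by (metis less_ereal.simps(1) min_less_iff_conj)
  have aR': "norm (\<Phi> \<xi>) < R'" using less.prems R' by simp
  have "ereal R' < \<rho>p \<xi> (Suc i)" using R'(2) less.prems by (auto simp: bold_rho_less)
  then obtain G N where GN: "comb G" "pole_form R' \<xi> (Suc i) G N"
    using rho_pole_obtain[OF \<xi> aR'] by blast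
  show ?case
    by (rule taylor_coeff_step[OF GN(2,1) \<xi> less.prems(2) R'(1,3)])
      (rule less.IH, use less.prems R' aR' in auto)
qed

section \<open>Convergence of the denominators\<close>

text \<open>Since \<open>QF\<close> is monic of degree M, the difference on the left is the
  remainder of q modulo \<open>QF\<close>. Interpolation expresses it through exactly the Taylor
  coefficients whose decay is known.\<close>

lemma denom_decay_bound:
  assumes R: "\<And>\<xi>. \<xi> \<in> X \<Longrightarrow> norm (\<Phi> \<xi>) < R \<xi> \<and> ereal (R \<xi>) < \<rho>b \<xi> (\<tau> \<xi>)"
    and \<theta>: "0 \<le> \<theta>" "\<And>\<xi>. \<xi> \<in> X \<Longrightarrow> norm (\<Phi> \<xi>) / R \<xi> \<le> \<theta>"
  shows "\<exists>C\<ge>0. \<forall>n q. denom n q \<longrightarrow> l1_norm M (q - smult (coeff q M) QF) \<le> C * l1_norm M q * \<theta> ^ n"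
proof -
  obtain h where h: "\<And>q. q mod QF = (\<Sum>\<xi>\<in>X. \<Sum>i<\<tau> \<xi>. smult (taylor_coeff q \<xi> i) (h \<xi> i))"
    using jet_interpolation[OF finite_poles X_nonempty, where \<tau> = \<tau>, folded system_pole_poly_def] by blast
  have "\<exists>C\<ge>0. \<forall>n q. denom n q \<longrightarrow> norm (taylor_coeff q \<xi> i) \<le> C * l1_norm M q * \<theta> ^ n"
    if \<xi>: "\<xi> \<in> X" and i: "i < \<tau> \<xi>" for \<xi> i
  proof -
    obtain C where C: "C \<ge> 0" "\<And>n q. denom n q \<Longrightarrow>
        norm (taylor_coeff q \<xi> i) \<le> C * l1_norm M q * (norm (\<Phi> \<xi>) / R \<xi>) ^ n"
      using taylor_coeff_decay[OF system_pole(1)[OF \<xi>] i, of "R \<xi>"] R[OF \<xi>] by blast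
    have p: "0 < R \<xi>" using R[OF \<xi>] norm_ge_zero[of "\<Phi> \<xi>"] by linarith
    show ?thesis
    proof (intro exI[of _ C] conjI allI impI C(1))
      fix n q assume "denom n q"
      from C(2)[OF this] show "norm (taylor_coeff q \<xi> i) \<le> C * l1_norm M q * \<theta> ^ n"
        by (rule order_trans) (use p C(1) \<theta>(2)[OF \<xi>] in
          \<open>intro mult_left_mono power_mono mult_nonneg_nonneg l1_norm_nonneg divide_nonneg_pos; simp\<close>)
    qed
  qed
  then have "\<forall>\<xi> i. \<exists>C. \<xi> \<in> X \<longrightarrow> i < \<tau> \<xi> \<longrightarrow> C \<ge> 0 \<and> (\<forall>n q. denom n q \<longrightarrow> norm (taylor_coeff q \<xi> i) \<le> C * l1_norm M q * \<theta> ^ n)"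
    by blast
  then obtain C where C: "\<And>\<xi> i. \<xi> \<in> X \<Longrightarrow> i < \<tau> \<xi> \<Longrightarrow> C \<xi> i \<ge> 0"
     "\<And>\<xi> i n q. \<xi> \<in> X \<Longrightarrow> i < \<tau> \<xi> \<Longrightarrow> denom n q \<Longrightarrow> norm (taylor_coeff q \<xi> i) \<le> C \<xi> i * l1_norm M q * \<theta> ^ n"
    by metis
  show ?thesis
  proof (intro exI[of _ "\<Sum>\<xi>\<in>X. \<Sum>i<\<tau> \<xi>. C \<xi> i * l1_norm M (h \<xi> i)"] conjI allI impI)
    show "0 \<le> (\<Sum>\<xi>\<in>X. \<Sum>i<\<tau> \<xi>. C \<xi> i * l1_norm M (h \<xi> i))"
      using C(1) by (intro sum_nonneg mult_nonneg_nonneg l1_norm_nonneg) auto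
    fix n q assume q: "denom n q"
    have "q - smult (coeff q M) QF = q mod QF"
      using mod_monic[of QF q] QF_facts(1,2) M_pos q by (simp add: denom_def)
    also have "l1_norm M (q mod QF) \<le> (\<Sum>\<xi>\<in>X. \<Sum>i<\<tau> \<xi>. norm (taylor_coeff q \<xi> i) * l1_norm M (h \<xi> i))"
      unfolding h by (intro order_trans[OF l1_norm_sum_le] sum_mono) (simp add: l1_norm_smult)
    also have "\<dots> \<le> (\<Sum>\<xi>\<in>X. \<Sum>i<\<tau> \<xi>. (C \<xi> i * l1_norm M q * \<theta> ^ n) * l1_norm M (h \<xi> i))"
      by (intro sum_mono mult_right_mono C q l1_norm_nonneg) auto
    also have "\<dots> = (\<Sum>\<xi>\<in>X. \<Sum>i<\<tau> \<xi>. C \<xi> i * l1_norm M (h \<xi> i)) * l1_norm M q * \<theta> ^ n"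
      by (simp add: sum_distrib_left sum_distrib_right mult_ac)
    finally show "l1_norm M (q - smult (coeff q M) QF) \<le>
       (\<Sum>\<xi>\<in>X. \<Sum>i<\<tau> \<xi>. C \<xi> i * l1_norm M (h \<xi> i)) * l1_norm M q * \<theta> ^ n" .
  qed
qed

text \<open>The claimed value of the limit superior for the denominators.\<close>

definition \<theta>\<^sub>0 :: ereal where "\<theta>\<^sub>0 = Max ((\<lambda>\<xi>. ereal (norm (\<Phi> \<xi>)) / bold_rho E \<Phi> d m F \<xi>) ` X)"

lemma bold_rho_eq: "bold_rho E \<Phi> d m F \<xi> = \<rho>b \<xi> (\<tau> \<xi>)" by (simp add: bold_rho_def)

text \<open>Provides a finite radius below the index, also when the index is \<infinity>. The last
  inequality is not strict; where a strict one is required, an intermediate \<theta> is inserted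
  first.\<close>

lemma ratio_less_obtain:
  assumes "0 < a" "ereal a < \<rho>" "ereal a / \<rho> < ereal \<theta>"
  obtains R where "a < R" "ereal R < \<rho>" "a / R \<le> \<theta>"
proof -
  have \<theta>: "0 < \<theta>"
  proof -
    have "0 \<le> ereal a / \<rho>" using assms(1,2) by (cases \<rho>) (auto intro!: divide_nonneg_nonneg)
    then show ?thesis using assms(3) by (metis ereal_less(2) le_less_trans)
  qed
  have "ereal (max a (a / \<theta>)) < \<rho>"
  proof (cases \<rho>)
    case (real r)
    then have "a < r" "a / r < \<theta>" using assms by auto
    then have "a / \<theta> < r" using \<theta> assms(1) by (simp add: field_simps)
    then show ?thesis using real \<open>a < r\<close> by simp
  next
    case PInf
    then show ?thesis by (simp only: less_ereal.simps)
  qed (use assms in auto)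
  then obtain R where R: "max a (a / \<theta>) < R" "ereal R < \<rho>" using ereal_dense2 by (metis less_ereal.simps(1))
  then have "a / R \<le> \<theta>" using \<theta> assms(1) by (simp add: field_simps)
  then show thesis by (intro that[of R]) (use R in auto)
qed

lemma denom_rate:
  assumes "\<theta>\<^sub>0 < ereal \<theta>"
  shows "\<exists>C\<ge>0. \<forall>n q. denom n q \<longrightarrow> l1_norm M (q - smult (coeff q M) QF) \<le> C * l1_norm M q * \<theta> ^ n"
proof -
  have "\<exists>R. norm (\<Phi> \<xi>) < R \<and> ereal R < \<rho>b \<xi> (\<tau> \<xi>) \<and> norm (\<Phi> \<xi>) / R \<le> \<theta>" if "\<xi> \<in> X" for \<xi>
  proof -
    have "ereal (norm (\<Phi> \<xi>)) / \<rho>b \<xi> (\<tau> \<xi>) \<le> \<theta>\<^sub>0"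
      unfolding \<theta>\<^sub>0_def bold_rho_eq[symmetric] using that finite_poles by (intro Max_ge) auto
    then have 1: "ereal (norm (\<Phi> \<xi>)) / \<rho>b \<xi> (\<tau> \<xi>) < ereal \<theta>" using assms by (rule le_less_trans)
    have 2: "0 < norm (\<Phi> \<xi>)" using norm_Phi[OF system_pole(1)[OF that]] by linarith
    have 3: "ereal (norm (\<Phi> \<xi>)) < \<rho>b \<xi> (\<tau> \<xi>)" using bold_rho_gt[OF that] system_pole(2)[OF that] by simp
    from ratio_less_obtain[OF 2 3 1] show ?thesis by blast
  qed
  then obtain R where R: "\<And>\<xi>. \<xi> \<in> X \<Longrightarrow> norm (\<Phi> \<xi>) < R \<xi> \<and> ereal (R \<xi>) < \<rho>b \<xi> (\<tau> \<xi>) \<and> norm (\<Phi> \<xi>) / R \<xi> \<le> \<theta>"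
    by metis
  obtain \<xi> where \<xi>: "\<xi> \<in> X" using X_nonempty by blast
  have "0 \<le> norm (\<Phi> \<xi>) / R \<xi>" using R[OF \<xi>] norm_ge_zero[of "\<Phi> \<xi>"] by (intro divide_nonneg_nonneg) linarith+
  then have "0 \<le> \<theta>" using R[OF \<xi>] by linarith
  then show ?thesis using R by (intro denom_decay_bound[of R]) auto
qed

lemma theta0: "0 \<le> \<theta>\<^sub>0" "\<theta>\<^sub>0 < 1"
proof -
  have *: "0 \<le> ereal (norm (\<Phi> \<xi>)) / bold_rho E \<Phi> d m F \<xi> \<and> ereal (norm (\<Phi> \<xi>)) / bold_rho E \<Phi> d m F \<xi> < 1"
    if "\<xi> \<in> X" for \<xi>
  proof -
    have "ereal (norm (\<Phi> \<xi>)) < bold_rho E \<Phi> d m F \<xi>"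
      unfolding bold_rho_eq using bold_rho_gt[OF that] system_pole(2)[OF that] by simp
    moreover have "0 < norm (\<Phi> \<xi>)" using norm_Phi[OF system_pole(1)[OF that]] by linarith
    moreover have "0 \<le> ereal x / \<rho> \<and> ereal x / \<rho> < 1" if "ereal x < \<rho>" "0 < x" for x \<rho>
      using that by (cases \<rho>) (auto simp: divide_less_eq)
    ultimately show ?thesis by blast
  qed
  show "\<theta>\<^sub>0 < 1" unfolding \<theta>\<^sub>0_def using * finite_poles X_nonempty by (subst Max_less_iff) auto
  show "0 \<le> \<theta>\<^sub>0" unfolding \<theta>\<^sub>0_def using * finite_poles X_nonempty by (subst Max_ge_iff) auto
qed

text \<open>Once C \<theta>^n < 1/2, the remainder term is absorbed by half the norm of q. The bound
  is stated for all solutions of the linear conditions, monic or not, so that it applies to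
  differences.\<close>

lemma denom_eventually:
  shows "\<exists>n0 B. \<forall>n q. n0 \<le> n \<longrightarrow> denom n q \<longrightarrow> l1_norm M q \<le> B * norm (coeff q M)"
proof -
  obtain \<theta> where \<theta>: "\<theta>\<^sub>0 < ereal \<theta>" "ereal \<theta> < 1" using ereal_dense2[OF theta0(2)] by blast
  have t: "0 \<le> \<theta>" "\<theta> < 1" using \<theta> theta0(1) by (auto simp: one_ereal_def dest: le_less_trans)
  obtain C where C: "C \<ge> 0" "\<And>n q. denom n q \<Longrightarrow> l1_norm M (q - smult (coeff q M) QF) \<le> C * l1_norm M q * \<theta> ^ n"
    using denom_rate[OF \<theta>(1)] by blast
  have "(\<lambda>n. C * \<theta> ^ n) \<longlonglongrightarrow> C * 0" by (intro tendsto_intros LIMSEQ_power_zero) (use t in auto)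
  then have "\<forall>\<^sub>F n in sequentially. C * \<theta> ^ n < 1 / 2" by (intro order_tendstoD) auto
  then obtain n0 where n0: "\<And>n. n0 \<le> n \<Longrightarrow> C * \<theta> ^ n < 1 / 2" by (auto simp: eventually_sequentially)
  show ?thesis
  proof (intro exI[of _ n0] exI[of _ "2 * l1_norm M QF"] allI impI)
    fix n q assume n: "n0 \<le> n" and q: "denom n q"
    have "l1_norm M q = l1_norm M ((q - smult (coeff q M) QF) + smult (coeff q M) QF)" by simp
    also have "\<dots> \<le> l1_norm M (q - smult (coeff q M) QF) + norm (coeff q M) * l1_norm M QF"
      by (rule order_trans[OF l1_norm_add_le]) (simp add: l1_norm_smult)
    also have "l1_norm M (q - smult (coeff q M) QF) \<le> (C * \<theta> ^ n) * l1_norm M q" using C(2)[OF q] by (simp add: mult_ac)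
    also have "\<dots> \<le> 1 / 2 * l1_norm M q" using n0[OF n] by (intro mult_right_mono l1_norm_nonneg) simp
    finally have "l1_norm M q \<le> 2 * (norm (coeff q M) * l1_norm M QF)" by linarith
    then show "l1_norm M q \<le> 2 * l1_norm M QF * norm (coeff q M)" by (simp only: mult_ac)
  qed
qed

lemma denom_diff:
  assumes "denom n q" "denom n q'" shows "denom n (q - q')"
proof -
  have "cf (\<lambda>z. poly (q - q') z * z ^ k * F \<alpha> z) r0 n = 0" if \<alpha>: "\<alpha> \<in> {1..d}" "k < m \<alpha>" for \<alpha> k
  proof -
    have "cf (\<lambda>z. poly (q - q') z * z ^ k * F \<alpha> z) r0 n =
       cf (\<lambda>z. poly q z * z ^ k * F \<alpha> z - poly q' z * z ^ k * F \<alpha> z) r0 n"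
      by (intro circle_coeff_cong) (use r0 in \<open>auto simp: algebra_simps\<close>)
    then have "cf (\<lambda>z. poly (q - q') z * z ^ k * F \<alpha> z) r0 n =
       cf (\<lambda>z. poly q z * z ^ k * F \<alpha> z) r0 n - cf (\<lambda>z. poly q' z * z ^ k * F \<alpha> z) r0 n"
      using cf_diff[OF qF_holomorphic[OF \<alpha>(1)] qF_holomorphic[OF \<alpha>(1)] r0] by simp
    then show ?thesis using assms \<alpha> by (simp add: denom_def)
  qed
  then show ?thesis using assms by (auto simp: denom_def intro: degree_diff_le)
qed

text \<open>A solution without a term of degree M is 0 by the preceding bound. Two monic solutions
  both have degree M, so their difference is such a solution.\<close>

lemma denom_eventually_unique:
  obtains n0 B where "\<And>n q. n0 \<le> n \<Longrightarrow> denom n q \<Longrightarrow> q \<noteq> 0 \<Longrightarrow> degree q = M"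
    "\<And>n q. n0 \<le> n \<Longrightarrow> denom n q \<Longrightarrow> lead_coeff q = 1 \<Longrightarrow> l1_norm M q \<le> B"
    "\<And>n q q'. n0 \<le> n \<Longrightarrow> denom n q \<Longrightarrow> denom n q' \<Longrightarrow> lead_coeff q = 1 \<Longrightarrow> lead_coeff q' = 1 \<Longrightarrow> q = q'"
proof -
  obtain n0 B where B: "\<And>n q. n0 \<le> n \<Longrightarrow> denom n q \<Longrightarrow> l1_norm M q \<le> B * norm (coeff q M)"
    using denom_eventually by blast
  have deg: "degree q = M" if n: "n0 \<le> n" and q: "denom n q" and "q \<noteq> 0" for n q
  proof (rule ccontr)
    assume "degree q \<noteq> M"
    then have "coeff q M = 0" using q by (intro coeff_eq_0) (auto simp: denom_def)
    then have "l1_norm M q \<le> 0" using B[OF n q] by simp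
    then show False using l1_norm_eq_0[of q M] l1_norm_nonneg[of M q] q \<open>q \<noteq> 0\<close> by (auto simp: denom_def)
  qed
  have uniq: "q = q'" if n: "n0 \<le> n" and q: "denom n q" "denom n q'" "lead_coeff q = 1" "lead_coeff q' = 1" for n q q'
  proof (rule ccontr)
    assume "q \<noteq> q'"
    then have "degree (q - q') = M" by (intro deg[OF n denom_diff[OF q(1,2)]]) simp
    moreover have "q \<noteq> 0" "q' \<noteq> 0" using q(3,4) by auto
    then have "degree q = M" "degree q' = M" using deg[OF n q(1)] deg[OF n q(2)] by simp_all
    then have "coeff (q - q') M = 0" using q(3,4) by simp
    ultimately have "lead_coeff (q - q') = 0" by simp
    then show False using \<open>q \<noteq> q'\<close> by (simp only: leading_coeff_0_iff) simp
  qed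
  have bd: "l1_norm M q \<le> B" if n: "n0 \<le> n" and q: "denom n q" "lead_coeff q = 1" for n q
  proof -
    have "q \<noteq> 0" using q(2) by auto
    then show ?thesis using B[OF n q(1)] deg[OF n q(1)] q(2) by simp
  qed
  show thesis by (rule that[OF deg bd uniq])
qed

end

section \<open>The lower bound for the rate of convergence\<close>

context exterior_domain
begin

lemma hext_divide_linear:
  assumes N: "hext R (\<lambda>z. (z - \<eta>) * f z) N" and R: "1 < R" and \<eta>: "\<eta> \<notin> E" and 0: "\<eta> \<in> D R \<Longrightarrow> N \<eta> = 0"
  obtains N' where "hext R f N'" "\<And>z. z \<in> D R \<Longrightarrow> z \<noteq> \<eta> \<Longrightarrow> N' z = N z / (z - \<eta>)"
proof -
  define N' where "N' = (\<lambda>z. if z = \<eta> then deriv N \<eta> else N z / (z - \<eta>))"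
  have Nh: "N holomorphic_on D R" using N by (rule hext_holomorphic)
  have "N' holomorphic_on D R"
  proof (cases "\<eta> \<in> D R")
    case True
    then have "N' = (\<lambda>z. if z = \<eta> then deriv N \<eta> else (N z - N \<eta>) / (z - \<eta>))"
      using 0 by (simp add: N'_def fun_eq_iff)
    then show ?thesis using pole_lemma_open[OF Nh open_D[OF R], of \<eta>] by simp
  next
    case False
    have "(\<lambda>z. N z / (z - \<eta>)) holomorphic_on D R" by (intro holomorphic_intros Nh) (use False in auto)
    then show ?thesis by (rule holomorphic_transform) (use False in \<open>auto simp: N'_def\<close>)
  qed
  moreover obtain U where U: "open U" "E \<subseteq> U" "\<forall>z\<in>U. N z = (z - \<eta>) * f z" using N by (auto simp: hext_def)
  ultimately have "hext R f N'" unfolding hext_def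
    by (intro conjI exI[of _ "U - {\<eta>}"]) (use \<eta> in \<open>auto simp: N'_def\<close>)
  then show thesis by (rule that) (simp add: N'_def)
qed

text \<open>All zeros of e lie in the smaller domain, where a continuation without the factor e is
  already given; elsewhere the larger continuation may simply be divided by e.\<close>

lemma hext_remove_factor:
  assumes N1: "hext \<rho>1 (\<lambda>z. poly c z * G z) N1" and M1: "hext \<rho> (\<lambda>z. poly (c * e) z * G z) M1"
    and \<rho>: "1 < \<rho>1" "\<rho>1 \<le> \<rho>" and e: "e \<noteq> 0" "\<And>z. poly e z = 0 \<Longrightarrow> z \<in> D \<rho>1"
  obtains N where "hext \<rho> (\<lambda>z. poly c z * G z) N" "\<And>z. z \<in> D \<rho>1 \<Longrightarrow> N z = N1 z"
proof -
  define N where "N = (\<lambda>z. if z \<in> D \<rho>1 then N1 z else M1 z / poly e z)"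
  have h: "hext \<rho>1 (\<lambda>z. poly (c * e) z * G z) (\<lambda>z. poly e z * N1 z)"
    using hext_mult_poly[OF N1, of e] by (simp add: mult_ac)
  have eq: "poly e z * N1 z = M1 z" if "z \<in> D \<rho>1" for z
    by (rule hext_unique[OF h M1 \<rho> that])
  define B where "B = D \<rho> - {z. poly e z = 0}"
  have B: "open B" unfolding B_def
    using poly_roots_finite[OF e(1)] \<rho> by (intro open_Diff open_D finite_imp_closed) auto
  have "N holomorphic_on D \<rho>1"
    by (rule holomorphic_transform[OF hext_holomorphic[OF N1]]) (simp add: N_def)
  moreover have "N holomorphic_on B"
  proof (rule holomorphic_transform)
    show "(\<lambda>z. M1 z / poly e z) holomorphic_on B"
      by (intro holomorphic_intros holomorphic_on_subset[OF hext_holomorphic[OF M1]]) (auto simp: B_def)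
    show "M1 z / poly e z = N z" if "z \<in> B" for z
      using that eq[of z] by (auto simp: N_def B_def field_simps)
  qed
  ultimately have "N holomorphic_on D \<rho>1 \<union> B" using B open_D[OF \<rho>(1)] by (intro holomorphic_on_Un) auto
  moreover have "D \<rho> \<subseteq> D \<rho>1 \<union> B" using e(2) by (auto simp: B_def)
  ultimately have "N holomorphic_on D \<rho>" by (rule holomorphic_on_subset)
  moreover obtain U where U: "open U" "E \<subseteq> U" "\<forall>z\<in>U. N1 z = poly c z * G z" using N1 by (auto simp: hext_def)
  ultimately have "hext \<rho> (\<lambda>z. poly c z * G z) N" unfolding hext_def
    using open_D[OF \<rho>(1)] by (intro conjI exI[of _ "U \<inter> D \<rho>1"]) (auto simp: N_def mem_D)
  then show thesis by (rule that) (simp add: N_def)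
qed

end

context faber_system
begin

lemma comb_diff_cmult:
  assumes "comb G" "comb H" shows "comb (\<lambda>z. G z - k * H z)"
proof -
  obtain v w where v: "\<And>\<alpha>. \<alpha> \<in> {1..d} \<Longrightarrow> degree (v \<alpha>) < m \<alpha>" "G = poly_comb d F v"
    and w: "\<And>\<alpha>. \<alpha> \<in> {1..d} \<Longrightarrow> degree (w \<alpha>) < m \<alpha>" "H = poly_comb d F w"
    using assms unfolding comb_def by blast
  have "degree (v \<alpha> - smult k (w \<alpha>)) < m \<alpha>" if "\<alpha> \<in> {1..d}" for \<alpha>
    using v(1)[OF that] w(1)[OF that] by (intro degree_diff_less) (auto intro: le_less_trans[OF degree_smult_le])
  moreover have "(\<lambda>z. G z - k * H z) = poly_comb d F (\<lambda>\<alpha>. v \<alpha> - smult k (w \<alpha>))"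
    by (simp add: v w poly_comb_def fun_eq_iff sum_subtractf[symmetric] sum_distrib_left algebra_simps)
  ultimately show ?thesis unfolding comb_def by (intro exI[of _ "\<lambda>\<alpha>. v \<alpha> - smult k (w \<alpha>)"]) auto
qed

lemma eventually_bound_imp_bound:
  fixes x y :: "nat \<Rightarrow> real"
  assumes "\<And>n. n0 \<le> n \<Longrightarrow> x n \<le> C * y n" "\<And>n. 0 < y n"
  shows "\<exists>C'. \<forall>n. x n \<le> C' * y n"
proof (intro exI[of _ "max C (Max ((\<lambda>n. x n / y n) ` {..n0}))"] allI)
  fix n
  show "x n \<le> max C (Max ((\<lambda>n. x n / y n) ` {..n0})) * y n"
  proof (cases "n0 \<le> n")
    case True
    then show ?thesis using assms by (meson max.cobounded1 mult_right_mono less_imp_le order_trans)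
  next
    case False
    then have "x n / y n \<le> Max ((\<lambda>n. x n / y n) ` {..n0})" by (intro Max_ge) auto
    then have "x n / y n \<le> max C (Max ((\<lambda>n. x n / y n) ` {..n0}))" by simp
    then show ?thesis using assms(2)[of n] by (simp only: pos_divide_le_eq)
  qed
qed

text \<open>Below the level of \<xi> the n-th coefficients of z^i G are O(r^(-n)), and those of
  \<open>QF\<close> - Q_n are O(\<theta>^n). The product is O((\<theta> / r)^n), and r > R \<theta>
  turns this into O(R^(-n)).\<close>

lemma QF_comb_extends:
  assumes G: "comb G" and N: "pole_form R0 \<xi> t G N" and \<xi>: "\<xi> \<notin> E" and R0: "norm (\<Phi> \<xi>) < R0"
    and \<theta>: "0 < \<theta>" "R * \<theta> < norm (\<Phi> \<xi>)" and R: "norm (\<Phi> \<xi>) < R"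
    and Q: "\<And>n. n0 \<le> n \<Longrightarrow> denom n (Q n) \<and> l1_norm M (Q n - QF) \<le> C * \<theta> ^ n"
  obtains H where "hext R (\<lambda>z. poly QF z * G z) H"
proof -
  define a where "a = norm (\<Phi> \<xi>)"
  have a1: "1 < a" using norm_Phi[OF \<xi>] by (simp add: a_def)
  \<comment> \<open>Possible because R \<theta> < |\<Phi> \<xi>|, the condition that links the
    radius to the assumed rate.\<close>
  obtain r where r: "max 1 (R * \<theta>) < r" "r < a" using dense[of "max 1 (R * \<theta>)" a] a1 \<theta> by (auto simp: a_def)
  have r': "1 < r" "R * \<theta> < r" using r by auto
  have Rp: "0 < R" using R a1 by (simp add: a_def)
  define g where "g = (\<lambda>z. N z / (z - \<xi>) ^ t)"
  have \<xi>D: "\<xi> \<notin> D a" using \<xi> by (simp add: mem_D a_def)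
  have g: "g holomorphic_on D a" unfolding g_def
    by (intro holomorphic_intros holomorphic_on_subset[OF hext_holomorphic D_mono])
      (use N R0 \<xi>D in \<open>auto simp: pole_form_def a_def\<close>)
  obtain U where U: "open U" "E \<subseteq> U" "\<forall>z\<in>U. N z = (z - \<xi>) ^ t * G z"
    using N by (auto simp: pole_form_def hext_def)
  have hg: "hext a G g" unfolding hext_def
    by (intro conjI g exI[of _ "U - {\<xi>}"]) (use U \<xi> in \<open>auto simp: g_def\<close>)
  have zg: "(\<lambda>z. z ^ i * g z) holomorphic_on D a" for i by (intro holomorphic_intros g)
  have pg: "(\<lambda>z. poly p z * g z) holomorphic_on D a" for p by (intro holomorphic_intros g holomorphic_poly_D)
  have "\<exists>B. \<forall>i. 0 \<le> B i \<and> (\<forall>n. norm (cf (\<lambda>z. z ^ i * g z) r n) \<le> B i / r ^ n)"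
    by (intro choice allI) (use cf_bound[OF zg r'(1) r(2)] in blast)
  then obtain B where B: "\<And>i. 0 \<le> B i" "\<And>i n. norm (cf (\<lambda>z. z ^ i * g z) r n) \<le> B i / r ^ n" by blast
  define S where "S = (\<Sum>i\<le>M. B i)"
  have S0: "0 \<le> S" using B by (simp add: S_def sum_nonneg)
  have bnd: "norm (cf (\<lambda>z. poly QF z * g z) r n) \<le> C * S * (1 / R ^ n)" if n: "n0 \<le> n" for n
  proof -
    define p where "p = QF - Q n"
    have dn: "denom n (Q n)" and ln: "l1_norm M (Q n - QF) \<le> C * \<theta> ^ n" using Q[OF n] by auto
    have lp: "l1_norm M p \<le> C * \<theta> ^ n"
      using ln by (simp add: l1_norm_def p_def norm_minus_commute)
    have deg: "degree p \<le> M" unfolding p_def using dn QF_facts(1) by (intro degree_diff_le) (auto simp: denom_def)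
    have "cf (\<lambda>z. poly QF z * g z) r n = cf (\<lambda>z. poly p z * g z + poly (Q n) z * g z) r n"
      by (intro circle_coeff_cong) (use r' in \<open>auto simp: p_def algebra_simps\<close>)
    also have "\<dots> = cf (\<lambda>z. poly p z * g z) r n + cf (\<lambda>z. poly (Q n) z * g z) r n"
      by (rule cf_add[OF pg pg r'(1) r(2)])
    also have "cf (\<lambda>z. poly (Q n) z * g z) r n = 0"
      by (rule denom_comb[OF dn G hext_mult_poly[OF hg] r'(1) r(2)])
    also have "cf (\<lambda>z. poly p z * g z) r n = cf (\<lambda>z. \<Sum>i\<le>M. coeff p i * (z ^ i * g z)) r n"
    proof (intro circle_coeff_cong)
      fix w
      have "poly p (\<Psi> w) = (\<Sum>i\<le>M. coeff p i * \<Psi> w ^ i)"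
        unfolding poly_altdef using deg by (intro sum.mono_neutral_left) (auto simp: coeff_eq_0)
      then show "poly p (\<Psi> w) * g (\<Psi> w) = (\<Sum>i\<le>M. coeff p i * (\<Psi> w ^ i * g (\<Psi> w)))"
        by (simp add: sum_distrib_left sum_distrib_right mult_ac)
    qed (use r' in auto)
    also have "\<dots> = (\<Sum>i\<le>M. cf (\<lambda>z. coeff p i * (z ^ i * g z)) r n)"
      by (rule cf_sum[OF _ r'(1) r(2)]) (rule holomorphic_on_mult[OF holomorphic_on_const zg])
    also have "\<dots> = (\<Sum>i\<le>M. coeff p i * cf (\<lambda>z. z ^ i * g z) r n)"
      by (intro sum.cong refl cf_cmult[OF zg r'(1) r(2)])
    finally have "norm (cf (\<lambda>z. poly QF z * g z) r n) \<le> (\<Sum>i\<le>M. norm (coeff p i) * norm (cf (\<lambda>z. z ^ i * g z) r n))"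
      by (simp only: add_0_right) (rule order_trans[OF norm_sum], simp add: norm_mult)
    also have "\<dots> \<le> (\<Sum>i\<le>M. l1_norm M p * (B i / r ^ n))"
      by (intro sum_mono mult_mono B l1_norm_nonneg) (auto simp: l1_norm_def intro!: member_le_sum)
    also have "\<dots> = l1_norm M p * S / r ^ n"
      by (simp add: S_def sum_distrib_left sum_divide_distrib)
    also have "\<dots> \<le> C * \<theta> ^ n * S / r ^ n"
      by (intro divide_right_mono mult_right_mono lp S0) (use r' in auto)
    also have "\<dots> = (C * S) * (\<theta> / r) ^ n" by (simp add: power_divide)
    also have "\<dots> \<le> (C * S) * (1 / R) ^ n"
    proof (intro mult_left_mono power_mono)
      show "\<theta> / r \<le> 1 / R" using r' Rp by (simp add: field_simps less_imp_le)
      have "0 \<le> C * \<theta> ^ n" using lp l1_norm_nonneg[of M p] by linarith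
      then have "0 \<le> C" by (intro mult_right_le_imp_le[of 0 "\<theta> ^ n" C]) (use \<theta> in simp_all)
      then show "0 \<le> C * S" using S0 by simp
    qed (use \<theta> r' in auto)
    finally show ?thesis by (simp add: power_divide)
  qed
  obtain C' where C': "\<And>n. norm (cf (\<lambda>z. poly QF z * g z) r n) \<le> C' * (1 / R ^ n)"
    using eventually_bound_imp_bound[of n0 "\<lambda>n. norm (cf (\<lambda>z. poly QF z * g z) r n)", OF bnd] Rp by auto
  show thesis
  proof (rule hext_of_coeff_bound[OF hext_mult_poly[OF hg] r'(1) r(2)])
    show "r < R" using r R by (simp add: a_def)
    show "norm (cf (\<lambda>z. poly QF z * g z) r n) \<le> C' / R ^ n" for n using C'[of n] by simp
  qed (rule that)
qed

text \<open>Each induction step lowers the order of one pole \<open>\<eta>\<close>: if \<open>\<eta>\<close> lies in \<open>D R\<close>, by subtracting a multiple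
  of a combination whose only pole is \<open>\<eta>\<close>, with the same order; otherwise the factor \<open>z - \<eta>\<close> has no
  zero in \<open>D R\<close>.\<close>

lemma clear_outer_poles:
  assumes R: "1 < R" and W: "finite W" "\<xi> \<notin> W" "\<And>\<eta>. \<eta> \<in> W \<Longrightarrow> \<eta> \<notin> E" and \<xi>: "\<xi> \<in> D R" and t: "1 \<le> t"
    and kill: "\<And>\<eta> k. \<eta> \<in> W \<Longrightarrow> \<eta> \<in> D R \<Longrightarrow> 1 \<le> k \<Longrightarrow> k \<le> \<tau> \<eta> \<Longrightarrow> \<exists>G N. comb G \<and> pole_form R \<eta> k G N"
  shows "comb G \<Longrightarrow> hext R (\<lambda>z. (z - \<xi>) ^ t * (\<Prod>\<eta>\<in>W. (z - \<eta>) ^ s \<eta>) * G z) N \<Longrightarrow> N \<xi> \<noteq> 0 \<Longrightarrow>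
     (\<And>\<eta>. \<eta> \<in> W \<Longrightarrow> s \<eta> \<le> \<tau> \<eta>) \<Longrightarrow> \<exists>G' N'. comb G' \<and> pole_form R \<xi> t G' N'"
proof (induction "\<Sum>\<eta>\<in>W. s \<eta>" arbitrary: s G N)
  case 0
  then have "s \<eta> = 0" if "\<eta> \<in> W" for \<eta> using W(1) that by simp
  then have "(\<Prod>\<eta>\<in>W. (z - \<eta>) ^ s \<eta>) = 1" for z by simp
  then show ?case using 0 by (intro exI[of _ G] exI[of _ N]) (simp add: pole_form_def)
next
  case (Suc l)
  have "\<exists>\<eta>\<in>W. s \<eta> \<noteq> 0"
  proof (rule ccontr)
    assume "\<not> ?thesis"
    then have "(\<Sum>\<eta>\<in>W. s \<eta>) = 0" by simp
    then show False using Suc.hyps(2) by simp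
  qed
  then obtain \<eta> where \<eta>: "\<eta> \<in> W" "s \<eta> \<noteq> 0" by blast
  define s' where "s' = s(\<eta> := s \<eta> - 1)"
  define p where "p = (\<lambda>z. (z - \<xi>) ^ t * (\<Prod>\<zeta>\<in>W - {\<eta>}. (z - \<zeta>) ^ s \<zeta>))"
  have prod_s: "(z - \<xi>) ^ t * (\<Prod>\<zeta>\<in>W. (z - \<zeta>) ^ s \<zeta>) = p z * (z - \<eta>) ^ s \<eta>" for z
    unfolding p_def prod.remove[OF W(1) \<eta>(1)] by (simp add: mult_ac)
  have prod_s': "(z - \<eta>) * ((z - \<xi>) ^ t * (\<Prod>\<zeta>\<in>W. (z - \<zeta>) ^ s' \<zeta>)) = p z * (z - \<eta>) ^ s \<eta>" for z
  proof -
    have "(\<Prod>\<zeta>\<in>W - {\<eta>}. (z - \<zeta>) ^ s' \<zeta>) = (\<Prod>\<zeta>\<in>W - {\<eta>}. (z - \<zeta>) ^ s \<zeta>)"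
      by (intro prod.cong) (auto simp: s'_def)
    moreover have *: "(z - \<eta>) ^ s \<eta> = (z - \<eta>) * (z - \<eta>) ^ s' \<eta>"
      using \<eta>(2) by (simp add: s'_def power_Suc[symmetric] del: power_Suc)
    ultimately show ?thesis unfolding p_def prod.remove[OF W(1) \<eta>(1)] * by (simp only: mult_ac)
  qed
  have \<xi>\<eta>: "\<xi> \<noteq> \<eta>" using \<eta> W by auto
  have p\<xi>: "p \<xi> = 0" using t by (simp add: p_def)
  have p\<eta>: "p \<eta> \<noteq> 0" using W \<xi>\<eta> by (auto simp: p_def)
  have ps: "p holomorphic_on UNIV" unfolding p_def by (intro holomorphic_intros)
  have "\<exists>G1 N1. comb G1 \<and> hext R (\<lambda>z. p z * (z - \<eta>) ^ s \<eta> * G1 z) N1 \<and> N1 \<xi> = N \<xi> \<and> (\<eta> \<in> D R \<longrightarrow> N1 \<eta> = 0)"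
  proof (cases "\<eta> \<in> D R")
    case False
    then show ?thesis using Suc.prems(1,2) unfolding prod_s by blast
  next
    case True
    obtain H K where HK: "comb H" "hext R (\<lambda>z. (z - \<eta>) ^ s \<eta> * H z) K" "K \<eta> \<noteq> 0"
      using kill[OF \<eta>(1) True, of "s \<eta>"] \<eta>(2) Suc.prems(4)[OF \<eta>(1)] by (auto simp: pole_form_def)
    \<comment> \<open>This value of k makes the new numerator vanish at \<eta>. The correction
      carries the factor p, which vanishes at \<xi> because t \<ge> 1, so the value at \<xi> is
      preserved.\<close>
    define k where "k = N \<eta> / (p \<eta> * K \<eta>)"
    have "hext R (\<lambda>z. p z * (z - \<eta>) ^ s \<eta> * G z + (- k * p z) * ((z - \<eta>) ^ s \<eta> * H z)) (\<lambda>z. N z + (- k * p z) * K z)"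
      by (intro hext_add hext_mult_entire HK holomorphic_intros ps) (use Suc.prems(2) in \<open>simp add: prod_s\<close>)
    then have "hext R (\<lambda>z. p z * (z - \<eta>) ^ s \<eta> * (G z - k * H z)) (\<lambda>z. N z + (- k * p z) * K z)"
      by (rule hext_cong[THEN iffD1, rotated]) (simp add: algebra_simps)
    moreover have "N \<eta> + (- k * p \<eta>) * K \<eta> = 0" using HK(3) p\<eta> by (simp add: k_def)
    ultimately show ?thesis using comb_diff_cmult[OF Suc.prems(1) HK(1), of k] p\<xi>
      by (intro exI[of _ "\<lambda>z. G z - k * H z"] exI[of _ "\<lambda>z. N z + (- k * p z) * K z"]) simp
  qed
  then obtain G1 N1 where G1: "comb G1" "hext R (\<lambda>z. p z * (z - \<eta>) ^ s \<eta> * G1 z) N1" "N1 \<xi> = N \<xi>"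
     "\<eta> \<in> D R \<Longrightarrow> N1 \<eta> = 0" by blast
  have hd: "hext R (\<lambda>z. (z - \<eta>) * ((z - \<xi>) ^ t * (\<Prod>\<zeta>\<in>W. (z - \<zeta>) ^ s' \<zeta>) * G1 z)) N1"
    by (rule hext_cong[THEN iffD1, OF _ G1(2)]) (simp only: prod_s'[symmetric] mult.assoc)
  obtain N2 where N2: "hext R (\<lambda>z. (z - \<xi>) ^ t * (\<Prod>\<zeta>\<in>W. (z - \<zeta>) ^ s' \<zeta>) * G1 z) N2"
     "\<And>z. z \<in> D R \<Longrightarrow> z \<noteq> \<eta> \<Longrightarrow> N2 z = N1 z / (z - \<eta>)"
    using hext_divide_linear[OF hd R W(3)[OF \<eta>(1)] G1(4)] by blast
  show ?case
  proof (rule Suc.hyps(1)[OF _ G1(1) N2(1)])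
    have "(\<Sum>\<zeta>\<in>W. s \<zeta>) = s \<eta> + (\<Sum>\<zeta>\<in>W - {\<eta>}. s \<zeta>)" by (rule sum.remove[OF W(1) \<eta>(1)])
    moreover have "(\<Sum>\<zeta>\<in>W. s' \<zeta>) = s' \<eta> + (\<Sum>\<zeta>\<in>W - {\<eta>}. s' \<zeta>)" by (rule sum.remove[OF W(1) \<eta>(1)])
    moreover have "(\<Sum>\<zeta>\<in>W - {\<eta>}. s' \<zeta>) = (\<Sum>\<zeta>\<in>W - {\<eta>}. s \<zeta>)" by (intro sum.cong) (auto simp: s'_def)
    ultimately show "l = (\<Sum>\<zeta>\<in>W. s' \<zeta>)" using Suc.hyps(2) \<eta>(2) by (simp add: s'_def)
    show "N2 \<xi> \<noteq> 0" using N2(2)[OF \<xi> \<xi>\<eta>] G1(3) Suc.prems(3) \<xi>\<eta> by simp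
    show "s' \<zeta> \<le> \<tau> \<zeta>" if "\<zeta> \<in> W" for \<zeta> using Suc.prems(4)[OF that] by (auto simp: s'_def)
  qed
qed

text \<open>Induction on the number of system poles strictly beyond the level of \<xi>. For such a
  pole \<eta> the condition R \<theta> < |\<Phi> \<eta>| is inherited, so the combinations that
  clear it are available up to the same R.\<close>

lemma single_pole_comb:
  assumes Q: "\<And>n. n0 \<le> n \<Longrightarrow> denom n (Q n) \<and> l1_norm M (Q n - QF) \<le> C * \<theta> ^ n" and \<theta>: "0 < \<theta>"
  shows "\<xi> \<in> X \<Longrightarrow> 1 \<le> t \<Longrightarrow> t \<le> \<tau> \<xi> \<Longrightarrow> norm (\<Phi> \<xi>) < R \<Longrightarrow> R * \<theta> < norm (\<Phi> \<xi>) \<Longrightarrow>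
     \<exists>G N. comb G \<and> pole_form R \<xi> t G N"
proof (induction "card {\<eta> \<in> X. norm (\<Phi> \<xi>) < norm (\<Phi> \<eta>)}" arbitrary: \<xi> t rule: less_induct)
  case less
  define W where "W = {\<eta> \<in> X. norm (\<Phi> \<xi>) < norm (\<Phi> \<eta>)}"
  have W: "finite W" "W \<subseteq> X" "\<xi> \<notin> W" using finite_poles by (auto simp: W_def)
  have \<xi>E: "\<xi> \<notin> E" using system_pole less.prems by auto
  have a1: "1 < norm (\<Phi> \<xi>)" by (rule norm_Phi[OF \<xi>E])
  obtain G R' N' where G: "comb G" and R': "norm (\<Phi> \<xi>) < R'" "pole_form R' \<xi> t G N'"
    using system_pole(3)[OF less.prems(1-3)] pole_combsD(1,2)[OF _ \<xi>E] by blast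
  \<comment> \<open>On \<open>D R0\<close> the combination G has only the pole \<xi>, with known
    numerator.\<close>
  define R0 where "R0 = min R R'"
  have R0: "norm (\<Phi> \<xi>) < R0" "R0 \<le> R" "R0 \<le> R'" using R' less.prems by (auto simp: R0_def)
  have N0: "pole_form R0 \<xi> t G N'" using R'(2) hext_mono[OF _ R0(3)] by (auto simp: pole_form_def)
  obtain H where H: "hext R (\<lambda>z. poly QF z * G z) H"
    using QF_comb_extends[OF G N0 \<xi>E R0(1) \<theta> less.prems(5,4) Q] by blast
  define pw where "pw = (\<Prod>\<eta>\<in>W. [:- \<eta>, 1:] ^ \<tau> \<eta>)"
  define c where "c = [:- \<xi>, 1:] ^ t * pw"
  \<comment> \<open>The factors of \<open>QF\<close> that G does not require: the surplus order at
    \<xi> and the poles not beyond its level. Their zeros lie in \<open>D R0\<close>, so they can be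
    removed from the extension of \<open>QF\<close> times G.\<close>
  define e where "e = [:- \<xi>, 1:] ^ (\<tau> \<xi> - t) * (\<Prod>\<eta>\<in>X - W - {\<xi>}. [:- \<eta>, 1:] ^ \<tau> \<eta>)"
  have ce: "QF = c * e"
  proof -
    have "QF = (\<Prod>\<eta>\<in>X - W. [:- \<eta>, 1:] ^ \<tau> \<eta>) * pw"
      unfolding system_pole_poly_def pw_def by (rule prod.subset_diff[OF W(2) finite_poles])
    also have "(\<Prod>\<eta>\<in>X - W. [:- \<eta>, 1:] ^ \<tau> \<eta>) = [:- \<xi>, 1:] ^ \<tau> \<xi> * (\<Prod>\<eta>\<in>X - W - {\<xi>}. [:- \<eta>, 1:] ^ \<tau> \<eta>)"
      by (rule prod.remove) (use finite_poles less.prems W in auto)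
    also have "[:- \<xi>, 1:] ^ \<tau> \<xi> = [:- \<xi>, 1:] ^ t * [:- \<xi>, 1:] ^ (\<tau> \<xi> - t)"
      using less.prems by (simp add: power_add[symmetric])
    finally show ?thesis by (simp add: c_def e_def mult_ac)
  qed
  have e0: "e \<noteq> 0" using ce QF_facts(3) by auto
  have er: "z \<in> D R0" if "poly e z = 0" for z
  proof -
    have "z = \<xi> \<or> z \<in> X - W" using that finite_poles by (auto simp: e_def poly_prod)
    then have "norm (\<Phi> z) \<le> norm (\<Phi> \<xi>)" by (auto simp: W_def)
    then show ?thesis using R0(1) by (simp add: mem_D)
  qed
  have N1: "hext R0 (\<lambda>z. poly c z * G z) (\<lambda>z. poly pw z * N' z)"
  proof -
    have "hext R0 (\<lambda>z. poly pw z * ((z - \<xi>) ^ t * G z)) (\<lambda>z. poly pw z * N' z)"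
      using N0 by (intro hext_mult_poly) (simp add: pole_form_def)
    then show ?thesis by (rule hext_cong[THEN iffD1, rotated]) (simp add: c_def mult_ac)
  qed
  obtain N where N: "hext R (\<lambda>z. poly c z * G z) N" "\<And>z. z \<in> D R0 \<Longrightarrow> N z = poly pw z * N' z"
    using hext_remove_factor[OF N1 H[unfolded ce] less_trans[OF a1 R0(1)] R0(2) e0 er] by blast
  show ?case
  proof (rule clear_outer_poles[OF less_trans[OF a1 less.prems(4)] W(1,3) _ mem_D_pole[OF less.prems(4)] less.prems(2) _ G])
    show "hext R (\<lambda>z. (z - \<xi>) ^ t * (\<Prod>\<eta>\<in>W. (z - \<eta>) ^ \<tau> \<eta>) * G z) N"
      by (rule hext_cong[THEN iffD1, OF _ N(1)]) (simp add: c_def pw_def poly_prod)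
    have "poly pw \<xi> \<noteq> 0" using W by (auto simp: pw_def poly_prod)
    then show "N \<xi> \<noteq> 0" using N(2)[OF mem_D_pole[OF R0(1)]] N0 by (simp add: pole_form_def)
    show "\<eta> \<notin> E" if "\<eta> \<in> W" for \<eta> using that W system_pole(1) by auto
    show "\<exists>G N. comb G \<and> pole_form R \<eta> k G N" if \<eta>: "\<eta> \<in> W" "\<eta> \<in> D R" "1 \<le> k" "k \<le> \<tau> \<eta>" for \<eta> k
    proof (rule less.hyps)
      have "{\<zeta> \<in> X. norm (\<Phi> \<eta>) < norm (\<Phi> \<zeta>)} \<subset> {\<zeta> \<in> X. norm (\<Phi> \<xi>) < norm (\<Phi> \<zeta>)}"
        using \<eta>(1) by (auto simp: W_def)
      then show "card {\<zeta> \<in> X. norm (\<Phi> \<eta>) < norm (\<Phi> \<zeta>)} < card {\<zeta> \<in> X. norm (\<Phi> \<xi>) < norm (\<Phi> \<zeta>)}"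
        using finite_poles by (intro psubset_card_mono) auto
      show "\<eta> \<in> X" using \<eta> W by auto
      then show "norm (\<Phi> \<eta>) < R" using \<eta>(2) system_pole(1) by (auto simp: mem_D)
      show "R * \<theta> < norm (\<Phi> \<eta>)" using less.prems(5) \<eta>(1) by (simp add: W_def)
    qed (use \<eta> in auto)
  qed auto
qed

text \<open>If some \<rho>_\<xi>,t were below |\<Phi> \<xi>| / \<theta>, a radius R strictly between
  them would admit a combination with pole \<xi> of order t up to R, which contradicts the
  maximality of \<rho>_\<xi>,t.\<close>

lemma theta0_le:
  assumes Q: "\<And>n. n0 \<le> n \<Longrightarrow> denom n (Q n) \<and> l1_norm M (Q n - QF) \<le> C * \<theta> ^ n" and \<theta>: "0 < \<theta>"
  shows "\<theta>\<^sub>0 \<le> ereal \<theta>"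
proof -
  have "ereal (norm (\<Phi> \<xi>)) / bold_rho E \<Phi> d m F \<xi> \<le> ereal \<theta>" if \<xi>: "\<xi> \<in> X" for \<xi>
  proof -
    define a where "a = norm (\<Phi> \<xi>)"
    have a: "0 < a" using norm_Phi[OF system_pole(1)[OF \<xi>]] unfolding a_def by linarith
    have le: "ereal (a / \<theta>) \<le> \<rho>p \<xi> t" if t: "1 \<le> t" "t \<le> \<tau> \<xi>" for t
    proof (rule ccontr)
      assume "\<not> ?thesis"
      then have "\<rho>p \<xi> t < ereal (a / \<theta>)" by simp
      then obtain R where R: "\<rho>p \<xi> t < ereal R" "ereal R < ereal (a / \<theta>)" using ereal_dense2 by blast
      have "ereal a < ereal R" using rho_pole_gt[OF \<xi> t] R(1) unfolding a_def by (rule less_trans)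
      then have aR: "norm (\<Phi> \<xi>) < R" by (simp add: a_def)
      have "R * \<theta> < norm (\<Phi> \<xi>)" using R(2) \<theta> by (simp add: a_def pos_less_divide_eq)
      from single_pole_comb[OF Q \<theta> \<xi> t aR this] obtain G N where "comb G" "pole_form R \<xi> t G N" by blast
      then have "ereal R \<le> \<rho>p \<xi> t" by (rule rho_pole_ge[OF _ _ aR system_pole(1)[OF \<xi>] t(1)])
      then show False using R(1) by simp
    qed
    have "ereal (a / \<theta>) \<le> bold_rho E \<Phi> d m F \<xi>"
      unfolding bold_rho_eq bold_rho_pole_def using le system_pole(2)[OF \<xi>] by (subst Min_ge_iff) auto
    then show ?thesis unfolding a_def[symmetric]
    proof (cases "bold_rho E \<Phi> d m F \<xi>")
      case (real r)
      with \<open>ereal (a / \<theta>) \<le> bold_rho E \<Phi> d m F \<xi>\<close> have r: "a / \<theta> \<le> r" by simp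
      then have "0 < r" using divide_pos_pos[OF a \<theta>] by linarith
      then show "ereal a / bold_rho E \<Phi> d m F \<xi> \<le> ereal \<theta>"
        using r \<theta> by (simp add: real pos_divide_le_eq mult.commute)
    qed (use \<theta> in auto)
  qed
  then show ?thesis unfolding \<theta>\<^sub>0_def using finite_poles X_nonempty by (subst Max_le_iff) auto
qed

end

section \<open>Faber sections\<close>

context exterior_domain
begin

text \<open>p is the n-th partial sum of the Faber series of g, with indices 0 to n - 1; it is
  characterized by its coefficients instead of being expanded in Faber polynomials.\<close>

definition faber_section :: "real \<Rightarrow> nat \<Rightarrow> (complex \<Rightarrow> complex) \<Rightarrow> complex poly \<Rightarrow> bool" where
  "faber_section r n g p \<longleftrightarrow> (\<forall>j<n. cf (poly p) r j = cf g r j) \<and> (\<forall>i\<ge>n. coeff p i = 0)"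

lemma cf_poly_radius: "1 < r \<Longrightarrow> 1 < s \<Longrightarrow> cf (poly p) r j = cf (poly p) s j"
  by (rule circle_coeff_Psi_radius[OF holomorphic_poly_D, of _ "max r s + 1"]) auto

lemma faber_section_radius:
  assumes "faber_section r n g p" "g holomorphic_on D A" "1 < r" "r < A" "1 < s" "s < A"
  shows "faber_section s n g p"
  using assms circle_coeff_Psi_radius[OF assms(2-6)] cf_poly_radius[OF assms(3,5)]
  by (simp add: faber_section_def)

lemma cf_poly_high:
  assumes "1 < r" "\<And>i. i \<ge> n \<Longrightarrow> coeff p i = 0" "n \<le> j"
  shows "cf (poly p) r j = 0"
proof -
  have "degree p \<le> n" by (rule degree_le) (use assms(2) in auto)
  then show ?thesis using cf_poly[OF assms(1), of p j] assms by simp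
qed

lemma ratio_choose:
  fixes r A \<mu> :: real
  assumes "0 < r" "0 < A" "r / A < \<mu>"
  obtains R u where "0 < R" "R < A" "r < u" "u / R < \<mu>" "r / \<mu> < R"
proof -
  have \<mu>: "0 < \<mu>" using assms by (meson divide_pos_pos less_trans)
  have "r / \<mu> < A" using assms \<mu> by (simp add: field_simps)
  then obtain R where R: "r / \<mu> < R" "R < A" using dense by blast
  have R0: "0 < R" using R assms \<mu> by (meson divide_pos_pos less_trans)
  have "r < \<mu> * R" using R \<mu> by (simp add: field_simps)
  then obtain u where "r < u" "u < \<mu> * R" using dense by blast
  then show thesis using that[of R u] R R0 by (simp add: field_simps)
qed

text \<open>The error g - p keeps only the coefficients of index n and higher, and these are
  O(R^(-j)) for R close to A. Bounding it on \<open>Dc r\<close> through a radius u slightly above r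
  gives a geometric tail with ratio u / R.\<close>

lemma faber_section_error:
  assumes g: "g holomorphic_on D A" and s: "1 < s" "s < A" and r: "1 < r" "r < A" and \<mu>: "r / A < \<mu>"
  shows "\<exists>C\<ge>0. \<forall>n p. faber_section s n g p \<longrightarrow> (\<forall>z\<in>Dc r. norm (g z - poly p z) \<le> C * \<mu> ^ n)"
proof -
  \<comment> \<open>The given \<mu> may be 1 or more. Lowering it below 1, but not to r / A, forces
    u < R, so that the tail converges and u lies within the domain of g.\<close>
  define \<mu>' where "\<mu>' = min \<mu> ((1 + r / A) / 2)"
  have "r / A < 1" using r by simp
  moreover have "y < min \<mu> ((1 + y) / 2) \<and> min \<mu> ((1 + y) / 2) < 1" if "y < 1" "y < \<mu>" for y :: real
    using that by (auto simp: min_def)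
  ultimately have \<mu>': "r / A < \<mu>'" "\<mu>' < 1" "\<mu>' \<le> \<mu>" using \<mu> unfolding \<mu>'_def by (blast intro: min.cobounded1)+
  obtain R u where Ru: "0 < R" "R < A" "r < u" "u / R < \<mu>'" "r / \<mu>' < R"
    using ratio_choose[of r A \<mu>'] r \<mu>' by auto
  have m0: "0 < \<mu>'" using \<mu>'(1) r by (meson divide_pos_pos less_trans zero_less_one)
  have u: "1 < u" "u < R" using Ru r \<mu>' by (auto simp: pos_divide_less_eq intro: less_trans)
  have R1: "1 < R" using u by simp
  obtain C where C: "0 \<le> C" "\<And>\<rho> N z. N holomorphic_on D \<rho> \<Longrightarrow> u < \<rho> \<Longrightarrow> z \<in> Dc r \<Longrightarrow>
     norm (N z) \<le> C * (\<Sum>n. norm (cf N u n) * u ^ n)"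
    using Faber_bound[OF u(1) Ru(3)] by blast
  obtain B where B: "0 \<le> B" "\<And>n. norm (cf g R n) \<le> B / R ^ n" using cf_bound[OF g R1 Ru(2)] by blast
  define x where "x = u / R"
  have x: "0 < x" "x < 1" "x < \<mu>'" using u R1 Ru by (auto simp: x_def)
  show ?thesis
  proof (intro exI[of _ "C * (B / (1 - x))"] conjI allI impI ballI)
    fix n p z assume sec: "faber_section s n g p" and z: "z \<in> Dc r"
    have gp: "(\<lambda>z. g z - poly p z) holomorphic_on D A" by (intro holomorphic_on_diff g holomorphic_poly_D)
    have secu: "faber_section u n g p" by (rule faber_section_radius[OF sec g s u(1)]) (use u Ru in auto)
    have t: "norm (cf (\<lambda>z. g z - poly p z) u j) * u ^ j \<le> (if j < n then 0 else B * x ^ j)" for j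
    proof -
      have "cf (\<lambda>z. g z - poly p z) u j = cf g u j - cf (poly p) u j"
        by (rule cf_diff[OF g holomorphic_poly_D u(1)]) (use u Ru in auto)
      moreover have "cf (poly p) u j = 0" if "n \<le> j"
        by (rule cf_poly_high[OF u(1) _ that]) (use secu in \<open>auto simp: faber_section_def\<close>)
      moreover have "cf (poly p) u j = cf g u j" if "j < n" using secu that by (simp add: faber_section_def)
      moreover have "cf g u j = cf g R j" by (rule circle_coeff_Psi_radius[OF g]) (use u R1 Ru in auto)
      moreover have "norm (cf g R j) * u ^ j \<le> B / R ^ j * u ^ j" using B u by (intro mult_right_mono) auto
      ultimately show ?thesis by (auto simp: x_def power_divide)
    qed
    have sm: "summable (\<lambda>j. if j < n then 0 else B * x ^ j)"
    proof (rule summable_comparison_test'[of "\<lambda>j. B * x ^ j" 0])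
      show "summable (\<lambda>j. B * x ^ j)" using x by (intro summable_mult summable_geometric) auto
    qed (use B x in auto)
    have "(\<Sum>j. norm (cf (\<lambda>z. g z - poly p z) u j) * u ^ j) \<le> (\<Sum>j. if j < n then 0 else B * x ^ j)"
      by (intro suminf_le t sm cf_summable(1)[OF gp u(1)]) (use u Ru in auto)
    also have "\<dots> = (\<Sum>j. (if j + n < n then 0 else B * x ^ (j + n)))"
      using suminf_split_initial_segment[OF sm, of n] by simp
    also have "\<dots> = (\<Sum>j. B * x ^ n * x ^ j)" by (simp add: power_add mult_ac)
    also have "\<dots> = B * x ^ n * (1 / (1 - x))"
      using x by (subst suminf_mult) (auto simp: suminf_geometric intro: summable_geometric)
    also have "\<dots> \<le> B * \<mu> ^ n * (1 / (1 - x))"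
      using x \<mu>' m0 B by (intro mult_right_mono mult_left_mono power_mono) auto
    finally have "norm (g z - poly p z) \<le> C * (B * \<mu> ^ n * (1 / (1 - x)))"
      using C(2)[OF gp _ z] C(1) u Ru by (meson less_trans mult_left_mono order_trans)
    then show "norm (g z - poly p z) \<le> C * (B / (1 - x)) * \<mu> ^ n" by (simp add: mult_ac)
  qed (use C B x in auto)
qed

text \<open>Here the level r need not be inside the domain of g, so no approximation is claimed; the
  section has only n coefficients, and the finite geometric sum grows at most like a ratio close to
  r / A.\<close>

lemma faber_section_bound:
  assumes g: "g holomorphic_on D A" and s: "1 < s" "s < A" and r: "A \<le> r" and \<mu>: "r / A < \<mu>"
  shows "\<exists>C\<ge>0. \<forall>n p. faber_section s n g p \<longrightarrow> (\<forall>z\<in>Dc r. norm (poly p z) \<le> C * \<mu> ^ n)"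
proof -
  have A: "1 < A" "0 < r" using s r by auto
  obtain R u where Ru: "0 < R" "R < A" "r < u" "u / R < \<mu>" "r / \<mu> < R"
    using ratio_choose[of r A \<mu>] A \<mu> by auto
  \<comment> \<open>Raises R above 1, where \<Psi> is defined, while staying below A; this only
    decreases the ratio.\<close>
  define R' where "R' = max R ((1 + A) / 2)"
  have R': "1 < R'" "R' < A" "R \<le> R'" using A Ru by (auto simp: R'_def less_max_iff_disj)
  define x where "x = u / R'"
  have u: "1 < u" "R' < u" using Ru R' r A by auto
  have "x \<le> u / R" unfolding x_def using R' Ru u by (intro divide_left_mono) auto
  then have x: "1 < x" "x < \<mu>" using Ru u R' by (auto simp: x_def)
  obtain C where C: "0 \<le> C" "\<And>\<rho> N z. N holomorphic_on D \<rho> \<Longrightarrow> u < \<rho> \<Longrightarrow> z \<in> Dc r \<Longrightarrow>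
     norm (N z) \<le> C * (\<Sum>n. norm (cf N u n) * u ^ n)"
    using Faber_bound[OF u(1) Ru(3)] by blast
  obtain B where B: "0 \<le> B" "\<And>n. norm (cf g R' n) \<le> B / R' ^ n" using cf_bound[OF g R'(1,2)] by blast
  show ?thesis
  proof (intro exI[of _ "C * (B / (x - 1))"] conjI allI impI ballI)
    fix n p z assume sec: "faber_section s n g p" and z: "z \<in> Dc r"
    have secR: "faber_section R' n g p" by (rule faber_section_radius[OF sec g s R'(1,2)])
    have "(\<Sum>j. norm (cf (poly p) u j) * u ^ j) = (\<Sum>j<n. norm (cf (poly p) u j) * u ^ j)"
      using cf_poly_high[OF u(1), of n p] secR by (intro suminf_finite) (auto simp: faber_section_def)
    also have "\<dots> \<le> (\<Sum>j<n. B * x ^ j)"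
    proof (rule sum_mono)
      fix j assume "j \<in> {..<n}"
      then have "cf (poly p) u j = cf g R' j"
        using secR cf_poly_radius[OF u(1) R'(1), of p j] by (simp add: faber_section_def)
      moreover have "norm (cf g R' j) * u ^ j \<le> B / R' ^ j * u ^ j" using B u by (intro mult_right_mono) auto
      ultimately show "norm (cf (poly p) u j) * u ^ j \<le> B * x ^ j" by (simp add: x_def power_divide)
    qed
    also have "\<dots> = B * ((x ^ n - 1) / (x - 1))" using x by (simp add: sum_distrib_left[symmetric] geometric_sum)
    also have "\<dots> \<le> B * (\<mu> ^ n / (x - 1))"
    proof (intro mult_left_mono divide_right_mono B)
      have "x ^ n \<le> \<mu> ^ n" using x by (intro power_mono) auto
      then show "x ^ n - 1 \<le> \<mu> ^ n" by simp
    qed (use x in auto)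
    finally have "norm (poly p z) \<le> C * (B * (\<mu> ^ n / (x - 1)))"
      using C(2)[OF holomorphic_poly_D[of p "u + 1"] _ z] C(1) by (meson less_add_one mult_left_mono order_trans)
    then show "norm (poly p z) \<le> C * (B / (x - 1)) * \<mu> ^ n" by (simp add: mult_ac)
  qed (use C B x in auto)
qed

end

section \<open>Convergence of the approximants\<close>

lemma finite_exhaust_Min:
  fixes f :: "'a \<Rightarrow> real"
  assumes "finite X" "\<And>x. x \<in> X \<Longrightarrow> 1 < f x"
  obtains r where "1 < r" "\<And>x. x \<in> X \<Longrightarrow> r < f x"
proof -
  define b where "b = Min (insert 2 (f ` X))"
  have "1 < b" unfolding b_def using assms by (subst Min_gr_iff) auto
  then obtain r where r: "1 < r" "r < b" using dense by blast
  have "b \<le> f x" if "x \<in> X" for x unfolding b_def using assms(1) that by (intro Min_le) auto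
  then show thesis using that r by (meson less_le_trans)
qed

context faber_system
begin

text \<open>The function \<open>f \<xi> i\<close> has at most a pole of order \<sigma> \<xi> - i at
  \<xi>. For i \<ge> \<sigma> \<xi> it continues to \<open>D R\<close>, and its section error alone
  has the rate r / R. Otherwise the decay (|\<Phi> \<xi>| / R)^n of the Taylor coefficient meets a
  section error of rate r / |\<Phi> \<xi>|, and the product again has the rate r / R. The level r
  avoids the poles.\<close>

lemma approximant_error_on_level:
  assumes \<alpha>: "\<alpha> \<in> {1..d}" "k < m \<alpha>" and R: "1 < R"
    and \<sigma>: "\<And>\<xi>. \<xi> \<in> X \<Longrightarrow> 0 < \<sigma> \<xi> \<Longrightarrow> norm (\<Phi> \<xi>) < R \<and> ereal R < \<rho>b \<xi> (\<sigma> \<xi>)"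
    and N: "hext R (\<lambda>z. (\<Prod>\<xi>\<in>X. (z - \<xi>) ^ \<sigma> \<xi>) * F \<alpha> z) N"
    and r: "1 < r" "r < R" "\<And>\<xi>. \<xi> \<in> X \<Longrightarrow> norm (\<Phi> \<xi>) \<noteq> r" and \<nu>: "r / R < \<nu>"
  shows "\<exists>C\<ge>0. \<forall>n\<ge>1. \<forall>q P. pade_faber E \<Phi> d m F n q P \<longrightarrow> (\<forall>z. z \<notin> E \<and> norm (\<Phi> z) = r \<longrightarrow>
     norm (poly q z * z ^ k * (N z / (\<Prod>\<xi>\<in>X. (z - \<xi>) ^ \<sigma> \<xi>)) - poly (P k \<alpha>) z) \<le> C * l1_norm M q * \<nu> ^ n)"
proof -
  define qs where "qs = (\<lambda>z. \<Prod>\<xi>\<in>X. (z - \<xi>) ^ \<sigma> \<xi>)"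
  have hN: "hext R (\<lambda>z. qs z * F \<alpha> z) N" using N by (simp only: qs_def)
  have qs0: "qs z \<noteq> 0" if "z \<notin> X" for z unfolding qs_def using that finite_poles by (subst prod_zero_iff) auto
  obtain p where p: "(\<Sum>\<xi>\<in>X. p \<xi> * (\<Prod>\<eta>\<in>X - {\<xi>}. [:- \<eta>, 1:] ^ \<sigma> \<eta>)) = 1"
    using partial_fraction_unity[OF finite_poles X_nonempty, of \<sigma>] by blast
  define f where "f = (\<lambda>\<xi> i z. (z - \<xi>) ^ i * (z ^ k * poly (p \<xi>) z * N z / (z - \<xi>) ^ \<sigma> \<xi>))"
  have Nh: "N holomorphic_on D R" using N by (rule hext_holomorphic)
  have lampos: "0 < \<nu>" using \<nu> r R by (meson divide_pos_pos less_trans zero_less_one)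
  have a1: "1 < norm (\<Phi> \<xi>)" "\<xi> \<notin> E" if "\<xi> \<in> X" for \<xi> using system_pole(1)[OF that] norm_Phi by auto
  have split: "z ^ k * (N z / qs z) = (\<Sum>\<xi>\<in>X. z ^ k * poly (p \<xi>) z * N z / (z - \<xi>) ^ \<sigma> \<xi>)" if "z \<notin> X" for z
  proof -
    have "1 = poly (\<Sum>\<xi>\<in>X. p \<xi> * (\<Prod>\<eta>\<in>X - {\<xi>}. [:- \<eta>, 1:] ^ \<sigma> \<eta>)) z" unfolding p by simp
    also have "\<dots> = (\<Sum>\<xi>\<in>X. poly (p \<xi>) z * (\<Prod>\<eta>\<in>X - {\<xi>}. (z - \<eta>) ^ \<sigma> \<eta>))" by (simp add: poly_sum poly_prod)
    finally have "z ^ k * (N z / qs z) =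
        z ^ k * (N z / qs z) * (\<Sum>\<xi>\<in>X. poly (p \<xi>) z * (\<Prod>\<eta>\<in>X - {\<xi>}. (z - \<eta>) ^ \<sigma> \<eta>))"
      by (metis mult_1_right)
    also have "\<dots> = (\<Sum>\<xi>\<in>X. z ^ k * (N z / qs z) * (poly (p \<xi>) z * (\<Prod>\<eta>\<in>X - {\<xi>}. (z - \<eta>) ^ \<sigma> \<eta>)))"
      by (rule sum_distrib_left)
    also have "\<dots> = (\<Sum>\<xi>\<in>X. z ^ k * poly (p \<xi>) z * N z / (z - \<xi>) ^ \<sigma> \<xi>)"
    proof (rule sum.cong[OF refl])
      fix \<xi> assume \<xi>: "\<xi> \<in> X"
      have "qs z = (z - \<xi>) ^ \<sigma> \<xi> * (\<Prod>\<eta>\<in>X - {\<xi>}. (z - \<eta>) ^ \<sigma> \<eta>)"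
        unfolding qs_def by (rule prod.remove[OF finite_poles \<xi>])
      moreover have "qs z \<noteq> 0" by (rule qs0[OF that])
      ultimately show "z ^ k * (N z / qs z) * (poly (p \<xi>) z * (\<Prod>\<eta>\<in>X - {\<xi>}. (z - \<eta>) ^ \<sigma> \<eta>)) =
          z ^ k * poly (p \<xi>) z * N z / (z - \<xi>) ^ \<sigma> \<xi>" by (simp add: field_simps)
    qed
    finally show ?thesis .
  qed
  obtain r1' where r1': "1 < r1'" "\<And>\<xi>. \<xi> \<in> X \<Longrightarrow> r1' < norm (\<Phi> \<xi>)"
    using finite_exhaust_Min[of X "\<lambda>\<xi>. norm (\<Phi> \<xi>)"] finite_poles a1 by blast
  \<comment> \<open>Below A there is no system pole, the given F_\<alpha> is holomorphic, and N is
    defined; all coefficients are compared at the radius s inside.\<close>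
  define A where "A = min r1' (min R \<rho>0)"
  define s where "s = (1 + A) / 2"
  have A: "1 < A" "A \<le> R" "A \<le> \<rho>0" "\<And>\<xi>. \<xi> \<in> X \<Longrightarrow> A < norm (\<Phi> \<xi>)"
    using r1' R rho0 by (auto simp: A_def min_less_iff_disj)
  have s: "1 < s" "s < A" using A by (auto simp: s_def)
  have fA: "f \<xi> i holomorphic_on D a" if "\<xi> \<in> X" "a \<le> R" "a \<le> norm (\<Phi> \<xi>)" for \<xi> i a
  proof -
    have "\<xi> \<notin> D a" using a1[OF that(1)] that(3) by (simp add: mem_D)
    then show ?thesis unfolding f_def
      by (intro holomorphic_intros holomorphic_poly_D holomorphic_on_subset[OF Nh D_mono]) (use that in auto)
  qed
  have expand: "poly q z * z ^ k * (N z / qs z) = (\<Sum>\<xi>\<in>X. \<Sum>i\<le>M. taylor_coeff q \<xi> i * f \<xi> i z)"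
    if "z \<notin> X" "degree q \<le> M" for q z
  proof -
    have "poly q z * z ^ k * (N z / qs z) = (\<Sum>\<xi>\<in>X. poly q z * (z ^ k * poly (p \<xi>) z * N z / (z - \<xi>) ^ \<sigma> \<xi>))"
      using split[OF that(1)] by (simp only: mult.assoc sum_distrib_left)
    also have "\<dots> = (\<Sum>\<xi>\<in>X. \<Sum>i\<le>M. taylor_coeff q \<xi> i * f \<xi> i z)"
    proof (rule sum.cong[OF refl])
      fix \<xi>
      show "poly q z * (z ^ k * poly (p \<xi>) z * N z / (z - \<xi>) ^ \<sigma> \<xi>) = (\<Sum>i\<le>M. taylor_coeff q \<xi> i * f \<xi> i z)"
        unfolding f_def poly_taylor[OF that(2), of z \<xi>] sum_distrib_right by (simp only: mult.assoc)
    qed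
    finally show ?thesis .
  qed
  have piece: "\<exists>C\<ge>0. \<forall>n q p'. denom n q \<longrightarrow> faber_section s n (f \<xi> i) p' \<longrightarrow> (\<forall>z. z \<notin> E \<and> norm (\<Phi> z) = r \<longrightarrow>
      norm (taylor_coeff q \<xi> i) * norm (f \<xi> i z - poly p' z) \<le> C * l1_norm M q * \<nu> ^ n)" if \<xi>: "\<xi> \<in> X" for \<xi> i
  proof (cases "i < \<sigma> \<xi>")
    case False
    define g where "g = (\<lambda>z. (z - \<xi>) ^ (i - \<sigma> \<xi>) * (z ^ k * poly (p \<xi>) z * N z))"
    have g: "g holomorphic_on D R" unfolding g_def by (intro holomorphic_intros holomorphic_poly_D Nh)
    have gf: "f \<xi> i z = g z" if "z \<noteq> \<xi>" for z
    proof -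
      have "(z - \<xi>) ^ i = (z - \<xi>) ^ (i - \<sigma> \<xi>) * (z - \<xi>) ^ \<sigma> \<xi>"
        using False by (simp add: power_add[symmetric])
      then show ?thesis using that by (simp add: f_def g_def)
    qed
    obtain C where C: "C \<ge> 0" "\<And>n p' z. faber_section s n g p' \<Longrightarrow> z \<in> Dc r \<Longrightarrow> norm (g z - poly p' z) \<le> C * \<nu> ^ n"
      using faber_section_error[OF g s(1) _ r(1,2) \<nu>] s A by auto
    obtain K where K: "0 \<le> K" "\<And>q. degree q \<le> M \<Longrightarrow> norm (taylor_coeff q \<xi> i) \<le> K * l1_norm M q"
      using taylor_coeff_bound by blast
    show ?thesis
    proof (intro exI[of _ "K * C"] conjI allI impI)
      fix n q p' z assume q: "denom n q" and sec: "faber_section s n (f \<xi> i) p'" and z: "z \<notin> E \<and> norm (\<Phi> z) = r"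
      have "cf (f \<xi> i) s j = cf g s j" for j
      proof (rule circle_coeff_cong)
        fix w :: complex assume w: "norm w = s"
        have "\<Psi> w \<noteq> \<xi>" using w s A(4)[OF \<xi>] Phi_Psi[of w] by auto
        then show "f \<xi> i (\<Psi> w) = g (\<Psi> w)" by (rule gf)
      qed (use s in auto)
      then have "faber_section s n g p'" using sec by (simp add: faber_section_def)
      moreover have "z \<noteq> \<xi>" using z r(3)[OF \<xi>] by auto
      ultimately have "norm (f \<xi> i z - poly p' z) \<le> C * \<nu> ^ n" using C(2) z gf by (auto simp: Dc_def)
      then have "norm (taylor_coeff q \<xi> i) * norm (f \<xi> i z - poly p' z) \<le> (K * l1_norm M q) * (C * \<nu> ^ n)"
        using q K by (intro mult_mono K(2)) (auto simp: denom_def intro!: mult_nonneg_nonneg l1_norm_nonneg)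
      then show "norm (taylor_coeff q \<xi> i) * norm (f \<xi> i z - poly p' z) \<le> K * C * l1_norm M q * \<nu> ^ n" by (simp add: mult_ac)
    qed (use K C in auto)
  next
    case True
    define a where "a = norm (\<Phi> \<xi>)"
    have a: "1 < a" "a < R" "ereal R < \<rho>b \<xi> (\<sigma> \<xi>)" "A < a" using \<sigma>[OF \<xi>] True a1[OF \<xi>] A(4)[OF \<xi>] by (auto simp: a_def)
    obtain K where K: "0 \<le> K" "\<And>n q. denom n q \<Longrightarrow> norm (taylor_coeff q \<xi> i) \<le> K * l1_norm M q * (a / R) ^ n"
      using taylor_coeff_decay[OF a1(2)[OF \<xi>] True] a unfolding a_def by blast
    \<comment> \<open>The rate left for the section once the decay a / R is split off from \<nu>;
      the assumption r / R < \<nu> becomes r / a < \<mu>.\<close>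
    define \<mu> where "\<mu> = \<nu> * R / a"
    have \<mu>: "r / a < \<mu>" "0 < \<mu>" "a / R * \<mu> = \<nu>"
    proof -
      have "r < \<nu> * R" using \<nu> R by (simp add: pos_divide_less_eq)
      then show "r / a < \<mu>" unfolding \<mu>_def using a by (intro divide_strict_right_mono) auto
    qed (use a R lampos in \<open>auto simp: \<mu>_def\<close>)
    have fa: "f \<xi> i holomorphic_on D a" by (rule fA[OF \<xi>]) (use a in \<open>auto simp: a_def\<close>)
    have "\<exists>C\<ge>0. \<forall>n p'. faber_section s n (f \<xi> i) p' \<longrightarrow> (\<forall>z. z \<notin> E \<and> norm (\<Phi> z) = r \<longrightarrow>
       norm (f \<xi> i z - poly p' z) \<le> C * \<mu> ^ n)"
    proof (cases "r < a")
      case True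
      have "\<exists>C\<ge>0. \<forall>n p'. faber_section s n (f \<xi> i) p' \<longrightarrow> (\<forall>z\<in>Dc r. norm (f \<xi> i z - poly p' z) \<le> C * \<mu> ^ n)"
        by (rule faber_section_error[OF fa s(1) _ r(1) True \<mu>(1)]) (use s a in auto)
      then show ?thesis by (fastforce simp: Dc_def)
    next
      case False
      then have ra: "a < r" using r(3)[OF \<xi>] by (simp add: a_def)
      obtain C where C: "C \<ge> 0" "\<And>n p' z. faber_section s n (f \<xi> i) p' \<Longrightarrow> z \<in> Dc r \<Longrightarrow> norm (poly p' z) \<le> C * \<mu> ^ n"
        using faber_section_bound[OF fa s(1) _ _ \<mu>(1)] s a ra by auto
      have "continuous_on {z. z \<notin> E \<and> norm (\<Phi> z) = r} (f \<xi> i)"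
        unfolding f_def using r ra
        by (intro continuous_intros continuous_on_subset[OF holomorphic_on_imp_continuous_on[OF Nh]])
          (auto simp: mem_D a_def)
      moreover have "{z. z \<notin> E \<and> norm (\<Phi> z) = r} = \<Psi> ` sphere 0 r"
      proof (intro equalityI subsetI)
        fix z assume "z \<in> {z. z \<notin> E \<and> norm (\<Phi> z) = r}"
        then show "z \<in> \<Psi> ` sphere 0 r" by (intro image_eqI[of _ _ "\<Phi> z"]) (auto simp: Psi_Phi)
      qed (use r Psi_notin Phi_Psi in auto)
      moreover have "compact (\<Psi> ` sphere 0 r)"
        by (intro compact_continuous_image continuous_at_imp_continuous_on) (use r isCont_Psi in auto)
      ultimately have "bounded (f \<xi> i ` {z. z \<notin> E \<and> norm (\<Phi> z) = r})"
        by (intro compact_imp_bounded compact_continuous_image) auto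
      then obtain B where B: "B > 0" "\<And>z. z \<notin> E \<Longrightarrow> norm (\<Phi> z) = r \<Longrightarrow> norm (f \<xi> i z) \<le> B"
        unfolding bounded_pos by auto
      \<comment> \<open>Beyond the pole the function and its section are bounded separately; the
        fixed bound of the function is absorbed because \<mu> \<ge> 1.\<close>
      have "1 < r / a" using ra a by simp
      then have m1: "1 \<le> \<mu>" using \<mu>(1) by simp
      show ?thesis
      proof (intro exI[of _ "B + C"] conjI allI impI)
        fix n p' z assume sec: "faber_section s n (f \<xi> i) p'" and z: "z \<notin> E \<and> norm (\<Phi> z) = r"
        have "norm (f \<xi> i z - poly p' z) \<le> B + C * \<mu> ^ n"
          by (rule order_trans[OF norm_triangle_ineq4 add_mono]) (use B(2) z C(2)[OF sec, of z] in \<open>auto simp: Dc_def\<close>)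
        moreover have "B * 1 \<le> B * \<mu> ^ n" using B m1 by (intro mult_left_mono one_le_power) auto
        ultimately show "norm (f \<xi> i z - poly p' z) \<le> (B + C) * \<mu> ^ n" by (simp add: algebra_simps)
      qed (use B C in auto)
    qed
    then obtain C where C: "C \<ge> 0" "\<And>n p' z. faber_section s n (f \<xi> i) p' \<Longrightarrow> z \<notin> E \<and> norm (\<Phi> z) = r \<Longrightarrow>
       norm (f \<xi> i z - poly p' z) \<le> C * \<mu> ^ n" by blast
    show ?thesis
    proof (intro exI[of _ "K * C"] conjI allI impI)
      fix n q p' z assume q: "denom n q" and sec: "faber_section s n (f \<xi> i) p'" and z: "z \<notin> E \<and> norm (\<Phi> z) = r"
      have "norm (taylor_coeff q \<xi> i) * norm (f \<xi> i z - poly p' z) \<le> (K * l1_norm M q * (a / R) ^ n) * (C * \<mu> ^ n)"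
        using K C(2)[OF sec z] a R by (intro mult_mono K(2)[OF q]) (auto intro!: mult_nonneg_nonneg l1_norm_nonneg)
      also have "\<dots> = K * C * l1_norm M q * (a / R * \<mu>) ^ n" unfolding power_mult_distrib by (simp only: mult_ac)
      finally show "norm (taylor_coeff q \<xi> i) * norm (f \<xi> i z - poly p' z) \<le> K * C * l1_norm M q * \<nu> ^ n"
        unfolding \<mu>(3) .
    qed (use K C in auto)
  qed
  have "\<forall>\<xi> i. \<exists>C. \<xi> \<in> X \<longrightarrow> C \<ge> 0 \<and> (\<forall>n q p'. denom n q \<longrightarrow> faber_section s n (f \<xi> i) p' \<longrightarrow> (\<forall>z. z \<notin> E \<and> norm (\<Phi> z) = r \<longrightarrow>
      norm (taylor_coeff q \<xi> i) * norm (f \<xi> i z - poly p' z) \<le> C * l1_norm M q * \<nu> ^ n))"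
    using piece by blast
  then obtain C where C: "\<And>\<xi> i. \<xi> \<in> X \<Longrightarrow> C \<xi> i \<ge> 0"
    "\<And>\<xi> i n q p' z. \<xi> \<in> X \<Longrightarrow> denom n q \<Longrightarrow> faber_section s n (f \<xi> i) p' \<Longrightarrow> z \<notin> E \<and> norm (\<Phi> z) = r \<Longrightarrow>
      norm (taylor_coeff q \<xi> i) * norm (f \<xi> i z - poly p' z) \<le> C \<xi> i * l1_norm M q * \<nu> ^ n"
    by metis
  show ?thesis
  proof (intro exI[of _ "\<Sum>\<xi>\<in>X. \<Sum>i\<le>M. C \<xi> i"] conjI allI impI)
    show "0 \<le> (\<Sum>\<xi>\<in>X. \<Sum>i\<le>M. C \<xi> i)" using C(1) by (intro sum_nonneg) auto
    fix n q P z assume n: "1 \<le> n" and pf: "pade_faber E \<Phi> d m F n q P" and z: "z \<notin> E \<and> norm (\<Phi> z) = r"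
    have q: "denom n q" by (rule pade_faber_denom[OF pf n])
    then have dq: "degree q \<le> M" by (simp add: denom_def)
    have dP: "degree (P k \<alpha>) \<le> n - 1" "\<And>j. j \<le> n \<Longrightarrow> cf (\<lambda>z. poly q z * z ^ k * F \<alpha> z) r0 j = cf (poly (P k \<alpha>)) r0 j"
      using pf \<alpha> unfolding pade_faber_iff by blast+
    have "\<exists>p'. faber_section s n (f \<xi> i) p'" for \<xi> i
      unfolding faber_section_def by (rule Faber_section_exists[OF s(1)])
    then obtain S where S: "\<And>\<xi> i. faber_section s n (f \<xi> i) (S \<xi> i)" by metis
    define P' where "P' = (\<Sum>\<xi>\<in>X. \<Sum>i\<le>M. smult (taylor_coeff q \<xi> i) (S \<xi> i))"
    \<comment> \<open>Both polynomials have degree below n and the same coefficients of index below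
      n, so they coincide by triangularity. This identifies the numerator with a combination of
      sections.\<close>
    have "P k \<alpha> = P'"
    proof -
      define \<Delta> where "\<Delta> = P k \<alpha> - P'"
      have c0: "coeff \<Delta> i = 0" if "i \<ge> n" for i
      proof -
        have "coeff P' i = 0" using S that by (simp add: P'_def coeff_sum faber_section_def)
        moreover have "coeff (P k \<alpha>) i = 0" using dP(1) n that by (intro coeff_eq_0) simp
        ultimately show ?thesis by (simp add: \<Delta>_def)
      qed
      have "cf (poly \<Delta>) s j = 0" if j: "j \<le> degree \<Delta>" for j
      proof (cases "j < n")
        case False
        then show ?thesis using cf_poly_high[OF s(1) c0] by simp
      next
        case True
        have "cf (poly (P k \<alpha>)) s j = cf (poly (P k \<alpha>)) r0 j" by (rule cf_poly_radius) (use s r0 in auto)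
        also have "\<dots> = cf (\<lambda>z. poly q z * z ^ k * F \<alpha> z) r0 j" using dP(2) True by simp
        also have "\<dots> = cf (\<lambda>z. poly q z * z ^ k * F \<alpha> z) s j"
          by (rule circle_coeff_Psi_radius[OF qF_holomorphic[OF \<alpha>(1)]]) (use s A r0 in auto)
        also have "\<dots> = cf (\<lambda>z. \<Sum>\<xi>\<in>X. \<Sum>i\<le>M. taylor_coeff q \<xi> i * f \<xi> i z) s j"
        proof (rule circle_coeff_cong)
          fix w :: complex assume w: "norm w = s"
          have wX: "\<Psi> w \<notin> X" using w s A(4)[of "\<Psi> w"] Phi_Psi[of w] by auto
          have wD: "\<Psi> w \<in> D A" using w s by (simp add: mem_D Phi_Psi)
          have "(\<lambda>z. qs z * F \<alpha> z) holomorphic_on D \<rho>0" unfolding qs_def by (intro holomorphic_intros F_holomorphic \<alpha>)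
          then have "hext A (\<lambda>z. qs z * F \<alpha> z) (\<lambda>z. qs z * F \<alpha> z)" by (intro hext_mono[OF hext_self A(3)] rho0)
          from hext_unique[OF this hN A(1,2) wD] have "qs (\<Psi> w) * F \<alpha> (\<Psi> w) = N (\<Psi> w)" .
          then have "F \<alpha> (\<Psi> w) = N (\<Psi> w) / qs (\<Psi> w)" using qs0[OF wX] by (simp add: field_simps)
          then show "poly q (\<Psi> w) * \<Psi> w ^ k * F \<alpha> (\<Psi> w) = (\<Sum>\<xi>\<in>X. \<Sum>i\<le>M. taylor_coeff q \<xi> i * f \<xi> i (\<Psi> w))"
            using expand[OF wX dq] by simp
        qed (use s in auto)
        also have "\<dots> = (\<Sum>\<xi>\<in>X. cf (\<lambda>z. \<Sum>i\<le>M. taylor_coeff q \<xi> i * f \<xi> i z) s j)"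
          by (rule cf_sum[OF _ s]) (intro holomorphic_on_sum holomorphic_on_mult[OF holomorphic_on_const] fA, use A in \<open>auto intro: less_imp_le\<close>)
        also have "\<dots> = (\<Sum>\<xi>\<in>X. \<Sum>i\<le>M. cf (\<lambda>z. taylor_coeff q \<xi> i * f \<xi> i z) s j)"
          by (intro sum.cong refl cf_sum[OF _ s] holomorphic_on_mult[OF holomorphic_on_const] fA) (use A in \<open>auto intro: less_imp_le\<close>)
        also have "\<dots> = (\<Sum>\<xi>\<in>X. \<Sum>i\<le>M. taylor_coeff q \<xi> i * cf (f \<xi> i) s j)"
          by (intro sum.cong refl cf_cmult[OF _ s] fA) (use A in \<open>auto intro: less_imp_le\<close>)
        also have "\<dots> = (\<Sum>\<xi>\<in>X. \<Sum>i\<le>M. taylor_coeff q \<xi> i * cf (poly (S \<xi> i)) s j)"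
          using S True by (simp add: faber_section_def)
        also have "\<dots> = (\<Sum>\<xi>\<in>X. \<Sum>i\<le>M. cf (\<lambda>z. taylor_coeff q \<xi> i * poly (S \<xi> i) z) s j)"
          by (intro sum.cong refl cf_cmult[OF holomorphic_poly_D s, symmetric])
        also have "\<dots> = (\<Sum>\<xi>\<in>X. cf (\<lambda>z. \<Sum>i\<le>M. taylor_coeff q \<xi> i * poly (S \<xi> i) z) s j)"
          by (intro sum.cong refl cf_sum[OF _ s, symmetric] holomorphic_on_mult[OF holomorphic_on_const] holomorphic_poly_D)
        also have "\<dots> = cf (\<lambda>z. \<Sum>\<xi>\<in>X. \<Sum>i\<le>M. taylor_coeff q \<xi> i * poly (S \<xi> i) z) s j"
          by (rule cf_sum[OF _ s, symmetric]) (intro holomorphic_on_sum holomorphic_on_mult[OF holomorphic_on_const] holomorphic_poly_D)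
        also have "\<dots> = cf (poly P') s j" by (simp add: P'_def poly_sum)
        finally have "cf (poly (P k \<alpha>)) s j = cf (poly P') s j" .
        moreover have "cf (\<lambda>z. poly (P k \<alpha>) z - poly P' z) s j = cf (poly (P k \<alpha>)) s j - cf (poly P') s j"
          by (rule cf_diff[OF holomorphic_poly_D holomorphic_poly_D s])
        ultimately show ?thesis by (simp add: \<Delta>_def)
      qed
      then have "\<Delta> = 0" by (rule cf_poly_eq_0[OF s(1)])
      then show ?thesis by (simp add: \<Delta>_def)
    qed
    then have Pz: "poly (P k \<alpha>) z = (\<Sum>\<xi>\<in>X. \<Sum>i\<le>M. taylor_coeff q \<xi> i * poly (S \<xi> i) z)"
      by (simp add: P'_def poly_sum)
    have "z \<notin> X" using z r(3) by auto
    then have "poly q z * z ^ k * (N z / qs z) - poly (P k \<alpha>) z =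
        (\<Sum>\<xi>\<in>X. \<Sum>i\<le>M. taylor_coeff q \<xi> i * (f \<xi> i z - poly (S \<xi> i) z))"
      unfolding expand[OF \<open>z \<notin> X\<close> dq] Pz by (simp only: sum_subtractf[symmetric] right_diff_distrib)
    also have "norm \<dots> \<le> (\<Sum>\<xi>\<in>X. \<Sum>i\<le>M. norm (taylor_coeff q \<xi> i) * norm (f \<xi> i z - poly (S \<xi> i) z))"
      by (intro order_trans[OF norm_sum] sum_mono) (simp add: norm_mult)
    also have "\<dots> \<le> (\<Sum>\<xi>\<in>X. \<Sum>i\<le>M. C \<xi> i * l1_norm M q * \<nu> ^ n)"
      by (intro sum_mono C(2)[OF _ q S z])
    also have "\<dots> = (\<Sum>\<xi>\<in>X. \<Sum>i\<le>M. C \<xi> i) * l1_norm M q * \<nu> ^ n" by (simp add: sum_distrib_right)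
    finally show "norm (poly q z * z ^ k * (N z / (\<Prod>\<xi>\<in>X. (z - \<xi>) ^ \<sigma> \<xi>)) - poly (P k \<alpha>) z) \<le>
       (\<Sum>\<xi>\<in>X. \<Sum>i\<le>M. C \<xi> i) * l1_norm M q * \<nu> ^ n" by (simp only: qs_def)
  qed
qed

end

section \<open>Rates as limits superior of n-th roots\<close>

lemma limsup_root_le:
  fixes x :: "nat \<Rightarrow> real"
  assumes "\<And>n. n0 \<le> n \<Longrightarrow> 0 \<le> x n \<and> x n \<le> C * y ^ n" and y: "0 < y"
  shows "limsup (\<lambda>n. ereal (x n powr (1 / real n))) \<le> ereal y"
proof -
  \<comment> \<open>Ensures a positive base, whose n-th root tends to 1.\<close>
  define B where "B = max C 1"
  have "(\<lambda>n. B powr (1 / real n) * y) \<longlonglongrightarrow> B powr 0 * y"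
    by (intro tendsto_intros lim_1_over_n) (auto simp: B_def)
  moreover have "B \<noteq> 0" by (simp add: B_def)
  ultimately have lim: "(\<lambda>n. ereal (B powr (1 / real n) * y)) \<longlonglongrightarrow> ereal y" by simp
  have "\<forall>\<^sub>F n in sequentially. ereal (x n powr (1 / real n)) \<le> ereal (B powr (1 / real n) * y)"
    using eventually_ge_at_top[of "max n0 1"]
  proof eventually_elim
    case (elim n)
    then have n: "n0 \<le> n" "1 \<le> n" by auto
    have "x n \<le> B * y ^ n"
    proof -
      have "C * y ^ n \<le> B * y ^ n" using y by (intro mult_right_mono) (auto simp: B_def)
      then show ?thesis using assms(1)[OF n(1)] by linarith
    qed
    then have "x n powr (1 / real n) \<le> (B * y ^ n) powr (1 / real n)"
      using assms(1)[OF n(1)] by (intro powr_mono2) auto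
    also have "\<dots> = B powr (1 / real n) * (y ^ n) powr (1 / real n)"
      by (rule powr_mult)
    also have "(y ^ n) powr (1 / real n) = y"
      using y n by (simp add: powr_realpow[symmetric] powr_powr)
    finally show ?case by simp
  qed
  then have "limsup (\<lambda>n. ereal (x n powr (1 / real n))) \<le> limsup (\<lambda>n. ereal (B powr (1 / real n) * y))"
    by (rule Limsup_mono)
  also have "\<dots> = ereal y" by (rule lim_imp_Limsup[OF _ lim]) simp
  finally show ?thesis .
qed

lemma limsup_root_less:
  fixes x :: "nat \<Rightarrow> real"
  assumes "limsup (\<lambda>n. ereal (x n powr (1 / real n))) < ereal \<theta>" and x: "\<And>n. 0 \<le> x n"
  shows "\<exists>n0. \<forall>n\<ge>n0. x n \<le> \<theta> ^ n"
proof -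
  have "\<forall>\<^sub>F n in sequentially. ereal (x n powr (1 / real n)) < ereal \<theta>"
    by (rule Limsup_lessD[OF assms(1)])
  then have "\<forall>\<^sub>F n in sequentially. x n \<le> \<theta> ^ n"
    using eventually_ge_at_top[of 1]
  proof eventually_elim
    case (elim n)
    have "x n = (x n powr (1 / real n)) ^ n"
    proof (cases "x n = 0")
      case False
      then have "0 < x n" using x[of n] by simp
      then show ?thesis using elim(2) by (simp add: powr_realpow[symmetric] powr_powr)
    qed (use elim in simp)
    also have "\<dots> \<le> \<theta> ^ n" using elim(1) by (intro power_mono) auto
    finally show ?case .
  qed
  then show ?thesis by (simp add: eventually_sequentially)
qed

lemma poly_le_l1_norm:
  assumes "degree p \<le> n" "norm z \<le> B" "1 \<le> B"
  shows "norm (poly p z) \<le> l1_norm n p * B ^ n"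
proof -
  have "poly p z = (\<Sum>i\<le>n. coeff p i * z ^ i)"
    unfolding poly_altdef using assms(1) by (intro sum.mono_neutral_left) (auto simp: coeff_eq_0)
  also have "norm \<dots> \<le> (\<Sum>i\<le>n. norm (coeff p i) * B ^ n)"
  proof (rule order_trans[OF norm_sum sum_mono])
    fix i assume "i \<in> {..n}"
    then have "norm z ^ i \<le> B ^ n"
      using assms by (intro order_trans[OF power_mono[OF assms(2)] power_increasing]) auto
    then show "norm (coeff p i * z ^ i) \<le> norm (coeff p i) * B ^ n"
      by (simp add: norm_mult norm_power mult_left_mono)
  qed
  finally show ?thesis by (simp add: l1_norm_def sum_distrib_right)
qed

lemma l1_norm_le_coeff_norm: "l1_norm n p \<le> (real n + 1) * coeff_norm p"
proof -
  have "l1_norm n p \<le> (\<Sum>i\<le>n. coeff_norm p)" unfolding l1_norm_def by (intro sum_mono norm_coeff_le_coeff_norm)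
  then show ?thesis by (simp add: algebra_simps)
qed

lemma coeff_norm_nonneg: "0 \<le> coeff_norm p"
  using norm_coeff_le_coeff_norm[of p 0] norm_ge_zero order_trans by blast

context faber_system
begin

text \<open>The error itself has poles inside the level curve, so the maximum principle is applied
  after multiplication by \<open>qs\<close>, which is bounded on \<open>Dc r\<close> and bounded
  away from 0 on K.\<close>

lemma approximant_error_on_compact:
  assumes \<alpha>: "\<alpha> \<in> {1..d}" "k < m \<alpha>" and R: "1 < R"
    and \<sigma>: "\<And>\<xi>. \<xi> \<in> X \<Longrightarrow> 0 < \<sigma> \<xi> \<Longrightarrow> norm (\<Phi> \<xi>) < R \<and> ereal R < \<rho>b \<xi> (\<sigma> \<xi>)"
    and N: "hext R (\<lambda>z. (\<Prod>\<xi>\<in>X. (z - \<xi>) ^ \<sigma> \<xi>) * F \<alpha> z) N"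
    and r: "1 < r" "r < R" "\<And>\<xi>. \<xi> \<in> X \<Longrightarrow> norm (\<Phi> \<xi>) \<noteq> r" and \<nu>: "r / R < \<nu>"
    and K: "compact K" "K \<subseteq> D r" "K \<inter> X = {}"
  shows "\<exists>C\<ge>0. \<forall>n\<ge>1. \<forall>q P. pade_faber E \<Phi> d m F n q P \<longrightarrow> (\<forall>z\<in>K.
     norm (poly q z * z ^ k * (N z / (\<Prod>\<xi>\<in>X. (z - \<xi>) ^ \<sigma> \<xi>)) - poly (P k \<alpha>) z) \<le> C * l1_norm M q * \<nu> ^ n)"
proof -
  define qs where "qs = (\<lambda>z. \<Prod>\<xi>\<in>X. (z - \<xi>) ^ \<sigma> \<xi>)"
  have qs0: "qs z \<noteq> 0" if "z \<notin> X" for z unfolding qs_def using that finite_poles by (subst prod_zero_iff) auto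
  have cq: "continuous_on S qs" for S unfolding qs_def by (intro continuous_intros)
  obtain C where C: "C \<ge> 0" "\<And>n q P z. 1 \<le> n \<Longrightarrow> pade_faber E \<Phi> d m F n q P \<Longrightarrow> z \<notin> E \<and> norm (\<Phi> z) = r \<Longrightarrow>
      norm (poly q z * z ^ k * (N z / qs z) - poly (P k \<alpha>) z) \<le> C * l1_norm M q * \<nu> ^ n"
    using approximant_error_on_level[OF \<alpha> R \<sigma> N r \<nu>] unfolding qs_def by blast
  have "bounded (qs ` Dc r)" by (intro compact_imp_bounded compact_continuous_image cq compact_Dc)
  then obtain B where B: "B > 0" "\<And>z. z \<in> Dc r \<Longrightarrow> norm (qs z) \<le> B" unfolding bounded_pos by auto
  have "\<exists>c>0. \<forall>z\<in>K. c \<le> norm (qs z)"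
  proof (cases "K = {}")
    case False
    obtain z0 where "z0 \<in> K" "\<And>z. z \<in> K \<Longrightarrow> norm (qs z0) \<le> norm (qs z)"
      using continuous_attains_inf[OF K(1) False continuous_on_norm[OF cq]] by blast
    then show ?thesis using qs0[of z0] K(3) by (intro exI[of _ "norm (qs z0)"]) auto
  qed (auto intro: exI[of _ 1])
  then obtain c where c: "c > 0" "\<And>z. z \<in> K \<Longrightarrow> c \<le> norm (qs z)" by blast
  show ?thesis
  proof (intro exI[of _ "B * C / c"] conjI allI impI ballI)
    fix n q P z assume n: "1 \<le> n" and pf: "pade_faber E \<Phi> d m F n q P" and z: "z \<in> K"
    define T where "T = C * l1_norm M q * \<nu> ^ n"
    define H where "H = (\<lambda>z. poly q z * z ^ k * N z - qs z * poly (P k \<alpha>) z)"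
    have H: "H holomorphic_on D R" unfolding H_def qs_def
      by (intro holomorphic_intros holomorphic_poly_D hext_holomorphic[OF N])
    have Hq: "H w = qs w * (poly q w * w ^ k * (N w / qs w) - poly (P k \<alpha>) w)" if "w \<notin> X" for w
      using qs0[OF that] by (simp add: H_def field_simps)
    have "norm (H z) \<le> B * T"
    proof (rule maximum_modulus_frontier[of H "D r"])
      show "H holomorphic_on interior (D r)"
        using holomorphic_on_subset[OF H, of "interior (D r)"] interior_subset[of "D r"] D_mono[of r R] r by auto
      have "closure (D r) \<subseteq> D R" using closure_D_subset Dc_subset_D[OF r(2)] by blast
      then show "continuous_on (closure (D r)) H" using H holomorphic_on_imp_continuous_on continuous_on_subset by blast
      show "bounded (D r)" using bounded_Dc D_subset_Dc bounded_subset by blast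
      show "z \<in> D r" using z K by auto
      fix w assume "w \<in> frontier (D r)"
      then have w: "w \<notin> E \<and> norm (\<Phi> w) = r" using frontier_D_subset[OF r(1)] by auto
      then have "w \<notin> X" using r(3) by auto
      have "norm (H w) = norm (qs w) * norm (poly q w * w ^ k * (N w / qs w) - poly (P k \<alpha>) w)"
        unfolding Hq[OF \<open>w \<notin> X\<close>] norm_mult ..
      also have "\<dots> \<le> B * T"
        unfolding T_def using w B C(2)[OF n pf w] by (intro mult_mono) (auto simp: Dc_def)
      finally show "norm (H w) \<le> B * T" .
    qed
    have "z \<notin> X" using z K(3) by auto
    from \<open>norm (H z) \<le> B * T\<close> have *: "norm (qs z) * norm (poly q z * z ^ k * (N z / qs z) - poly (P k \<alpha>) z) \<le> B * T"
      unfolding Hq[OF \<open>z \<notin> X\<close>] norm_mult .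
    have "c * norm (poly q z * z ^ k * (N z / qs z) - poly (P k \<alpha>) z) \<le>
        norm (qs z) * norm (poly q z * z ^ k * (N z / qs z) - poly (P k \<alpha>) z)"
      by (intro mult_right_mono c z) auto
    then have "c * norm (poly q z * z ^ k * (N z / qs z) - poly (P k \<alpha>) z) \<le> B * T" using * by linarith
    then have "norm (poly q z * z ^ k * (N z / qs z) - poly (P k \<alpha>) z) \<le> B * T / c"
      using c(1) by (simp add: pos_le_divide_eq mult.commute)
    then show "norm (poly q z * z ^ k * (N z / (\<Prod>\<xi>\<in>X. (z - \<xi>) ^ \<sigma> \<xi>)) - poly (P k \<alpha>) z) \<le> B * C / c * l1_norm M q * \<nu> ^ n"
      by (simp add: T_def qs_def mult_ac)
  qed (use B C c in auto)
qed

text \<open>Near each point the glued extension coincides with one of the extensions that define the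
  supremum, so the restrictions on the poles pass to the maximal domain.\<close>

lemma rho_comp_facts:
  assumes \<alpha>: "\<alpha> \<in> {1..d}"
  defines "\<rho> \<equiv> rho_comp E \<Phi> d m F \<alpha>"
  defines "f \<equiv> mero_ext E (canonical_domain E \<Phi> \<rho>) (F \<alpha>)"
  shows "1 < \<rho>" "is_mero_ext E (canonical_domain E \<Phi> \<rho>) (F \<alpha>) f"
    "\<And>z. z \<in> poles_in f (canonical_domain E \<Phi> \<rho>) \<Longrightarrow> z \<in> X \<and> 1 \<le> pole_order f z \<and> pole_order f z \<le> \<tau> z"
proof -
  let ?C = "canonical_domain E \<Phi>"
  define ok where "ok = (\<lambda>\<rho> g. is_mero_ext E (?C \<rho>) (F \<alpha>) g \<and>
     (\<forall>z\<in>poles_in g (?C \<rho>). z \<in> X \<and> pole_order g z \<le> \<tau> z))"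
  define S where "S = {\<rho>. 1 < \<rho> \<and> (\<exists>g. ok \<rho> g)}"
  have \<rho>: "\<rho> = Sup S" by (simp add: \<rho>_def rho_comp_def S_def ok_def)
  have "hext \<rho>0 (F \<alpha>) (F \<alpha>)" by (rule hext_self[OF F_holomorphic[OF \<alpha>] rho0])
  from hext_imp_is_mero_ext[OF this rho0] have "ok (ereal \<rho>0) (F \<alpha>)" by (simp add: ok_def)
  then have \<rho>0S: "ereal \<rho>0 \<in> S" using rho0 by (auto simp: S_def)
  then show "1 < \<rho>" unfolding \<rho> using rho0 by (intro less_le_trans[OF _ Sup_upper[OF \<rho>0S]]) simp
  define h where "h = (\<lambda>\<rho>. SOME g. ok \<rho> g)"
  have h: "1 < \<rho> \<and> ok \<rho> (h \<rho>)" if "\<rho> \<in> S" for \<rho>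
    using someI_ex[of "ok \<rho>"] that by (simp add: S_def h_def)
  have f: "is_mero_ext E (?C \<rho>) (F \<alpha>) f" "\<And>s z. s \<in> S \<Longrightarrow> z \<in> ?C s \<Longrightarrow> f z = h s z"
    using mero_ext_Sup[of S "F \<alpha>" h] \<rho>0S h unfolding f_def \<rho> ok_def by blast+
  show "is_mero_ext E (?C \<rho>) (F \<alpha>) f" by (rule f(1))
  fix z assume z: "z \<in> poles_in f (?C \<rho>)"
  then have "z \<in> ?C (Sup S)" by (simp add: poles_in_def \<rho>)
  then obtain s where s: "s \<in> S" "z \<in> ?C s" using canonical_domain_Sup[of S] \<rho>0S by blast
  have "open (?C s)" using h[OF s(1)] by (intro open_canonical_domain) simp
  then have ev: "\<forall>\<^sub>F w in at z. f w = h s w"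
    using eventually_at_in_open'[of "?C s" z] s by (auto elim!: eventually_mono intro: f(2))
  have "is_pole (h s) z" using is_pole_cong[OF ev refl] z by (simp add: poles_in_def)
  then have zh: "z \<in> poles_in (h s) (?C s)" using s by (simp add: poles_in_def)
  have ord: "pole_order f z = pole_order (h s) z" using zorder_cong[OF ev refl] by (simp add: pole_order_def)
  have "0 < pole_order f z"
    using pole_order_pos[of f "?C \<rho>" z] f(1) z by (simp add: is_mero_ext_def poles_in_def)
  then show "z \<in> X \<and> 1 \<le> pole_order f z \<and> pole_order f z \<le> \<tau> z"
    using h[OF s(1)] zh ord unfolding ok_def by auto
qed

text \<open>Strictness survives because the infimum over a finite set is attained; for the empty set
  it is \<infinity>, which is why x < \<infinity> is required.\<close>

lemma less_INF_finite:
  fixes g :: "'b \<Rightarrow> ereal"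
  assumes "finite A" "x < \<infinity>" shows "(\<And>i. i \<in> A \<Longrightarrow> x < g i) \<Longrightarrow> x < (INF i\<in>A. g i)"
  using assms(1) by (induction A rule: finite_induct) (use assms(2) in \<open>auto simp: top_ereal_def inf_min\<close>)

lemma rho_star_facts:
  assumes \<alpha>: "\<alpha> \<in> {1..d}"
  defines "\<rho> \<equiv> rho_comp E \<Phi> d m F \<alpha>"
  defines "f \<equiv> mero_ext E (canonical_domain E \<Phi> \<rho>) (F \<alpha>)"
  shows "1 < rho_star E \<Phi> d m F \<alpha>" "rho_star E \<Phi> d m F \<alpha> \<le> \<rho>"
    "\<And>\<xi>. \<xi> \<in> poles_in f (canonical_domain E \<Phi> \<rho>) \<Longrightarrow> rho_star E \<Phi> d m F \<alpha> \<le> \<rho>b \<xi> (pole_order f \<xi>)"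
proof -
  let ?Y = "poles_in f (canonical_domain E \<Phi> \<rho>)"
  have star: "rho_star E \<Phi> d m F \<alpha> = min \<rho> (INF \<xi>\<in>?Y. \<rho>b \<xi> (pole_order f \<xi>))"
    by (simp add: rho_star_def \<rho>_def f_def Let_def)
  show "rho_star E \<Phi> d m F \<alpha> \<le> \<rho>" unfolding star by simp
  show "\<And>\<xi>. \<xi> \<in> ?Y \<Longrightarrow> rho_star E \<Phi> d m F \<alpha> \<le> \<rho>b \<xi> (pole_order f \<xi>)"
    unfolding star by (rule min.coboundedI2) (rule INF_lower)
  have Y: "\<xi> \<in> X \<and> 1 \<le> pole_order f \<xi> \<and> pole_order f \<xi> \<le> \<tau> \<xi>" if "\<xi> \<in> ?Y" for \<xi>
    using rho_comp_facts(3)[OF \<alpha>] that unfolding \<rho>_def f_def by blast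
  have "finite ?Y" by (rule finite_subset[OF _ finite_poles]) (use Y in blast)
  moreover have "1 < \<rho>b \<xi> (pole_order f \<xi>)" if "\<xi> \<in> ?Y" for \<xi>
  proof (rule less_trans)
    show "1 < ereal (norm (\<Phi> \<xi>))" using norm_Phi[OF system_pole(1)] Y[OF that] by (simp add: one_ereal_def)
    show "ereal (norm (\<Phi> \<xi>)) < \<rho>b \<xi> (pole_order f \<xi>)" using bold_rho_gt Y[OF that] by blast
  qed
  ultimately have "1 < (INF \<xi>\<in>?Y. \<rho>b \<xi> (pole_order f \<xi>))" by (intro less_INF_finite) auto
  then show "1 < rho_star E \<Phi> d m F \<alpha>" unfolding star using rho_comp_facts(1)[OF \<alpha>] by (simp add: \<rho>_def)
qed

lemma Phi_norm_facts:
  assumes "K \<subseteq> D s" "1 < s"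
  shows "1 \<le> Phi_norm E \<Phi> K" "Phi_norm E \<Phi> K \<le> s" "Phi_norm E \<Phi> K < r \<Longrightarrow> K \<subseteq> D r"
proof -
  have b: "norm (\<Phi> z) < s" if "z \<in> K - E" for z using that assms by (auto simp: mem_D)
  have "1 \<le> Phi_norm E \<Phi> K \<and> Phi_norm E \<Phi> K \<le> s \<and> (\<forall>z\<in>K - E. norm (\<Phi> z) \<le> Phi_norm E \<Phi> K)"
  proof (cases "K \<subseteq> E")
    case True
    then show ?thesis using assms by (auto simp: Phi_norm_def)
  next
    case False
    define S where "S = insert 0 ((\<lambda>z. norm (\<Phi> z)) ` (K - E))"
    have P: "Phi_norm E \<Phi> K = Sup S" using False by (simp add: Phi_norm_def sup_norm_def S_def)
    have S: "bdd_above S" "\<And>x. x \<in> S \<Longrightarrow> x \<le> s"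
      unfolding S_def using b assms by (auto intro!: bdd_aboveI[of _ s] dest: b intro: less_imp_le)
    have up: "norm (\<Phi> z) \<le> Sup S" if "z \<in> K - E" for z
      using that by (intro cSup_upper S) (auto simp: S_def)
    obtain z where "z \<in> K - E" using False by auto
    then have "1 \<le> Sup S" using up[of z] norm_Phi[of z] by simp
    moreover have "Sup S \<le> s" by (rule cSup_least) (use S in \<open>auto simp: S_def\<close>)
    ultimately show ?thesis using up unfolding P by blast
  qed
  then have *: "1 \<le> Phi_norm E \<Phi> K" "Phi_norm E \<Phi> K \<le> s" "\<And>z. z \<in> K - E \<Longrightarrow> norm (\<Phi> z) \<le> Phi_norm E \<Phi> K"
    by auto
  show "1 \<le> Phi_norm E \<Phi> K" "Phi_norm E \<Phi> K \<le> s" by (rule *)+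
  assume r: "Phi_norm E \<Phi> K < r"
  have "norm (\<Phi> z) < r" if "z \<in> K" "z \<notin> E" for z using *(3)[of z] r that by simp
  show "K \<subseteq> D r"
  proof
    fix z assume "z \<in> K"
    then show "z \<in> D r" using \<open>\<And>z. z \<in> K \<Longrightarrow> z \<notin> E \<Longrightarrow> norm (\<Phi> z) < r\<close>[of z]
      by (cases "z \<in> E") (simp_all add: mem_D)
  qed
qed

text \<open>For any y strictly between the two sides of the claim there are r and R with r / R < y
  and K inside \<open>D r\<close>; the error bound on K, divided by the denominators, then gives a
  limit superior of at most y.\<close>

lemma approximant_limsup_le:
  assumes \<alpha>: "\<alpha> \<in> {1..d}" "k < m \<alpha>" and K: "compact K" "K \<subseteq> D_star E \<Phi> d m F \<alpha> - X"
    and QP: "\<And>n. 1 \<le> n \<Longrightarrow> pade_faber E \<Phi> d m F n (Q n) (P n)"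
  shows "limsup (\<lambda>n. ereal (sup_norm K
                (\<lambda>z. poly (P n k \<alpha>) z / poly (Q n) z
                       - z ^ k * mero_ext E (D_star E \<Phi> d m F \<alpha>) (F \<alpha>) z) powr (1 / real n)))
              \<le> ereal (Phi_norm E \<Phi> K) / rho_star E \<Phi> d m F \<alpha>"
proof (rule ccontr)
  assume neg: "\<not> ?thesis"
  let ?C = "canonical_domain E \<Phi>"
  define \<rho> where "\<rho> = rho_comp E \<Phi> d m F \<alpha>"
  define \<rho>s where "\<rho>s = rho_star E \<Phi> d m F \<alpha>"
  define f where "f = mero_ext E (?C \<rho>) (F \<alpha>)"
  define g where "g = mero_ext E (D_star E \<Phi> d m F \<alpha>) (F \<alpha>)"
  define p where "p = Phi_norm E \<Phi> K"
  define x where "x = (\<lambda>n. sup_norm K (\<lambda>z. poly (P n k \<alpha>) z / poly (Q n) z - z ^ k * g z))"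
  have star: "1 < \<rho>s" "\<rho>s \<le> \<rho>" "\<And>\<xi>. \<xi> \<in> poles_in f (?C \<rho>) \<Longrightarrow> \<rho>s \<le> \<rho>b \<xi> (pole_order f \<xi>)"
    using rho_star_facts[OF \<alpha>(1)] unfolding \<rho>s_def \<rho>_def f_def by auto
  have f: "is_mero_ext E (?C \<rho>) (F \<alpha>) f"
    "\<And>z. z \<in> poles_in f (?C \<rho>) \<Longrightarrow> z \<in> X \<and> 1 \<le> pole_order f z \<and> pole_order f z \<le> \<tau> z"
    using rho_comp_facts(2,3)[OF \<alpha>(1)] unfolding \<rho>_def f_def by auto
  have Ds: "D_star E \<Phi> d m F \<alpha> = ?C \<rho>s" by (simp add: D_star_def \<rho>s_def)
  have sub: "?C \<rho>s \<subseteq> ?C \<rho>" by (rule canonical_domain_mono[OF star(2)])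
  have "is_mero_ext E (?C \<rho>s) (F \<alpha>) f" by (rule is_mero_ext_mono[OF f(1) sub])
  then have "is_mero_ext E (?C \<rho>s) (F \<alpha>) g"
    unfolding g_def Ds mero_ext_def by (rule someI[of "is_mero_ext E (?C \<rho>s) (F \<alpha>)"])
  \<comment> \<open>The choices made by \<open>mero_ext\<close> on \<open>D_star\<close> and on the
    larger domain of F_\<alpha> are separate; uniqueness of the extension identifies them.\<close>
  then have gf: "g z = f z" if "z \<in> ?C \<rho>s" for z
    by (rule is_mero_ext_unique[OF _ f(1) star(1)]) (use sub that in auto)
  obtain s where s: "1 < s" "ereal s < \<rho>s" "K \<subseteq> D s"
    using compact_subset_D[OF K(1) _ star(1)] K(2) Ds by blast
  note pn = Phi_norm_facts[OF s(3,1), folded p_def]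
  have ps: "ereal p < \<rho>s" using pn(2) s(2) by (meson ereal_less_eq(3) le_less_trans)
  have "ereal p / \<rho>s < limsup (\<lambda>n. ereal (x n powr (1 / real n)))"
    using neg unfolding x_def g_def p_def \<rho>s_def by simp
  then obtain y where y: "ereal p / \<rho>s < ereal y" "ereal y < limsup (\<lambda>n. ereal (x n powr (1 / real n)))"
    using ereal_dense2 by blast
  \<comment> \<open>The intermediate y' makes the inequality p / R < y strict.\<close>
  obtain y' where y': "ereal p / \<rho>s < ereal y'" "ereal y' < ereal y" using ereal_dense2[OF y(1)] by blast
  obtain R where R: "p < R" "ereal R < \<rho>s" "p / R \<le> y'"
    using ratio_less_obtain[OF _ ps y'(1)] pn(1) by auto
  have R1: "1 < R" using R pn by simp
  have y0: "0 < y" "p < y * R"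
  proof -
    have "p / R < y" using R(3) y'(2) by simp
    then show "p < y * R" using R1 by (simp add: pos_divide_less_eq)
    then show "0 < y" using R1 pn(1) by (smt (verit) mult_nonpos_nonneg)
  qed
  \<comment> \<open>Only finitely many levels carry system poles, so r can be chosen in the interval
    to avoid them.\<close>
  have "infinite {p<..<min R (y * R)}" using R y0 by (intro infinite_Ioo) auto
  then have "infinite ({p<..<min R (y * R)} - (\<lambda>\<xi>. norm (\<Phi> \<xi>)) ` X)"
    using finite_poles by (intro Diff_infinite_finite) auto
  from infinite_imp_nonempty[OF this]
  obtain r where "r \<in> {p<..<min R (y * R)} - (\<lambda>\<xi>. norm (\<Phi> \<xi>)) ` X" by blast
  then have r: "p < r" "r < R" "r < y * R" "r \<notin> (\<lambda>\<xi>. norm (\<Phi> \<xi>)) ` X" by auto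
  have r1: "1 < r" "r / R < y" "\<And>\<xi>. \<xi> \<in> X \<Longrightarrow> norm (\<Phi> \<xi>) \<noteq> r"
    using r pn(1) R1 by (auto simp: pos_divide_less_eq)
  have DR: "D R \<subseteq> ?C \<rho>s" using R by (intro canonical_domain_mono) simp
  have DR': "D R \<subseteq> ?C \<rho>" using DR sub by blast
  define Y where "Y = poles_in f (D R)"
  have YC: "Y \<subseteq> poles_in f (?C \<rho>)" using DR' by (auto simp: Y_def poles_in_def)
  have YX: "Y \<subseteq> X" using YC f(2) by blast
  have fY: "finite Y" by (rule finite_subset[OF YX finite_poles])
  \<comment> \<open>Pole orders of F_\<alpha> within \<open>D R\<close>, extended by 0 to the
    remaining system poles, so that all products run over the same set.\<close>
  define \<sigma> where "\<sigma> = (\<lambda>\<xi>. if \<xi> \<in> Y then pole_order f \<xi> else 0)"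
  have \<sigma>: "norm (\<Phi> \<xi>) < R \<and> ereal R < \<rho>b \<xi> (\<sigma> \<xi>)" if "\<xi> \<in> X" "0 < \<sigma> \<xi>" for \<xi>
  proof -
    have \<xi>: "\<xi> \<in> Y" using that by (simp add: \<sigma>_def split: if_splits)
    then have "\<xi> \<in> D R" by (simp add: Y_def poles_in_def)
    then have "norm (\<Phi> \<xi>) < R" using system_pole(1)[OF that(1)] by (simp add: mem_D)
    moreover have "\<rho>s \<le> \<rho>b \<xi> (\<sigma> \<xi>)" using star(3)[of \<xi>] \<xi> YC by (auto simp: \<sigma>_def)
    ultimately show ?thesis using less_le_trans[OF R(2)] by blast
  qed
  have prod: "(\<Prod>\<xi>\<in>X. (z - \<xi>) ^ \<sigma> \<xi>) = (\<Prod>\<xi>\<in>Y. (z - \<xi>) ^ pole_order f \<xi>)" for z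
    using YX finite_poles by (intro prod.mono_neutral_cong_right) (auto simp: \<sigma>_def)
  have nm: "f nicely_meromorphic_on D R"
    using f(1) DR' nicely_meromorphic_on_subset by (auto simp: is_mero_ext_def)
  obtain N where hol: "N holomorphic_on D R"
    and N0: "\<And>z. z \<in> D R - poles_in f (D R) \<Longrightarrow> N z = (\<Prod>\<xi>\<in>poles_in f (D R). (z - \<xi>) ^ pole_order f \<xi>) * f z"
    using nicely_meromorphic_numerator[OF nm open_D[OF R1] fY[unfolded Y_def]] by metis
  have N: "N holomorphic_on D R"
    "\<And>z. z \<in> D R - Y \<Longrightarrow> N z = (\<Prod>\<xi>\<in>X. (z - \<xi>) ^ \<sigma> \<xi>) * f z"
    using hol N0 by (simp_all only: prod Y_def)
  obtain U where U: "open U" "E \<subseteq> U" "\<forall>z\<in>U. f z = F \<alpha> z" using f(1) by (auto simp: is_mero_ext_def)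
  have hN: "hext R (\<lambda>z. (\<Prod>\<xi>\<in>X. (z - \<xi>) ^ \<sigma> \<xi>) * F \<alpha> z) N" unfolding hext_def
  proof (intro conjI N(1) exI[of _ "U \<inter> D R - Y"])
    show "open (U \<inter> D R - Y)" using U open_D[OF R1] fY by (intro open_Diff finite_imp_closed) auto
    show "E \<subseteq> U \<inter> D R - Y" using U YX system_pole(1) by (auto simp: mem_D)
    show "\<forall>z\<in>U \<inter> D R - Y. N z = (\<Prod>\<xi>\<in>X. (z - \<xi>) ^ \<sigma> \<xi>) * F \<alpha> z" using N(2) U(3) by auto
  qed
  have KD: "K \<subseteq> D r" by (rule pn(3)[OF r(1)])
  have KX: "K \<inter> X = {}" using K(2) by blast
  obtain C where C: "C \<ge> 0" "\<And>n q P z. 1 \<le> n \<Longrightarrow> pade_faber E \<Phi> d m F n q P \<Longrightarrow> z \<in> K \<Longrightarrow>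
     norm (poly q z * z ^ k * (N z / (\<Prod>\<xi>\<in>X. (z - \<xi>) ^ \<sigma> \<xi>)) - poly (P k \<alpha>) z) \<le> C * l1_norm M q * y ^ n"
    using approximant_error_on_compact[OF \<alpha> R1 \<sigma> hN r1(1) r(2) r1(3) r1(2) K(1) KD KX] by blast
  have err: "norm (poly (Q n) z * (z ^ k * g z) - poly (P n k \<alpha>) z) \<le> C * l1_norm M (Q n) * y ^ n"
    if n: "1 \<le> n" and z: "z \<in> K" for n z
  proof -
    have zR: "z \<in> D R" using KD z D_mono[of r R] r(2) by auto
    have "z \<notin> X" using z KX by auto
    then have "(\<Prod>\<xi>\<in>X. (z - \<xi>) ^ \<sigma> \<xi>) \<noteq> 0" using finite_poles by (subst prod_zero_iff) auto
    moreover have "z \<notin> Y" using \<open>z \<notin> X\<close> YX by auto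
    ultimately have "N z / (\<Prod>\<xi>\<in>X. (z - \<xi>) ^ \<sigma> \<xi>) = g z" using N(2)[of z] zR gf[of z] DR by auto
    then show ?thesis using C(2)[OF n QP[OF n] z] by (simp add: mult.assoc)
  qed
  have dn: "denom n (Q n)" if "1 \<le> n" for n by (rule pade_faber_denom[OF QP[OF that] that])
  have lc: "lead_coeff (Q n) = 1" if "1 \<le> n" for n using QP[OF that] by (simp add: pade_faber_def)
  obtain n1 B where B: "\<And>n q. n1 \<le> n \<Longrightarrow> denom n q \<Longrightarrow> q \<noteq> 0 \<Longrightarrow> degree q = M"
    "\<And>n q. n1 \<le> n \<Longrightarrow> denom n q \<Longrightarrow> lead_coeff q = 1 \<Longrightarrow> l1_norm M q \<le> B"
    using denom_eventually_unique by metis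
  have cM: "coeff (Q n) M = 1" if "max 1 n1 \<le> n" for n
  proof -
    have "Q n \<noteq> 0" using lc[of n] that by auto
    then show ?thesis using B(1)[of n "Q n"] dn[of n] lc[of n] that by simp
  qed
  have "\<exists>c>0. \<forall>z\<in>K. c \<le> norm (poly QF z)"
  proof (cases "K = {}")
    case False
    have "continuous_on K (\<lambda>z. norm (poly QF z))" by (intro continuous_intros)
    from continuous_attains_inf[OF K(1) False this]
    obtain z0 where "z0 \<in> K" "\<And>z. z \<in> K \<Longrightarrow> norm (poly QF z0) \<le> norm (poly QF z)" by blast
    then show ?thesis using QF_facts(5)[of z0] KX by (intro exI[of _ "norm (poly QF z0)"]) auto
  qed (auto intro: exI[of _ 1])
  then obtain c where c: "c > 0" "\<And>z. z \<in> K \<Longrightarrow> c \<le> norm (poly QF z)" by blast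
  obtain b where b: "\<And>z. z \<in> K \<Longrightarrow> norm z \<le> b" using compact_imp_bounded[OF K(1)] by (auto simp: bounded_iff)
  define b' where "b' = max 1 b"
  obtain \<theta> where \<theta>: "\<theta>\<^sub>0 < ereal \<theta>" "ereal \<theta> < 1" using ereal_dense2[OF theta0(2)] by blast
  have t: "0 \<le> \<theta>" "\<theta> < 1" using \<theta> theta0(1) by (auto simp: one_ereal_def dest: le_less_trans)
  obtain C2 where C2: "C2 \<ge> 0" "\<And>n q. denom n q \<Longrightarrow> l1_norm M (q - smult (coeff q M) QF) \<le> C2 * l1_norm M q * \<theta> ^ n"
    using denom_rate[OF \<theta>(1)] by blast
  have B0: "0 \<le> B" using B(2)[OF _ dn lc, of "max 1 n1"] l1_norm_nonneg[of M "Q (max 1 n1)"] by auto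
  have "(\<lambda>n. C2 * B * \<theta> ^ n * b' ^ M) \<longlonglongrightarrow> C2 * B * 0 * b' ^ M"
    by (intro tendsto_intros LIMSEQ_power_zero) (use t in auto)
  then have "\<forall>\<^sub>F n in sequentially. C2 * B * \<theta> ^ n * b' ^ M < c / 2" by (intro order_tendstoD) (use c in auto)
  then obtain n2 where n2: "\<And>n. n2 \<le> n \<Longrightarrow> C2 * B * \<theta> ^ n * b' ^ M < c / 2" by (auto simp: eventually_sequentially)
  \<comment> \<open>Convergence of the denominators to \<open>QF\<close>, which has no zero on K,
    keeps them uniformly away from 0 on K for large n.\<close>
  have Qlow: "c / 2 \<le> norm (poly (Q n) z)" if n: "max (max 1 n1) n2 \<le> n" and z: "z \<in> K" for n z
  proof -
    have d: "denom n (Q n)" using dn n by simp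
    have "l1_norm M (Q n - QF) \<le> C2 * l1_norm M (Q n) * \<theta> ^ n" using C2(2)[OF d] cM[of n] n by simp
    also have "\<dots> \<le> C2 * B * \<theta> ^ n"
      using B(2)[OF _ d lc] n C2(1) t by (intro mult_right_mono mult_left_mono) auto
    finally have l: "l1_norm M (Q n - QF) \<le> C2 * B * \<theta> ^ n" .
    have "degree (Q n - QF) \<le> M" using d QF_facts(1) by (intro degree_diff_le) (auto simp: denom_def)
    then have "norm (poly (Q n - QF) z) \<le> l1_norm M (Q n - QF) * b' ^ M"
      by (rule poly_le_l1_norm) (use b[OF z] in \<open>auto simp: b'_def\<close>)
    also have "\<dots> \<le> C2 * B * \<theta> ^ n * b' ^ M" by (intro mult_right_mono l) (auto simp: b'_def)
    also have "\<dots> < c / 2" using n2 n by simp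
    finally have "norm (poly (Q n) z - poly QF z) < c / 2" by simp
    then show ?thesis using c(2)[OF z] norm_triangle_ineq3[of "poly (Q n) z" "poly QF z"] by linarith
  qed
  have "limsup (\<lambda>n. ereal (x n powr (1 / real n))) \<le> ereal y"
  proof (rule limsup_root_le[of "max (max 1 n1) n2" x "C * B / (c / 2)" y, OF _ y0(1)])
    fix n assume n: "max (max 1 n1) n2 \<le> n"
    define e where "e = (\<lambda>z. poly (P n k \<alpha>) z / poly (Q n) z - z ^ k * g z)"
    define T where "T = C * B / (c / 2) * y ^ n"
    have T0: "0 \<le> T" using C(1) B0 c(1) y0(1) by (simp add: T_def)
    have le: "norm (e z) \<le> T" if z: "z \<in> K" for z
    proof -
      have q0: "poly (Q n) z \<noteq> 0" using Qlow[OF n z] c(1) by auto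
      have "norm (e z) * norm (poly (Q n) z) = norm (poly (Q n) z * (z ^ k * g z) - poly (P n k \<alpha>) z)"
      proof -
        have "e z * poly (Q n) z = - (poly (Q n) z * (z ^ k * g z) - poly (P n k \<alpha>) z)"
          unfolding e_def using q0 by (simp add: left_diff_distrib)
        then show ?thesis by (simp only: norm_mult[symmetric] norm_minus_cancel)
      qed
      also have "\<dots> \<le> C * l1_norm M (Q n) * y ^ n" by (rule err) (use n z in auto)
      also have "\<dots> \<le> C * B * y ^ n"
        using B(2)[OF _ dn lc] n C(1) y0 by (intro mult_right_mono mult_left_mono) auto
      finally have 1: "norm (e z) * norm (poly (Q n) z) \<le> C * B * y ^ n" .
      have "norm (e z) * (c / 2) \<le> norm (e z) * norm (poly (Q n) z)" by (intro mult_left_mono Qlow[OF n z]) auto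
      then have "norm (e z) * (c / 2) \<le> C * B * y ^ n" using 1 by linarith
      then have "norm (e z) \<le> C * B * y ^ n / (c / 2)" using c(1) by (simp add: pos_le_divide_eq)
      then show ?thesis by (simp add: T_def mult_ac)
    qed
    have xn: "x n = Sup (insert 0 ((\<lambda>z. norm (e z)) ` K))" by (simp add: x_def sup_norm_def e_def)
    have "x n \<le> T" unfolding xn by (rule cSup_least) (use le T0 in auto)
    moreover have "0 \<le> x n" unfolding xn by (rule cSup_upper) (use le T0 in \<open>auto intro!: bdd_aboveI[of _ T]\<close>)
    ultimately show "0 \<le> x n \<and> x n \<le> C * B / (c / 2) * y ^ n" by (simp add: T_def)
  qed
  then show False using y(2) by simp
qed

section \<open>Uniqueness of the solutions and the exact rate of the denominators\<close>

lemma pade_faber_eventually_unique: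
  "\<exists>n0\<ge>1. \<forall>n\<ge>n0. \<forall>q p q' p'. pade_faber E \<Phi> d m F n q p \<longrightarrow> pade_faber E \<Phi> d m F n q' p' \<longrightarrow>
     q = q' \<and> (\<forall>\<alpha>\<in>{1..d}. \<forall>k<m \<alpha>. p k \<alpha> = p' k \<alpha>)"
proof -
  obtain n0 where u: "\<And>n q q'. n0 \<le> n \<Longrightarrow> denom n q \<Longrightarrow> denom n q' \<Longrightarrow> lead_coeff q = 1 \<Longrightarrow> lead_coeff q' = 1 \<Longrightarrow> q = q'"
    by (rule denom_eventually_unique) (rule that)
  show ?thesis
  proof (intro exI[of _ "max 1 n0"] conjI allI impI ballI)
    fix n q p q' p' assume n: "max 1 n0 \<le> n" and a: "pade_faber E \<Phi> d m F n q p" "pade_faber E \<Phi> d m F n q' p'"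
    show qq: "q = q'"
      by (rule u[of n]) (use n a pade_faber_denom[OF a(1)] pade_faber_denom[OF a(2)] in \<open>auto simp: pade_faber_def\<close>)
    fix \<alpha> k assume \<alpha>: "\<alpha> \<in> {1..d}" "k < m \<alpha>"
    define \<Delta> where "\<Delta> = p k \<alpha> - p' k \<alpha>"
    have d: "degree (p k \<alpha>) \<le> n - 1" "degree (p' k \<alpha>) \<le> n - 1"
      "\<And>j. j \<le> n \<Longrightarrow> cf (poly (p k \<alpha>)) r0 j = cf (poly (p' k \<alpha>)) r0 j"
      using a \<alpha> unfolding pade_faber_iff qq by auto
    have dd: "degree \<Delta> \<le> n - 1" unfolding \<Delta>_def by (intro degree_diff_le d)
    have "\<Delta> = 0"
    proof (rule cf_poly_eq_0[OF r0(1)])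
      fix j assume "j \<le> degree \<Delta>"
      then have "j \<le> n" using dd by simp
      have "cf (\<lambda>z. poly (p k \<alpha>) z - poly (p' k \<alpha>) z) r0 j = cf (poly (p k \<alpha>)) r0 j - cf (poly (p' k \<alpha>)) r0 j"
        by (rule cf_diff[OF holomorphic_poly_D holomorphic_poly_D r0])
      then show "cf (poly \<Delta>) r0 j = 0" using d(3)[OF \<open>j \<le> n\<close>] by (simp add: \<Delta>_def)
    qed
    then show "p k \<alpha> = p' k \<alpha>" by (simp add: \<Delta>_def)
  qed simp
qed

text \<open>Upper bound: the leading coefficient is eventually the one of degree M and equals 1, so
  the remainder modulo \<open>QF\<close> is Q_n - \<open>QF\<close>. Lower bound: a limit superior
  below some \<theta> < \<open>\<theta>\<^sub>0\<close> would give a rate excluded by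
  \<open>theta0_le\<close>. The two coefficient norms differ by a factor at most M + 1.\<close>

lemma denominator_limsup:
  assumes QP: "\<And>n. 1 \<le> n \<Longrightarrow> pade_faber E \<Phi> d m F n (Q n) (P n)"
  shows "limsup (\<lambda>n. ereal (coeff_norm (Q n - QF) powr (1 / real n))) = \<theta>\<^sub>0"
proof -
  define x where "x = (\<lambda>n. coeff_norm (Q n - QF))"
  have x0: "0 \<le> x n" for n by (simp add: x_def coeff_norm_nonneg)
  have dn: "denom n (Q n)" if "1 \<le> n" for n by (rule pade_faber_denom[OF QP[OF that] that])
  have lc: "lead_coeff (Q n) = 1" if "1 \<le> n" for n using QP[OF that] by (simp add: pade_faber_def)
  have deg: "degree (Q n - QF) \<le> M" if "1 \<le> n" for n
    using dn[OF that] QF_facts(1) by (intro degree_diff_le) (auto simp: denom_def)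
  obtain n1 B where B: "\<And>n q. n1 \<le> n \<Longrightarrow> denom n q \<Longrightarrow> q \<noteq> 0 \<Longrightarrow> degree q = M"
    "\<And>n q. n1 \<le> n \<Longrightarrow> denom n q \<Longrightarrow> lead_coeff q = 1 \<Longrightarrow> l1_norm M q \<le> B"
    using denom_eventually_unique by metis
  have cM: "coeff (Q n) M = 1" if "max 1 n1 \<le> n" for n
  proof -
    have "Q n \<noteq> 0" using lc[of n] that by auto
    then show ?thesis using B(1)[of n "Q n"] dn[of n] lc[of n] that by simp
  qed
  have upper: "limsup (\<lambda>n. ereal (x n powr (1 / real n))) \<le> ereal \<theta>" if \<theta>: "\<theta>\<^sub>0 < ereal \<theta>" for \<theta>
  proof -
    have t: "0 < \<theta>" using \<theta> theta0(1) by (metis ereal_less(2) le_less_trans)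
    obtain C where C: "C \<ge> 0" "\<And>n q. denom n q \<Longrightarrow> l1_norm M (q - smult (coeff q M) QF) \<le> C * l1_norm M q * \<theta> ^ n"
      using denom_rate[OF \<theta>] by blast
    show ?thesis
    proof (rule limsup_root_le[of "max 1 n1" x "C * B" \<theta>, OF _ t])
      fix n assume n: "max 1 n1 \<le> n"
      have "x n \<le> l1_norm M (Q n - QF)" unfolding x_def using deg n by (intro coeff_norm_le_l1) auto
      also have "\<dots> \<le> C * l1_norm M (Q n) * \<theta> ^ n" using C(2)[OF dn, of n] cM[OF n] n by simp
      also have "\<dots> \<le> C * B * \<theta> ^ n"
        using B(2)[OF _ dn lc] n C(1) t by (intro mult_right_mono mult_left_mono) auto
      finally show "0 \<le> x n \<and> x n \<le> C * B * \<theta> ^ n" using x0 by simp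
    qed
  qed
  have "limsup (\<lambda>n. ereal (x n powr (1 / real n))) \<le> \<theta>\<^sub>0"
  proof (rule ccontr)
    assume "\<not> ?thesis"
    then obtain \<theta> where "\<theta>\<^sub>0 < ereal \<theta>" "ereal \<theta> < limsup (\<lambda>n. ereal (x n powr (1 / real n)))"
      using ereal_dense2[of "\<theta>\<^sub>0"] by (auto simp: not_le)
    then show False using upper[of \<theta>] by simp
  qed
  moreover have "\<theta>\<^sub>0 \<le> limsup (\<lambda>n. ereal (x n powr (1 / real n)))"
  proof (rule ccontr)
    assume "\<not> ?thesis"
    then obtain \<theta> where \<theta>: "limsup (\<lambda>n. ereal (x n powr (1 / real n))) < ereal \<theta>" "ereal \<theta> < \<theta>\<^sub>0"
      using ereal_dense2[of _ "\<theta>\<^sub>0"] by (auto simp: not_le)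
    have "0 \<le> limsup (\<lambda>n. ereal (x n powr (1 / real n)))"
      by (rule le_Limsup) (auto intro!: always_eventually)
    then have t: "0 < \<theta>" using \<theta>(1) by (metis ereal_less(2) le_less_trans)
    obtain n2 where n2: "\<And>n. n2 \<le> n \<Longrightarrow> x n \<le> \<theta> ^ n" using limsup_root_less[OF \<theta>(1) x0] by blast
    have "\<theta>\<^sub>0 \<le> ereal \<theta>"
    proof (rule theta0_le[of "max 1 n2" Q "real M + 1", OF _ t])
      fix n assume n: "max 1 n2 \<le> n"
      have "l1_norm M (Q n - QF) \<le> (real M + 1) * x n" unfolding x_def by (rule l1_norm_le_coeff_norm)
      also have "\<dots> \<le> (real M + 1) * \<theta> ^ n" using n2 n by (intro mult_left_mono) auto
      finally show "denom n (Q n) \<and> l1_norm M (Q n - QF) \<le> (real M + 1) * \<theta> ^ n" using dn n by simp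
    qed
    then show False using \<theta>(2) by simp
  qed
  ultimately show ?thesis unfolding x_def by (rule antisym)
qed

end

theorem theorem1p1:
  fixes E :: "complex set"
    and \<Phi> :: "complex \<Rightarrow> complex"
    and d :: nat
    and m :: "nat \<Rightarrow> nat"
    and F :: "nat \<Rightarrow> complex \<Rightarrow> complex"
    and Q :: "nat \<Rightarrow> complex poly"
    and P :: "nat \<Rightarrow> nat \<Rightarrow> nat \<Rightarrow> complex poly"
  assumes "compact E" and "\<exists>a\<in>E. \<exists>b\<in>E. a \<noteq> b" and "0 \<in> E"
    and "simply_connected_space (sphere_complement E)"
    and "exterior_map E \<Phi>"
    and "1 \<le> d"
    and "\<And>\<alpha>. \<alpha> \<in> {1..d} \<Longrightarrow> F \<alpha> analytic_on E"
    and "\<And>\<alpha>. \<alpha> \<in> {1..d} \<Longrightarrow> 1 \<le> m \<alpha>"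
    and "finite (system_poles E \<Phi> d m F)"
    and "(\<Sum>\<xi>\<in>system_poles E \<Phi> d m F. system_order E \<Phi> d m F \<xi>) = msize d m"
    and "\<And>n. 1 \<le> n \<Longrightarrow> pade_faber E \<Phi> d m F n (Q n) (P n)"
  shows "(\<forall>\<^sub>F n in sequentially.
            (\<exists>!q. \<exists>p. pade_faber E \<Phi> d m F n q p) \<and>
            (\<forall>\<alpha>\<in>{1..d}. \<exists>!r. \<exists>q p. pade_faber E \<Phi> d m F n q p \<and> r = Fract (p 0 \<alpha>) q))
       \<and> limsup (\<lambda>n. ereal (coeff_norm (Q n - system_pole_poly E \<Phi> d m F) powr (1 / real n)))
           = Max ((\<lambda>\<xi>. ereal (norm (\<Phi> \<xi>)) / bold_rho E \<Phi> d m F \<xi>) ` system_poles E \<Phi> d m F)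
       \<and> (\<forall>\<alpha>\<in>{1..d}. \<forall>k<m \<alpha>. \<forall>K.
            compact K \<and> K \<subseteq> D_star E \<Phi> d m F \<alpha> - system_poles E \<Phi> d m F \<longrightarrow>
            limsup (\<lambda>n. ereal (sup_norm K
                (\<lambda>z. poly (P n k \<alpha>) z / poly (Q n) z
                       - z ^ k * mero_ext E (D_star E \<Phi> d m F \<alpha>) (F \<alpha>) z) powr (1 / real n)))
              \<le> ereal (Phi_norm E \<Phi> K) / rho_star E \<Phi> d m F \<alpha>)"
proof -
  interpret faber_system E \<Phi> d m F
    by unfold_locales (fact assms)+
  obtain n0 where n0: "1 \<le> n0" "\<And>n q p q' p'. n0 \<le> n \<Longrightarrow> pade_faber E \<Phi> d m F n q p \<Longrightarrow> pade_faber E \<Phi> d m F n q' p' \<Longrightarrow>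
     q = q' \<and> (\<forall>\<alpha>\<in>{1..d}. \<forall>k<m \<alpha>. p k \<alpha> = p' k \<alpha>)"
    using pade_faber_eventually_unique by blast
  have "(\<exists>!q. \<exists>p. pade_faber E \<Phi> d m F n q p) \<and>
            (\<forall>\<alpha>\<in>{1..d}. \<exists>!r. \<exists>q p. pade_faber E \<Phi> d m F n q p \<and> r = Fract (p 0 \<alpha>) q)" if n: "n0 \<le> n" for n
  proof (intro conjI ballI)
    have pf: "pade_faber E \<Phi> d m F n (Q n) (P n)" by (rule assms(11)) (use n n0 in simp)
    show "\<exists>!q. \<exists>p. pade_faber E \<Phi> d m F n q p"
      using pf n0(2)[OF n _ pf] by blast
    fix \<alpha> assume \<alpha>: "\<alpha> \<in> {1..d}"
    \<comment> \<open>Makes k = 0 an admissible index, so that the uniqueness of numerators covers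
      the one in the approximant.\<close>
    have m0: "0 < m \<alpha>" using m_pos[OF \<alpha>] by simp
    show "\<exists>!r. \<exists>q p. pade_faber E \<Phi> d m F n q p \<and> r = Fract (p 0 \<alpha>) q"
    proof (rule ex1I[of _ "Fract (P n 0 \<alpha>) (Q n)"])
      show "\<exists>q p. pade_faber E \<Phi> d m F n q p \<and> Fract (P n 0 \<alpha>) (Q n) = Fract (p 0 \<alpha>) q" using pf by blast
      fix r assume "\<exists>q p. pade_faber E \<Phi> d m F n q p \<and> r = Fract (p 0 \<alpha>) q"
      then obtain q p where qp: "pade_faber E \<Phi> d m F n q p" "r = Fract (p 0 \<alpha>) q" by blast
      then show "r = Fract (P n 0 \<alpha>) (Q n)" using n0(2)[OF n qp(1) pf] \<alpha> m0 by auto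
    qed
  qed
  then have "\<forall>\<^sub>F n in sequentially. (\<exists>!q. \<exists>p. pade_faber E \<Phi> d m F n q p) \<and>
            (\<forall>\<alpha>\<in>{1..d}. \<exists>!r. \<exists>q p. pade_faber E \<Phi> d m F n q p \<and> r = Fract (p 0 \<alpha>) q)"
    unfolding eventually_sequentially by blast
  moreover note denominator_limsup[OF assms(11), unfolded \<theta>\<^sub>0_def]
  ultimately show ?thesis using approximant_limsup_le[OF _ _ _ _ assms(11)] by blast
qed

end
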